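(* Let $A$ be a small set, $p(x),q(y)$ global $A$-invariant types, and $r\in S_{pq}(A)$ such that $p\cup r\vdash q$. (1) If $A=M$ is a model and $p$ is finitely satisfiable in $M$, then so is $q$. (2) If $p$ is definable over $A$, then so is $q$. (3) If $A=M$ is a model and $p$ is generically stable over $M$, then so is $q$.
   Context: $T$ is a complete first-order theory with infinite models in a language $L$, $\mathfrak U$ a monster model; $A\subseteq\mathfrak U$ is small if $\mathfrak U$ is $|A|^+$-saturated and $|A|^+$-strongly homogeneous; models $M$ considered are small elementary substructures of $\mathfrak U$. Global types are complete types over $\mathfrak U$; a global type $p$ is $A$-invariant if fixed by all automorphisms of $\mathfrak U$ fixing $A$ pointwise. For $p$ $A$-invariant and $B\supseteq\mathfrak U$, $p\mid B$ is its unique $A$-invariant extension; $p(x)\otimes q(y)$ is the global type with $\varphi(x,y)\in p\otimes q$ iff $\varphi(x,b)\in p\mid\mathfrak U b$ for $b\models q$; $p^{(1)}=p(x^0)$, $p^{(n+1)}=p(x^n)\otimes p^{(n)}(x^{n-1},\dots,x^0)$. $S_{pq}(A)$ is the set of complete types $r(x,y)$ over $A$ containing $(p\restriction A)\cup(q\restriction A)$. A (partial) type is finitely satisfiable in $M$ if every finite conjunction of its formulas is satisfied by a tuple from $M$. For $A$-invariant $p$ and $\psi(x;y)\in L$, $d_p\psi=\{\mathrm{tp}(b/A): b\in\mathfrak U,\ \psi(x;b)\in p\}$; $p$ is definable over $A$ if it is $A$-invariant and for every $\psi(x;y)\in L$ the set $d_p\psi\subseteq S_y(A)$ is clopen. A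 Morley sequence of an $A$-invariant $p$ over $A$ is an $A$-indiscernible sequence $\langle a^i: i\in I\rangle$ such that for $i_0<\dots<i_{n-1}$ in $I$, $\mathrm{tp}(a^{i_{n-1}},\dots,a^{i_0}/A)=p^{(n)}\restriction A$. $p$ is generically stable over $A$ if it is $A$-invariant and for every ordinal $\alpha\ge\omega$ and every Morley sequence $\langle a^i:i<\alpha\rangle$ of $p$ over $A$, the set of $L(\mathfrak U)$-formulas true of all but finitely many $a^i$ is a complete global type. *)

theory Defs
  imports "HOL-Analysis.Analysis"
begin

section \<open>First-order logic\<close>

(* A symbol is a name together with its arity; constants are function symbols of arity 0. *)
record ('f, 'r) lang =
  funs :: "('f \<times> nat) set"
  rels :: "('r \<times> nat) set"

(* Variables are de Bruijn indices. Par c is the name of the element c of the structure. *)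
datatype ('f, 'r, 'a) tm =
  Var nat
| Par 'a
| Fn 'f "('f, 'r, 'a) tm list"

datatype ('f, 'r, 'a) fm =
  Fls
| Eq "('f, 'r, 'a) tm" "('f, 'r, 'a) tm"
| Rl 'r "('f, 'r, 'a) tm list"
| Imp "('f, 'r, 'a) fm" "('f, 'r, 'a) fm"
| All "('f, 'r, 'a) fm"

abbreviation Neg :: "('f, 'r, 'a) fm \<Rightarrow> ('f, 'r, 'a) fm"
  where "Neg \<phi> \<equiv> Imp \<phi> Fls"

(* t is an L(B)-term with variables among 0, ..., n - 1 *)
fun tm_in :: "('f, 'r) lang \<Rightarrow> 'a set \<Rightarrow> nat \<Rightarrow> ('f, 'r, 'a) tm \<Rightarrow> bool" where
  "tm_in L B n (Var i) \<longleftrightarrow> i < n"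
| "tm_in L B n (Par c) \<longleftrightarrow> c \<in> B"
| "tm_in L B n (Fn f ts) \<longleftrightarrow> (f, length ts) \<in> funs L \<and> (\<forall>t\<in>set ts. tm_in L B n t)"

fun fm_in :: "('f, 'r) lang \<Rightarrow> 'a set \<Rightarrow> nat \<Rightarrow> ('f, 'r, 'a) fm \<Rightarrow> bool" where
  "fm_in L B n Fls \<longleftrightarrow> True"
| "fm_in L B n (Eq s t) \<longleftrightarrow> tm_in L B n s \<and> tm_in L B n t"
| "fm_in L B n (Rl R ts) \<longleftrightarrow> (R, length ts) \<in> rels L \<and> (\<forall>t\<in>set ts. tm_in L B n t)"
| "fm_in L B n (Imp \<phi> \<psi>) \<longleftrightarrow> fm_in L B n \<phi> \<and> fm_in L B n \<psi>"
| "fm_in L B n (All \<phi>) \<longleftrightarrow> fm_in L B (Suc n) \<phi>"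

(* L(B)-formulas with free variables among 0, ..., n - 1; the L-formulas are those with B = {} *)
definition formulas :: "('f, 'r) lang \<Rightarrow> 'a set \<Rightarrow> nat \<Rightarrow> ('f, 'r, 'a) fm set"
  where "formulas L B n = {\<phi>. fm_in L B n \<phi>}"

fun tsubst :: "(nat \<Rightarrow> ('f, 'r, 'a) tm) \<Rightarrow> ('f, 'r, 'a) tm \<Rightarrow> ('f, 'r, 'a) tm" where
  "tsubst \<sigma> (Var i) = \<sigma> i"
| "tsubst \<sigma> (Par c) = Par c"
| "tsubst \<sigma> (Fn f ts) = Fn f (map (tsubst \<sigma>) ts)"

definition lift_subst :: "(nat \<Rightarrow> ('f, 'r, 'a) tm) \<Rightarrow> nat \<Rightarrow> ('f, 'r, 'a) tm"
  where "lift_subst \<sigma> = case_nat (Var 0) (\<lambda>i. tsubst (\<lambda>j. Var (Suc j)) (\<sigma> i))"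

fun subst :: "(nat \<Rightarrow> ('f, 'r, 'a) tm) \<Rightarrow> ('f, 'r, 'a) fm \<Rightarrow> ('f, 'r, 'a) fm" where
  "subst \<sigma> Fls = Fls"
| "subst \<sigma> (Eq s t) = Eq (tsubst \<sigma> s) (tsubst \<sigma> t)"
| "subst \<sigma> (Rl R ts) = Rl R (map (tsubst \<sigma>) ts)"
| "subst \<sigma> (Imp \<phi> \<psi>) = Imp (subst \<sigma> \<phi>) (subst \<sigma> \<psi>)"
| "subst \<sigma> (All \<phi>) = All (subst (lift_subst \<sigma>) \<phi>)"

(* For \<phi>(x, y) with x the variables 0, ..., n - 1 and y the following ones: the formula \<phi>(x, b) *)
definition inst :: "nat \<Rightarrow> 'a list \<Rightarrow> ('f, 'r, 'a) fm \<Rightarrow> ('f, 'r, 'a) fm"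
  where "inst n b = subst (\<lambda>i. if i < n then Var i else Par (b ! (i - n)))"

(* A formula or type in y = (0, 1, ...) becomes one in y = (m, m + 1, ...). *)
definition shift :: "nat \<Rightarrow> ('f, 'r, 'a) fm \<Rightarrow> ('f, 'r, 'a) fm"
  where "shift m = subst (\<lambda>i. Var (m + i))"

record ('f, 'r, 'a) struct =
  univ :: "'a set"
  fn :: "'f \<Rightarrow> 'a list \<Rightarrow> 'a"
  rel :: "'r \<Rightarrow> 'a list \<Rightarrow> bool"

definition tuples :: "nat \<Rightarrow> 'a set \<Rightarrow> 'a list set"
  where "tuples n B = {b. length b = n \<and> set b \<subseteq> B}"

definition is_struct :: "('f, 'r) lang \<Rightarrow> ('f, 'r, 'a) struct \<Rightarrow> bool" where
  "is_struct L S \<longleftrightarrow> univ S \<noteq> {} \<and>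
     (\<forall>(f, k)\<in>funs L. \<forall>b\<in>tuples k (univ S). fn S f b \<in> univ S)"

fun tval :: "('f, 'r, 'a) struct \<Rightarrow> (nat \<Rightarrow> 'a) \<Rightarrow> ('f, 'r, 'a) tm \<Rightarrow> 'a" where
  "tval S e (Var i) = e i"
| "tval S e (Par c) = c"
| "tval S e (Fn f ts) = fn S f (map (tval S e) ts)"

fun sat :: "('f, 'r, 'a) struct \<Rightarrow> (nat \<Rightarrow> 'a) \<Rightarrow> ('f, 'r, 'a) fm \<Rightarrow> bool" where
  "sat S e Fls \<longleftrightarrow> False"
| "sat S e (Eq s t) \<longleftrightarrow> tval S e s = tval S e t"
| "sat S e (Rl R ts) \<longleftrightarrow> rel S R (map (tval S e) ts)"
| "sat S e (Imp \<phi> \<psi>) \<longleftrightarrow> (sat S e \<phi> \<longrightarrow> sat S e \<psi>)"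
| "sat S e (All \<phi>) \<longleftrightarrow> (\<forall>a\<in>univ S. sat S (case_nat a e) \<phi>)"

(* The tuple a satisfies every formula of \<Phi>. *)
definition realizes :: "('f, 'r, 'a) struct \<Rightarrow> 'a list \<Rightarrow> ('f, 'r, 'a) fm set \<Rightarrow> bool"
  where "realizes S a \<Phi> \<longleftrightarrow> (\<forall>\<phi>\<in>\<Phi>. sat S ((!) a) \<phi>)"

(* For atomic formulas the last clause says that S is a substructure of N. *)
definition elementary_sub ::
    "('f, 'r) lang \<Rightarrow> ('f, 'r, 'a) struct \<Rightarrow> ('f, 'r, 'a) struct \<Rightarrow> bool" where
  "elementary_sub L S N \<longleftrightarrow> is_struct L S \<and> is_struct L N \<and> univ S \<subseteq> univ N \<and>
     (\<forall>k. \<forall>\<phi>\<in>formulas L {} k. \<forall>a\<in>tuples k (univ S). sat S ((!) a) \<phi> \<longleftrightarrow> sat N ((!) a) \<phi>)"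

definition model :: "('f, 'r) lang \<Rightarrow> ('f, 'r, 'a) struct \<Rightarrow> 'a set \<Rightarrow> bool"
  where "model L U M \<longleftrightarrow> M \<subseteq> univ U \<and> elementary_sub L (U\<lparr>univ := M\<rparr>) U"

definition automorphism :: "('f, 'r) lang \<Rightarrow> ('f, 'r, 'a) struct \<Rightarrow> ('a \<Rightarrow> 'a) \<Rightarrow> bool" where
  "automorphism L U g \<longleftrightarrow> bij_betw g (univ U) (univ U) \<and>
     (\<forall>(f, k)\<in>funs L. \<forall>b\<in>tuples k (univ U). g (fn U f b) = fn U f (map g b)) \<and>
     (\<forall>(R, k)\<in>rels L. \<forall>b\<in>tuples k (univ U). rel U R b \<longleftrightarrow> rel U R (map g b))"

section \<open>Types\<close>

definition fin_sat_in ::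
    "('f, 'r, 'a) struct \<Rightarrow> nat \<Rightarrow> ('f, 'r, 'a) fm set \<Rightarrow> 'a set \<Rightarrow> bool" where
  "fin_sat_in S n \<Phi> M \<longleftrightarrow> (\<forall>F. finite F \<and> F \<subseteq> \<Phi> \<longrightarrow> (\<exists>a\<in>tuples n M. realizes S a F))"

(* The space S_n(B) of complete types over B in the variables 0, ..., n - 1, as computed in S.
   Global types are the elements of types L U n (univ U). *)
definition types ::
    "('f, 'r) lang \<Rightarrow> ('f, 'r, 'a) struct \<Rightarrow> nat \<Rightarrow> 'a set \<Rightarrow> ('f, 'r, 'a) fm set set" where
  "types L S n B = {s. s \<subseteq> formulas L B n \<and> fin_sat_in S n s (univ S) \<and>
     (\<forall>\<phi>\<in>formulas L B n. \<phi> \<in> s \<or> Neg \<phi> \<in> s)}"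

definition tp ::
    "('f, 'r) lang \<Rightarrow> ('f, 'r, 'a) struct \<Rightarrow> 'a list \<Rightarrow> 'a set \<Rightarrow> ('f, 'r, 'a) fm set"
  where "tp L S b B = {\<phi> \<in> formulas L B (length b). sat S ((!) b) \<phi>}"

definition type_restrict ::
    "('f, 'r) lang \<Rightarrow> nat \<Rightarrow> ('f, 'r, 'a) fm set \<Rightarrow> 'a set \<Rightarrow> ('f, 'r, 'a) fm set"
  where "type_restrict L n p A = p \<inter> formulas L A n"

(* U is |A|^+-saturated and |A|^+-strongly homogeneous. As usual, these notions refer to an
   infinite cardinal, so |A|^+ is read as the least infinite cardinal above |A|: a set B has
   smaller cardinality than that iff B is finite or |B| <= |A|. *)
definition small :: "('f, 'r) lang \<Rightarrow> ('f, 'r, 'a) struct \<Rightarrow> 'a set \<Rightarrow> bool" where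
  "small L U A \<longleftrightarrow> A \<subseteq> univ U \<and>
     (\<forall>B \<subseteq> univ U. finite B \<or> (card_of B, card_of A) \<in> ordLeq \<longrightarrow>
        (\<forall>n. \<forall>s\<in>types L U n B. \<exists>b\<in>tuples n (univ U). realizes U b s) \<and>
        (\<forall>h. h ` B \<subseteq> univ U \<and>
             (\<forall>k. \<forall>\<phi>\<in>formulas L {} k. \<forall>b\<in>tuples k B.
                sat U ((!) b) \<phi> \<longleftrightarrow> sat U ((!) (map h b)) \<phi>) \<longrightarrow>
             (\<exists>g. automorphism L U g \<and> (\<forall>c\<in>B. g c = h c))))"

(* Invariance of a global type: the automorphism g maps \<phi>(x, d) to \<phi>(x, g d). *)
definition invariant ::
    "('f, 'r) lang \<Rightarrow> ('f, 'r, 'a) struct \<Rightarrow> 'a set \<Rightarrow> ('f, 'r, 'a) fm set \<Rightarrow> bool" where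
  "invariant L U A p \<longleftrightarrow>
     (\<forall>g. automorphism L U g \<and> (\<forall>c\<in>A. g c = c) \<longrightarrow> map_fm id id g ` p = p)"

definition types_extending ::
    "('f, 'r) lang \<Rightarrow> ('f, 'r, 'a) struct \<Rightarrow> nat \<Rightarrow> nat \<Rightarrow> 'a set \<Rightarrow>
     ('f, 'r, 'a) fm set \<Rightarrow> ('f, 'r, 'a) fm set \<Rightarrow> ('f, 'r, 'a) fm set set" where
  "types_extending L U m n A p q = {r \<in> types L U (m + n) A.
     type_restrict L m p A \<subseteq> r \<and> shift m ` type_restrict L n q A \<subseteq> r}"

(* \<Phi> entails \<Psi> (variables 0, ..., n - 1) modulo the elementary diagram of U; the finite subset F
   is the finite set of hypotheses used in a derivation. *)
definition entails ::
    "('f, 'r, 'a) struct \<Rightarrow> nat \<Rightarrow> ('f, 'r, 'a) fm set \<Rightarrow> ('f, 'r, 'a) fm set \<Rightarrow> bool" where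
  "entails U n \<Phi> \<Psi> \<longleftrightarrow> (\<forall>\<psi>\<in>\<Psi>. \<exists>F. finite F \<and> F \<subseteq> \<Phi> \<and>
     (\<forall>c\<in>tuples n (univ U). realizes U c F \<longrightarrow> sat U ((!) c) \<psi>))"

section \<open>Definable types\<close>

definition stone_topology ::
    "('f, 'r) lang \<Rightarrow> ('f, 'r, 'a) struct \<Rightarrow> nat \<Rightarrow> 'a set \<Rightarrow> ('f, 'r, 'a) fm set topology" where
  "stone_topology L U k A =
     topology_generated_by ((\<lambda>\<theta>. {s \<in> types L U k A. \<theta> \<in> s}) ` formulas L A k)"

(* Here p is a type in n variables, and \<psi>(x; y) has |y| = k. *)
definition d_set ::
    "('f, 'r) lang \<Rightarrow> ('f, 'r, 'a) struct \<Rightarrow> nat \<Rightarrow> nat \<Rightarrow> 'a set \<Rightarrow>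
     ('f, 'r, 'a) fm set \<Rightarrow> ('f, 'r, 'a) fm \<Rightarrow> ('f, 'r, 'a) fm set set" where
  "d_set L U n k A p \<psi> = {tp L U b A | b. b \<in> tuples k (univ U) \<and> inst n b \<psi> \<in> p}"

definition definable_over ::
    "('f, 'r) lang \<Rightarrow> ('f, 'r, 'a) struct \<Rightarrow> nat \<Rightarrow> 'a set \<Rightarrow> ('f, 'r, 'a) fm set \<Rightarrow> bool" where
  "definable_over L U n A p \<longleftrightarrow> invariant L U A p \<and>
     (\<forall>k. \<forall>\<psi>\<in>formulas L {} (n + k).
        openin (stone_topology L U k A) (d_set L U n k A p \<psi>) \<and>
        closedin (stone_topology L U k A) (d_set L U n k A p \<psi>))"

section \<open>Products and Morley sequences\<close>

(* Realizations of global types live in an elementary extension N of U; N stands for a larger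
   monster model, of which only the following is needed. *)
definition realizes_global_types ::
    "('f, 'r) lang \<Rightarrow> ('f, 'r, 'a) struct \<Rightarrow> ('f, 'r, 'a) struct \<Rightarrow> bool" where
  "realizes_global_types L U N \<longleftrightarrow> elementary_sub L U N \<and>
     (\<forall>n. \<forall>s\<in>types L U n (univ U). \<exists>b\<in>tuples n (univ N). realizes N b s)"

(* A-invariance of a type s in n variables over a subset B of N: whether \<psi>(x, b) belongs to s
   depends only on \<psi> and tp(b/A). Automorphisms are of no use for B not homogeneous. *)
definition invariant_over ::
    "('f, 'r) lang \<Rightarrow> ('f, 'r, 'a) struct \<Rightarrow> nat \<Rightarrow> 'a set \<Rightarrow> 'a set \<Rightarrow>
     ('f, 'r, 'a) fm set \<Rightarrow> bool" where
  "invariant_over L N n A B s \<longleftrightarrow>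
     (\<forall>k. \<forall>\<psi>\<in>formulas L {} (n + k). \<forall>b\<in>tuples k B. \<forall>b'\<in>tuples k B.
        tp L N b A = tp L N b' A \<longrightarrow> (inst n b \<psi> \<in> s \<longleftrightarrow> inst n b' \<psi> \<in> s))"

(* The type p | B, for B between U and N *)
definition invariant_ext ::
    "('f, 'r) lang \<Rightarrow> ('f, 'r, 'a) struct \<Rightarrow> nat \<Rightarrow> 'a set \<Rightarrow>
     ('f, 'r, 'a) fm set \<Rightarrow> 'a set \<Rightarrow> ('f, 'r, 'a) fm set" where
  "invariant_ext L N n A p B =
     (THE s. s \<in> types L N n B \<and> p \<subseteq> s \<and> invariant_over L N n A B s)"

(* p(x) \<otimes> q(y), with x = (0, ..., m - 1) and y = (m, ..., m + n - 1) *)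
definition tensor ::
    "('f, 'r) lang \<Rightarrow> ('f, 'r, 'a) struct \<Rightarrow> ('f, 'r, 'a) struct \<Rightarrow> 'a set \<Rightarrow> nat \<Rightarrow> nat \<Rightarrow>
     ('f, 'r, 'a) fm set \<Rightarrow> ('f, 'r, 'a) fm set \<Rightarrow> ('f, 'r, 'a) fm set" where
  "tensor L U N A m n p q = {\<phi> \<in> formulas L (univ U) (m + n).
     \<exists>b\<in>tuples n (univ N). realizes N b q \<and>
       inst m b \<phi> \<in> invariant_ext L N m A p (univ U \<union> set b)}"

(* p^(k) in the variables x^(k-1), ..., x^0, in this order; k = 0 is not used. *)
fun morley_power ::
    "('f, 'r) lang \<Rightarrow> ('f, 'r, 'a) struct \<Rightarrow> ('f, 'r, 'a) struct \<Rightarrow> 'a set \<Rightarrow> nat \<Rightarrow>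
     ('f, 'r, 'a) fm set \<Rightarrow> nat \<Rightarrow> ('f, 'r, 'a) fm set" where
  "morley_power L U N A m p 0 = {}"
| "morley_power L U N A m p (Suc 0) = p"
| "morley_power L U N A m p (Suc (Suc k)) =
     tensor L U N A m (Suc k * m) p (morley_power L U N A m p (Suc k))"

(* Strictly increasing finite sequences of indices, for a (reflexive) linear order I *)
definition increasing :: "'i rel \<Rightarrow> 'i list \<Rightarrow> bool" where
  "increasing I js \<longleftrightarrow> set js \<subseteq> Field I \<and> sorted_wrt (\<lambda>i j. (i, j) \<in> I \<and> i \<noteq> j) js"

definition indiscernible ::
    "('f, 'r) lang \<Rightarrow> ('f, 'r, 'a) struct \<Rightarrow> 'a set \<Rightarrow> 'i rel \<Rightarrow> ('i \<Rightarrow> 'a list) \<Rightarrow> bool" where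
  "indiscernible L U A I a \<longleftrightarrow>
     (\<forall>is js. increasing I is \<and> increasing I js \<and> length is = length js \<longrightarrow>
        tp L U (concat (map a is)) A = tp L U (concat (map a js)) A)"

definition morley_sequence ::
    "('f, 'r) lang \<Rightarrow> ('f, 'r, 'a) struct \<Rightarrow> ('f, 'r, 'a) struct \<Rightarrow> nat \<Rightarrow> 'a set \<Rightarrow>
     ('f, 'r, 'a) fm set \<Rightarrow> 'i rel \<Rightarrow> ('i \<Rightarrow> 'a list) \<Rightarrow> bool" where
  "morley_sequence L U N m A p I a \<longleftrightarrow>
     (\<forall>i\<in>Field I. a i \<in> tuples m (univ U)) \<and> indiscernible L U A I a \<and>
     (\<forall>is. increasing I is \<and> is \<noteq> [] \<longrightarrow>
        tp L U (concat (map a (rev is))) A =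
          type_restrict L (length is * m) (morley_power L U N A m p (length is)) A)"

(* The ordinals are the infinite well-orders on subsets of the type 'i, since one cannot quantify
   over types. A given ordinal embeds into a suitable 'i, so results polymorphic in 'i cover all
   ordinals; the notion is the same for all infinite 'i when U is aleph_1-saturated (a failure is
   visible on a subsequence of order type at most omega + omega). *)
definition generically_stable ::
    "'i itself \<Rightarrow> ('f, 'r) lang \<Rightarrow> ('f, 'r, 'a) struct \<Rightarrow> ('f, 'r, 'a) struct \<Rightarrow> nat \<Rightarrow> 'a set \<Rightarrow>
     ('f, 'r, 'a) fm set \<Rightarrow> bool" where
  "generically_stable _ L U N m A p \<longleftrightarrow> invariant L U A p \<and>
     (\<forall>(\<alpha> :: 'i rel) a. Well_order \<alpha> \<and> infinite (Field \<alpha>) \<and> morley_sequence L U N m A p \<alpha> a \<longrightarrow>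
        {\<phi> \<in> formulas L (univ U) m. finite {i \<in> Field \<alpha>. \<not> sat U ((!) (a i)) \<phi>}}
          \<in> types L U m (univ U))"

end

theory Submission
  imports Defs
begin

text \<open>Each formula of \<open>q\<close> follows from one of \<open>p\<close> together with some \<open>\<rho>(x, y) \<in> r\<close>, and
  \<open>\<exists>y. \<rho>(x, y)\<close> belongs to \<open>p\<close>. For finite satisfiability, realize the formula of \<open>p\<close> and
  \<open>\<exists>y. \<rho>(x, y)\<close> by a tuple \<open>a\<close> of the model, and then \<open>\<rho>(a, y)\<close>. For definability, the implication
  \<open>\<phi>(x, w) \<and> \<rho>(x, y) \<longrightarrow> \<psi>(y, z)\<close> together with the definition of \<open>\<phi>\<close> in \<open>p\<close> gives a neighbourhood
  within \<open>d\<^sub>q \<psi>\<close>. For generic stability, \<open>p \<union> r \<union> q\<close> is consistent, so any Morley sequence of \<open>q\<close> of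
  order type \<open>\<omega>\<close> can be moved to one paired through \<open>r\<close> with a Morley sequence of \<open>p\<close>; a formula of
  \<open>q\<close> failing along the former yields a formula of \<open>p\<close> failing along the latter, which is impossible
  since Morley sequences of a generically stable \<open>p\<close> converge to \<open>p\<close>.\<close>

section \<open>Formulas\<close>

text \<open>Morley powers are defined through an extension N of U and through types p | B given by a
  definite description. The bridge back to U: every type over A of a tuple of N is realized in U,
  and an invariant type sees parameters only through their type over A. So, over A, powers of p are
  computed from tuples of U (\<open>tensor_over_A\<close>). In part (3) the given Morley sequence of
  q is arbitrary, and no pairing through r can be read off along it; the pairing is built elsewhere
  by saturation and compared with the given sequence by strong homogeneity. Both apply to sets of
  size at most |A|, and countable sequences qualify because a model inside an infinite structure is
  infinite. Moreover, generic stability only says that the eventual formulas along a Morley sequence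
  form some complete type; that formulas of p are among them takes a sequence longer than omega. In
  part (2), consistency of p, r and q together turns a consequence of p and r back into a member of
  q.\<close>

lemma mem_formulas [simp]: "\<phi> \<in> formulas L B n \<longleftrightarrow> fm_in L B n \<phi>"
  by (simp add: formulas_def)

lemma mem_tuples [simp]: "b \<in> tuples n B \<longleftrightarrow> length b = n \<and> set b \<subseteq> B"
  by (simp add: tuples_def)

lemma tval_cong:
  assumes "tm_in L B n t" and "\<And>i. i < n \<Longrightarrow> e i = e' i"
  shows "tval S e t = tval S e' t"
  using assms(1)
proof (induction t)
  case (Fn f ts)
  then have "map (tval S e) ts = map (tval S e') ts" by auto
  then show ?case by (metis tval.simps(3))
qed (use assms(2) in auto)

lemma sat_cong:
  assumes "fm_in L B n \<phi>" and "\<And>i. i < n \<Longrightarrow> e i = e' i"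
  shows "sat S e \<phi> \<longleftrightarrow> sat S e' \<phi>"
  using assms
proof (induction \<phi> arbitrary: n e e')
  case (Eq s t)
  then show ?case using tval_cong[of L B n _ e e' S] by simp
next
  case (Rl R ts)
  then have "map (tval S e) ts = map (tval S e') ts"
    using tval_cong[of L B n _ e e' S] by auto
  then show ?case by (metis sat.simps(3))
next
  case (Imp \<phi> \<psi>)
  show ?case
    using Imp.IH(1)[of n e e'] Imp.IH(2)[of n e e'] Imp.prems by simp
next
  case (All \<phi>)
  have "sat S (case_nat a e) \<phi> \<longleftrightarrow> sat S (case_nat a e') \<phi>" for a
    by (rule All.IH[of "Suc n"]) (use All.prems in \<open>auto split: nat.split\<close>)
  then show ?case by simp
qed simp

lemma sat_append_left:
  assumes "fm_in L B n \<phi>" and "length a = n"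
  shows "sat S ((!) (a @ b)) \<phi> \<longleftrightarrow> sat S ((!) a) \<phi>"
  by (rule sat_cong[OF assms(1)]) (simp add: nth_append assms(2))

lemma tm_in_mono: "tm_in L B n t \<Longrightarrow> B \<subseteq> C \<Longrightarrow> n \<le> k \<Longrightarrow> tm_in L C k t"
  by (induction t) auto

lemma fm_in_mono: "fm_in L B n \<phi> \<Longrightarrow> B \<subseteq> C \<Longrightarrow> n \<le> k \<Longrightarrow> fm_in L C k \<phi>"
proof (induction \<phi> arbitrary: n k)
  case (All \<phi>)
  then show ?case using All.IH[of "Suc n" "Suc k"] by simp
qed (auto simp: tm_in_mono[of L B n _ C k for n k])

lemma tval_tsubst: "tval S e (tsubst \<sigma> t) = tval S (\<lambda>i. tval S e (\<sigma> i)) t"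
proof (induction t)
  case (Fn f ts)
  then have "map (tval S e \<circ> tsubst \<sigma>) ts = map (tval S (\<lambda>i. tval S e (\<sigma> i))) ts" by auto
  then show ?case by (simp del: map_eq_conv)
qed auto

lemma sat_subst: "sat S e (subst \<sigma> \<phi>) \<longleftrightarrow> sat S (\<lambda>i. tval S e (\<sigma> i)) \<phi>"
proof (induction \<phi> arbitrary: e \<sigma>)
  case (Rl R ts)
  have "map (tval S e \<circ> tsubst \<sigma>) ts = map (tval S (\<lambda>i. tval S e (\<sigma> i))) ts"
    by (simp add: tval_tsubst)
  then show ?case by (simp del: map_eq_conv)
next
  case (All \<phi>)
  have "(\<lambda>i. tval S (case_nat a e) (lift_subst \<sigma> i)) = case_nat a (\<lambda>i. tval S e (\<sigma> i))" for a
    by (rule ext) (simp add: lift_subst_def tval_tsubst split: nat.split)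
  then show ?case by (simp add: All.IH)
qed (auto simp: tval_tsubst)

lemma tm_in_tsubst:
  assumes "B \<subseteq> C" and "\<And>i. i < k \<Longrightarrow> tm_in L C l (\<sigma> i)"
  shows "tm_in L B k t \<Longrightarrow> tm_in L C l (tsubst \<sigma> t)"
  by (induction t) (use assms in \<open>auto simp: subset_iff\<close>)

lemma fm_in_subst:
  "fm_in L B k \<phi> \<Longrightarrow> B \<subseteq> C \<Longrightarrow> (\<And>i. i < k \<Longrightarrow> tm_in L C l (\<sigma> i)) \<Longrightarrow> fm_in L C l (subst \<sigma> \<phi>)"
proof (induction \<phi> arbitrary: k l \<sigma>)
  case (All \<phi>)
  have "tm_in L C (Suc l) (lift_subst \<sigma> i)" if "i < Suc k" for i
    using that All.prems(3)
    by (cases i) (auto simp: lift_subst_def intro!: tm_in_tsubst[OF subset_refl, of "l" _ C "Suc l"])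
  then show ?case using All.IH[of "Suc k" "Suc l" "lift_subst \<sigma>"] All.prems by simp
next
  case (Eq s t)
  then show ?case using tm_in_tsubst[of B C k L l \<sigma>] by simp
next
  case (Rl R ts)
  then show ?case using tm_in_tsubst[of B C k L l \<sigma>] by simp
next
  case (Imp \<phi> \<psi>)
  show ?case
    using Imp.IH(1)[of k l \<sigma>] Imp.IH(2)[of k l \<sigma>] Imp.prems by simp
qed simp

lemma sat_inst: "sat S ((!) a) (inst n b \<phi>) \<longleftrightarrow> sat S ((!) (a @ b)) \<phi>" if "length a = n"
proof -
  have "(\<lambda>i. tval S ((!) a) (if i < n then Var i else Par (b ! (i - n)))) = (!) (a @ b)"
    using that by (auto simp: nth_append)
  then show ?thesis by (simp add: inst_def sat_subst)
qed

lemma fm_in_inst: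
  assumes "fm_in L B (n + length b) \<phi>" and "B \<subseteq> C" and "set b \<subseteq> C"
  shows "fm_in L C n (inst n b \<phi>)"
  unfolding inst_def
  by (rule fm_in_subst[OF assms(1,2)]) (use assms(3) in \<open>auto simp: subset_iff\<close>)

lemma inst_Neg: "inst n b (Neg \<phi>) = Neg (inst n b \<phi>)"
  by (simp add: inst_def)

lemma sat_shift: "sat S ((!) c) (shift m \<phi>) \<longleftrightarrow> sat S ((!) (drop m c)) \<phi>" if "fm_in L B n \<phi>" "length c = m + n"
  unfolding shift_def sat_subst by (rule sat_cong[OF that(1)]) (use that(2) in auto)

lemma fm_in_shift: "fm_in L B n \<phi> \<Longrightarrow> fm_in L B (m + n) (shift m \<phi>)"
  unfolding shift_def by (rule fm_in_subst) auto

text \<open>Later formulas are assembled by moving blocks of variables. Only the meaning of the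
  renamed formula is exported, uniformly in structure and assignment, which keeps substitution out
  of those constructions.\<close>

lemma reindex_formula:
  assumes "fm_in L B k \<phi>" and "\<And>i. i < k \<Longrightarrow> \<sigma> i < l"
  obtains \<phi>' where "fm_in L B l \<phi>'" and "\<And>(S :: ('f, 'r, 'a) struct) e. sat S e \<phi>' \<longleftrightarrow> sat S (e \<circ> \<sigma>) \<phi>"
proof
  show "fm_in L B l (subst (Var \<circ> \<sigma>) \<phi>)"
    by (rule fm_in_subst[OF assms(1)]) (auto simp: assms(2))
  show "sat S e (subst (Var \<circ> \<sigma>) \<phi>) \<longleftrightarrow> sat S (e \<circ> \<sigma>) \<phi>" for S :: "('f, 'r, 'a) struct" and e
    by (simp add: sat_subst comp_def)
qed

lemma conj_formula:
  assumes "finite F" and "F \<subseteq> formulas L B k"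
  obtains \<eta> where "fm_in L B k \<eta>" and "\<And>S e. sat S e \<eta> \<longleftrightarrow> (\<forall>\<phi>\<in>F. sat S e \<phi>)"
proof -
  have "\<exists>\<eta>. fm_in L B k \<eta> \<and> (\<forall>S e. sat S e \<eta> \<longleftrightarrow> (\<forall>\<phi>\<in>F. sat S e \<phi>))"
    using assms
  proof (induction F)
    case empty
    show ?case by (rule exI[of _ "Neg Fls"]) simp
  next
    case (insert \<phi> F)
    then obtain \<eta> where "fm_in L B k \<eta>" "\<forall>S e. sat S e \<eta> \<longleftrightarrow> (\<forall>\<phi>\<in>F. sat S e \<phi>)" by auto
    then show ?case using insert.prems by (intro exI[of _ "Neg (Imp \<phi> (Neg \<eta>))"]) auto
  qed
  then show thesis using that by blast
qed

text \<open>One formula serves all structures at once, so that the existential statement can be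
  carried between U, an elementary submodel and the extension N.\<close>

lemma ex_formula:
  assumes "fm_in L B (k + n) \<phi>"
  obtains \<eta> where "fm_in L B k \<eta>"
    and "\<And>(S :: ('f, 'r, 'a) struct) a. length a = k \<Longrightarrow>
      sat S ((!) a) \<eta> \<longleftrightarrow> (\<exists>b\<in>tuples n (univ S). sat S ((!) (a @ b)) \<phi>)"
proof -
  have "\<exists>\<eta>. fm_in L B k \<eta> \<and> (\<forall>(S :: ('f, 'r, 'a) struct) a. length a = k \<longrightarrow>
      (sat S ((!) a) \<eta> \<longleftrightarrow> (\<exists>b\<in>tuples n (univ S). sat S ((!) (a @ b)) \<phi>)))"
    using assms
  proof (induction n arbitrary: \<phi>)
    case 0
    then show ?case by auto
  next
    case (Suc n)
    \<comment> \<open>\<open>All\<close> binds index 0, while the block to be quantified sits at the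
      end: the last variable k + n moves to index 0 and all others move up by one.\<close>
    define \<sigma> where "\<sigma> i = (if i = k + n then 0 else Suc i)" for i
    obtain \<phi>' where \<phi>': "fm_in L B (Suc (k + n)) \<phi>'"
      "\<And>(S :: ('f, 'r, 'a) struct) e. sat S e \<phi>' \<longleftrightarrow> sat S (e \<circ> \<sigma>) \<phi>"
      by (rule reindex_formula[OF Suc.prems, of \<sigma> "Suc (k + n)"]) (auto simp: \<sigma>_def)
    let ?\<theta> = "Neg (All (Neg \<phi>'))"
    have "fm_in L B (k + n) ?\<theta>" using \<phi>'(1) by simp
    from Suc.IH[OF this] obtain \<eta> where \<eta>: "fm_in L B k \<eta>"
      "\<And>(S :: ('f, 'r, 'a) struct) a. length a = k \<Longrightarrow>
         sat S ((!) a) \<eta> \<longleftrightarrow> (\<exists>b\<in>tuples n (univ S). sat S ((!) (a @ b)) ?\<theta>)"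
      by blast
    have "sat S ((!) a) \<eta> \<longleftrightarrow> (\<exists>b\<in>tuples (Suc n) (univ S). sat S ((!) (a @ b)) \<phi>)"
      if a: "length a = k" for S :: "('f, 'r, 'a) struct" and a
    proof -
      have *: "sat S (case_nat c ((!) (a @ b)) \<circ> \<sigma>) \<phi> \<longleftrightarrow> sat S ((!) (a @ b @ [c])) \<phi>"
        if "length b = n" for b c
        by (rule sat_cong[OF Suc.prems]) (use a that in \<open>auto simp: \<sigma>_def nth_append\<close>)
      have "sat S ((!) a) \<eta> \<longleftrightarrow>
          (\<exists>b\<in>tuples n (univ S). \<exists>c\<in>univ S. sat S ((!) (a @ b @ [c])) \<phi>)"
        using * by (auto simp: \<eta>(2)[OF a] \<phi>'(2))
      also have "\<dots> \<longleftrightarrow> (\<exists>b\<in>tuples (Suc n) (univ S). sat S ((!) (a @ b)) \<phi>)" (is "?l \<longleftrightarrow> ?r")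
      proof
        assume ?l
        then obtain b c where "b \<in> tuples n (univ S)" "c \<in> univ S" "sat S ((!) (a @ b @ [c])) \<phi>"
          by blast
        then show ?r by (intro bexI[of _ "b @ [c]"]) auto
      next
        assume ?r
        then obtain d where "length d = Suc n" "set d \<subseteq> univ S" "sat S ((!) (a @ d)) \<phi>" by auto
        then show ?l
          by (cases d rule: rev_cases) auto
      qed
      finally show ?thesis .
    qed
    with \<eta>(1) show ?case by blast
  qed
  then show thesis using that by blast
qed

section \<open>Parameters of a formula and their replacement by variables\<close>

fun tm_params :: "('f, 'r, 'a) tm \<Rightarrow> 'a set" where
  "tm_params (Var i) = {}"
| "tm_params (Par c) = {c}"
| "tm_params (Fn f ts) = (\<Union>t\<in>set ts. tm_params t)"

fun fm_params :: "('f, 'r, 'a) fm \<Rightarrow> 'a set" where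
  "fm_params Fls = {}"
| "fm_params (Eq s t) = tm_params s \<union> tm_params t"
| "fm_params (Rl R ts) = (\<Union>t\<in>set ts. tm_params t)"
| "fm_params (Imp \<phi> \<psi>) = fm_params \<phi> \<union> fm_params \<psi>"
| "fm_params (All \<phi>) = fm_params \<phi>"

lemma finite_tm_params: "finite (tm_params t)"
  by (induction t) auto

lemma finite_fm_params: "finite (fm_params \<phi>)"
  by (induction \<phi>) (auto simp: finite_tm_params)

lemma tm_params_subset: "tm_in L B n t \<Longrightarrow> tm_params t \<subseteq> B"
  by (induction t) auto

lemma fm_params_subset: "fm_in L B n \<phi> \<Longrightarrow> fm_params \<phi> \<subseteq> B"
proof (induction \<phi> arbitrary: n)
  case (Rl R ts)
  then show ?case using tm_params_subset[of L B n] by (simp add: UN_subset_iff)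
next
  case (Imp \<phi> \<psi>)
  then show ?case by (metis Un_least fm_in.simps(4) fm_params.simps(4))
next
  case (All \<phi>)
  then show ?case by (metis fm_in.simps(5) fm_params.simps(5))
qed (auto dest: tm_params_subset)

lemma tm_in_params: "tm_in L B n t \<Longrightarrow> tm_params t \<subseteq> C \<Longrightarrow> tm_in L C n t"
  by (induction t) auto

lemma fm_in_params: "fm_in L B n \<phi> \<Longrightarrow> fm_params \<phi> \<subseteq> C \<Longrightarrow> fm_in L C n \<phi>"
  by (induction \<phi> arbitrary: n) (simp_all add: tm_in_params[of L B _ _ C] SUP_le_iff)

text \<open>Converse of \<open>inst\<close>: the block of new variables starts behind the n
  variables in scope. In \<open>fm_abs\<close> this n grows under \<open>All\<close>, which keeps
  the new variables free there.\<close>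

fun tm_abs :: "nat \<Rightarrow> ('a \<Rightarrow> nat) \<Rightarrow> ('f, 'r, 'a) tm \<Rightarrow> ('f, 'r, 'a) tm" where
  "tm_abs n g (Var i) = Var i"
| "tm_abs n g (Par c) = Var (n + g c)"
| "tm_abs n g (Fn f ts) = Fn f (map (tm_abs n g) ts)"

fun fm_abs :: "nat \<Rightarrow> ('a \<Rightarrow> nat) \<Rightarrow> ('f, 'r, 'a) fm \<Rightarrow> ('f, 'r, 'a) fm" where
  "fm_abs n g Fls = Fls"
| "fm_abs n g (Eq s t) = Eq (tm_abs n g s) (tm_abs n g t)"
| "fm_abs n g (Rl R ts) = Rl R (map (tm_abs n g) ts)"
| "fm_abs n g (Imp \<phi> \<psi>) = Imp (fm_abs n g \<phi>) (fm_abs n g \<psi>)"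
| "fm_abs n g (All \<phi>) = All (fm_abs (Suc n) g \<phi>)"

lemma tm_in_abs: "tm_in L B n t \<Longrightarrow> \<forall>c\<in>B. g c < k \<Longrightarrow> tm_in L {} (n + k) (tm_abs n g t)"
  by (induction t) auto

lemma fm_in_abs: "fm_in L B n \<phi> \<Longrightarrow> \<forall>c\<in>B. g c < k \<Longrightarrow> fm_in L {} (n + k) (fm_abs n g \<phi>)"
proof (induction \<phi> arbitrary: n)
  case (All \<phi>)
  then show ?case using All.IH[of "Suc n"] by simp
qed (auto intro: tm_in_abs)

lemma tsubst_abs:
  "tm_in L B n t \<Longrightarrow> \<forall>c\<in>B. b ! g c = c \<Longrightarrow>
    tsubst (\<lambda>i. if i < n then Var i else Par (b ! (i - n))) (tm_abs n g t) = t"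
  by (induction t) (auto intro!: map_idI)

text \<open>The equality is literal because membership in a type concerns the formula itself; any
  member of a type can now be written as a parameter-free formula filled with a tuple.\<close>

lemma inst_abs:
  fixes \<phi> :: "('f, 'r, 'a) fm"
  shows "fm_in L B n \<phi> \<Longrightarrow> \<forall>c\<in>B. b ! g c = c \<Longrightarrow> inst n b (fm_abs n g \<phi>) = \<phi>"
proof (induction \<phi> arbitrary: n)
  case (All \<phi>)
  \<comment> \<open>Lifting raises variable indices and leaves parameters alone, so the substitution
    behind \<open>inst n\<close> lifts to the one behind \<open>inst (Suc n)\<close>.\<close>
  have "lift_subst (\<lambda>i. if i < n then Var i else Par (b ! (i - n))) =
      ((\<lambda>i. if i < Suc n then Var i else Par (b ! (i - Suc n))) :: nat \<Rightarrow> ('f, 'r, 'a) tm)"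
    by (rule ext) (auto simp: lift_subst_def split: nat.split)
  then show ?case using All.IH[of "Suc n"] All.prems by (simp add: inst_def)
qed (auto simp: inst_def intro!: tsubst_abs map_idI)

text \<open>A single tuple b, enumerating the union of the parameter sets, turns satisfiability of F
  into one existential statement about b; \<open>extend_in_types\<close> moves that statement to
  another tuple.\<close>

lemma common_params:
  assumes "finite F" and "F \<subseteq> formulas L B n"
  obtains b \<psi> where "set b \<subseteq> B" and "\<And>\<phi>. \<phi> \<in> F \<Longrightarrow> fm_in L {} (n + length b) (\<psi> \<phi>)"
    and "\<And>\<phi>. \<phi> \<in> F \<Longrightarrow> inst n b (\<psi> \<phi>) = \<phi>"
proof -
  let ?P = "\<Union>\<phi>\<in>F. fm_params \<phi>"
  have "finite ?P" using assms(1) by (simp add: finite_fm_params)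
  then obtain b where b: "set b = ?P" using finite_list by blast
  have "\<forall>c\<in>?P. \<exists>i<length b. b ! i = c" by (metis b in_set_conv_nth)
  then obtain g where g: "\<forall>c\<in>?P. g c < length b \<and> b ! g c = c" by metis
  have fm: "fm_in L ?P n \<phi>" if "\<phi> \<in> F" for \<phi>
    by (rule fm_in_params[of L B]) (use that assms(2) in auto)
  have "?P \<subseteq> B" using assms(2) by (auto dest!: subsetD[of F] fm_params_subset)
  then show thesis
    using that[of b "fm_abs n g"] fm_in_abs[OF fm, of _ g "length b"] inst_abs[OF fm, of _ b g] b g
    by simp
qed

lemma extract_params:
  assumes "fm_in L B n \<phi>"
  obtains b \<psi> where "set b \<subseteq> B" and "fm_in L {} (n + length b) \<psi>" and "inst n b \<psi> = \<phi>"
proof (rule common_params[of "{\<phi>}" L B n])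
  show "{\<phi>} \<subseteq> formulas L B n" using assms by simp
qed (use that in auto)

section \<open>Types\<close>

lemma realizes_append:
  assumes "F \<subseteq> formulas L B n" and "length a = n"
  shows "realizes S (a @ b) F \<longleftrightarrow> realizes S a F"
  using assms sat_append_left[of L B n _ a S b] unfolding realizes_def by fastforce

lemma types_fm_in: "s \<in> types L S n B \<Longrightarrow> \<phi> \<in> s \<Longrightarrow> fm_in L B n \<phi>"
  by (auto simp: types_def)

lemma types_realize_finite:
  assumes "s \<in> types L S n B" and "finite F" and "F \<subseteq> s"
  obtains a where "length a = n" and "set a \<subseteq> univ S" and "realizes S a F"
proof -
  have "\<exists>a\<in>tuples n (univ S). realizes S a F"
    using assms(1-3) unfolding types_def fin_sat_in_def by blast
  then show thesis using that by auto
qed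

text \<open>Otherwise \<open>Neg \<phi>\<close> lies in s by completeness, and finite satisfiability
  yields a tuple of S refuting the entailment. As only tuples of S are tested, formulas equivalent
  in S are interchangeable in types.\<close>

lemma types_closed:
  assumes s: "s \<in> types L S n B" and F: "finite F" "F \<subseteq> s" and \<phi>: "fm_in L B n \<phi>"
    and entails: "\<And>a. length a = n \<Longrightarrow> set a \<subseteq> univ S \<Longrightarrow> realizes S a F \<Longrightarrow> sat S ((!) a) \<phi>"
  shows "\<phi> \<in> s"
proof (rule ccontr)
  assume "\<phi> \<notin> s"
  then have "Neg \<phi> \<in> s" using s \<phi> by (auto simp: types_def)
  then obtain a where "length a = n" "set a \<subseteq> univ S" "realizes S a (insert (Neg \<phi>) F)"
    using types_realize_finite[OF s, of "insert (Neg \<phi>) F"] F by auto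
  with entails[of a] show False by (simp add: realizes_def)
qed

lemma types_Neg:
  assumes s: "s \<in> types L S n B" and \<phi>: "fm_in L B n \<phi>"
  shows "Neg \<phi> \<in> s \<longleftrightarrow> \<phi> \<notin> s"
proof
  assume "Neg \<phi> \<in> s"
  show "\<phi> \<notin> s"
  proof
    assume "\<phi> \<in> s"
    then obtain a where "realizes S a {\<phi>, Neg \<phi>}"
      using types_realize_finite[OF s, of "{\<phi>, Neg \<phi>}"] \<open>Neg \<phi> \<in> s\<close> by auto
    then show False by (simp add: realizes_def)
  qed
qed (use s \<phi> in \<open>auto simp: types_def\<close>)

lemma types_equiv:
  assumes "s \<in> types L S n B" and "fm_in L B n \<phi>" and "fm_in L B n \<psi>"
    and "\<And>a. length a = n \<Longrightarrow> set a \<subseteq> univ S \<Longrightarrow> sat S ((!) a) \<phi> \<longleftrightarrow> sat S ((!) a) \<psi>"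
  shows "\<phi> \<in> s \<longleftrightarrow> \<psi> \<in> s"
  using types_closed[OF assms(1), of "{\<phi>}" \<psi>] types_closed[OF assms(1), of "{\<psi>}" \<phi>] assms
  by (auto simp: realizes_def)

text \<open>Completeness leaves no freedom: if \<phi> is not in s, then \<open>Neg \<phi>\<close>
  lies in s, hence in s'.\<close>

lemma types_subset_mem:
  assumes "s \<in> types L S n B" and "s' \<in> types L S' n B'" and "s \<subseteq> s'" and "fm_in L B n \<phi>"
  shows "\<phi> \<in> s' \<longleftrightarrow> \<phi> \<in> s"
proof -
  \<comment> \<open>That \<phi> has its parameters in B' is read off from s', which contains \<phi>
    or its negation.\<close>
  have \<phi>: "fm_in L B' n \<phi>"
    using assms types_Neg[OF assms(1,4)] types_fm_in[OF assms(2), of \<phi>]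
      types_fm_in[OF assms(2), of "Neg \<phi>"] by auto
  show ?thesis
    using types_Neg[OF assms(1,4)] types_Neg[OF assms(2) \<phi>] assms(3) by blast
qed

lemma types_conj:
  assumes s: "s \<in> types L S n B" and F: "finite F" "F \<subseteq> s"
  obtains \<phi> where "\<phi> \<in> s" and "fm_in L B n \<phi>" and "\<And>S e. sat S e \<phi> \<longleftrightarrow> (\<forall>\<phi>\<in>F. sat S e \<phi>)"
proof -
  have "F \<subseteq> formulas L B n" using s F by (auto simp: types_def)
  from conj_formula[OF F(1) this] obtain \<phi> where
    \<phi>: "fm_in L B n \<phi>" "\<And>S e. sat S e \<phi> \<longleftrightarrow> (\<forall>\<phi>\<in>F. sat S e \<phi>)" by blast
  have "\<phi> \<in> s" by (rule types_closed[OF s F \<phi>(1)]) (simp add: \<phi>(2) realizes_def)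
  with \<phi> show thesis using that by blast
qed

text \<open>Zorn's lemma gives a maximal finitely satisfiable extension. If it omitted both \<phi>
  and \<open>Neg \<phi>\<close>, finite parts of it would refute each of them, and the union of
  these parts would be unsatisfiable.\<close>

lemma types_extend:
  assumes "\<Phi> \<subseteq> formulas L B n" and "fin_sat_in S n \<Phi> (univ S)"
  obtains s where "s \<in> types L S n B" and "\<Phi> \<subseteq> s"
proof -
  let ?A = "{s. \<Phi> \<subseteq> s \<and> s \<subseteq> formulas L B n \<and> fin_sat_in S n s (univ S)}"
  have "\<exists>M\<in>?A. \<forall>X\<in>?A. M \<subseteq> X \<longrightarrow> X = M"
  proof (rule subset_Zorn_nonempty)
    show "?A \<noteq> {}" using assms by auto
    fix C assume C: "C \<noteq> {}" "subset.chain ?A C"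
    have "fin_sat_in S n (\<Union> C) (univ S)"
      unfolding fin_sat_in_def
    proof (intro allI impI)
      fix F assume "finite F \<and> F \<subseteq> \<Union> C"
      then obtain s where "s \<in> C" "F \<subseteq> s"
        using finite_subset_Union_chain[of F C ?A] C by blast
      then show "\<exists>a\<in>tuples n (univ S). realizes S a F"
        using C(2) \<open>finite F \<and> F \<subseteq> \<Union> C\<close> unfolding subset.chain_def fin_sat_in_def by blast
    qed
    moreover have "C \<subseteq> ?A" using C(2) by (simp add: subset.chain_def)
    moreover obtain s where "s \<in> C" using C(1) by blast
    ultimately show "\<Union> C \<in> ?A" by auto
  qed
  then obtain s where s: "s \<in> ?A" and max: "\<And>t. t \<in> ?A \<Longrightarrow> s \<subseteq> t \<Longrightarrow> t = s" by (elim bexE) blast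
  have "\<phi> \<in> s \<or> Neg \<phi> \<in> s" if \<phi>: "fm_in L B n \<phi>" for \<phi>
  proof (rule ccontr)
    assume *: "\<not> (\<phi> \<in> s \<or> Neg \<phi> \<in> s)"
    have ex: "\<exists>F. finite F \<and> F \<subseteq> s \<and> (\<forall>a\<in>tuples n (univ S). realizes S a F \<longrightarrow> \<not> sat S ((!) a) \<psi>)"
      if "\<psi> \<notin> s" "fm_in L B n \<psi>" for \<psi>
    proof -
      have "\<not> fin_sat_in S n (insert \<psi> s) (univ S)"
        using max[of "insert \<psi> s"] that s by auto
      then obtain F where F: "finite F" "F \<subseteq> insert \<psi> s" "\<forall>a\<in>tuples n (univ S). \<not> realizes S a F"
        unfolding fin_sat_in_def by blast
      show ?thesis
        by (rule exI[of _ "F - {\<psi>}"]) (use F in \<open>auto simp: realizes_def\<close>)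
    qed
    obtain F G where F: "finite F" "F \<subseteq> s" "\<forall>a\<in>tuples n (univ S). realizes S a F \<longrightarrow> \<not> sat S ((!) a) \<phi>"
      and G: "finite G" "G \<subseteq> s" "\<forall>a\<in>tuples n (univ S). realizes S a G \<longrightarrow> \<not> sat S ((!) a) (Neg \<phi>)"
      using ex[of \<phi>] ex[of "Neg \<phi>"] * \<phi> by auto
    have "\<exists>a\<in>tuples n (univ S). realizes S a (F \<union> G)"
      using s F G unfolding fin_sat_in_def by simp
    with F(3) G(3) show False by (auto simp: realizes_def)
  qed
  then have "s \<in> types L S n B" using s by (auto simp: types_def)
  with s show thesis using that by blast
qed

lemma tp_in_types:
  assumes "set a \<subseteq> univ S"
  shows "tp L S a B \<in> types L S (length a) B"
  using assms by (auto simp: tp_def types_def fin_sat_in_def realizes_def intro!: exI[of _ a])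

lemma types_restrict:
  assumes "s \<in> types L S n B" and "C \<subseteq> B"
  shows "type_restrict L n s C \<in> types L S n C"
  using assms fm_in_mono[of L C n _ B n]
  by (auto simp: type_restrict_def types_def fin_sat_in_def)

lemma tp_eqI:
  assumes "s \<in> types L S n B" and "length a = n" and "realizes S' a s"
  shows "tp L S' a B = s"
proof (rule set_eqI)
  fix \<phi>
  have "\<phi> \<in> s \<longleftrightarrow> sat S' ((!) a) \<phi>" if "fm_in L B n \<phi>"
    using types_Neg[OF assms(1) that] assms(3) unfolding realizes_def by (metis sat.simps(1,4))
  then show "\<phi> \<in> tp L S' a B \<longleftrightarrow> \<phi> \<in> s"
    using assms types_fm_in[OF assms(1)] by (auto simp: tp_def)
qed

lemma tp_eq_iff:
  assumes "length a = length b"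
  shows "tp L S a B = tp L S' b B \<longleftrightarrow>
    (\<forall>\<phi>. fm_in L B (length b) \<phi> \<longrightarrow> (sat S ((!) a) \<phi> \<longleftrightarrow> sat S' ((!) b) \<phi>))"
  using assms unfolding tp_def by auto

lemma tp_eq_reindex:
  assumes "length a = length b" and "tp L S a B = tp L S' b B" and "\<forall>i\<in>set js. i < length b"
  shows "tp L S (map ((!) a) js) B = tp L S' (map ((!) b) js) B"
proof -
  have "sat S ((!) (map ((!) a) js)) \<phi> \<longleftrightarrow> sat S' ((!) (map ((!) b) js)) \<phi>"
    if \<phi>: "fm_in L B (length js) \<phi>" for \<phi>
  proof -
    let ?\<psi> = "subst (\<lambda>i. Var (js ! i)) \<phi>"
    have "fm_in L B (length b) ?\<psi>"
      by (rule fm_in_subst[OF \<phi>]) (use assms(3) in auto)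
    then have "sat S ((!) a) ?\<psi> \<longleftrightarrow> sat S' ((!) b) ?\<psi>" using assms(1,2) by (simp add: tp_eq_iff)
    moreover have "sat T ((!) c) ?\<psi> \<longleftrightarrow> sat T ((!) (map ((!) c) js)) \<phi>" for T c
      unfolding sat_subst by (rule sat_cong[OF \<phi>]) simp
    ultimately show ?thesis by simp
  qed
  then show ?thesis by (simp add: tp_eq_iff)
qed

text \<open>Coordinates from B can be absorbed into the formula as parameters.\<close>

lemma tp_eq_append:
  assumes "length a = length b" and "tp L S a B = tp L S' b B" and "set c \<subseteq> B"
  shows "tp L S (a @ c) B = tp L S' (b @ c) B"
proof -
  have "sat S ((!) (a @ c)) \<phi> \<longleftrightarrow> sat S' ((!) (b @ c)) \<phi>"
    if \<phi>: "fm_in L B (length (b @ c)) \<phi>" for \<phi>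
  proof -
    have "fm_in L B (length b) (inst (length b) c \<phi>)"
      by (rule fm_in_inst[of L B]) (use \<phi> assms(3) in auto)
    then have "sat S ((!) a) (inst (length b) c \<phi>) \<longleftrightarrow> sat S' ((!) b) (inst (length b) c \<phi>)"
      using assms(1,2) by (simp add: tp_eq_iff)
    then show ?thesis using assms(1) by (simp add: sat_inst)
  qed
  then show ?thesis using assms(1) by (simp add: tp_eq_iff)
qed

lemma tp_eq_take_drop:
  assumes "length a = length b" and "tp L S (a @ c) B = tp L S' (b @ d) B" and "length c = length d"
  shows "tp L S a B = tp L S' b B" and "tp L S c B = tp L S' d B"
proof -
  have len: "length (a @ c) = length (b @ d)" using assms by simp
  have m: "map ((!) (x @ y)) [0..<length x] = x"
    "map ((!) (x @ y)) [length x..<length x + length y] = y" for x y :: "'a list"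
    by (auto intro!: nth_equalityI simp: nth_append)
  show "tp L S a B = tp L S' b B"
    using tp_eq_reindex[OF len assms(2), of "[0..<length a]"] m(1)[of a c] m(1)[of b d] assms(1) by simp
  show "tp L S c B = tp L S' d B"
    using tp_eq_reindex[OF len assms(2), of "[length a..<length a + length c]"]
      m(2)[of a c] m(2)[of b d] assms(1,3) by simp
qed

lemma tp_eq_mono:
  assumes "length a = length b" and "tp L S a C = tp L S' b C" and "B \<subseteq> C"
  shows "tp L S a B = tp L S' b B"
  using assms fm_in_mono[of L B _ _ C] by (simp add: tp_eq_iff)

section \<open>Automorphisms and invariance\<close>

lemma map_fm_fixed:
  assumes "\<forall>c\<in>B. g c = c"
  shows "fm_in L B n \<phi> \<Longrightarrow> map_fm id id g \<phi> = \<phi>"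
proof (induction \<phi> arbitrary: n)
  have tm: "tm_in L B n t \<Longrightarrow> map_tm id id g t = t" for n t
    by (induction t) (use assms in \<open>auto intro!: map_idI\<close>)
  {
    case (Eq s t)
    then show ?case using tm[of n s] tm[of n t] by (simp add: id_def)
  next
    case (Rl R ts)
    then show ?case using tm by (auto simp: id_def intro!: map_idI)
  }
qed auto

lemma fm_in_map:
  "fm_in L B n \<phi> \<Longrightarrow> fm_in L (g ` B) n (map_fm id id g \<phi>)"
proof (induction \<phi> arbitrary: n)
  have tm: "tm_in L B n t \<Longrightarrow> tm_in L (g ` B) n (map_tm id id g t)" for n t
    by (induction t) auto
  {
    case (Eq s t)
    then show ?case using tm[of n s] tm[of n t] by (simp add: id_def)
  next
    case (Rl R ts)
    then show ?case using tm by (auto simp: id_def)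
  }
qed auto

lemma tval_in_univ:
  assumes "is_struct L S" and "\<And>i. i < n \<Longrightarrow> e i \<in> univ S"
  shows "tm_in L (univ S) n t \<Longrightarrow> tval S e t \<in> univ S"
proof (induction t)
  case (Fn f ts)
  then have "map (tval S e) ts \<in> tuples (length ts) (univ S)" by auto
  with assms(1) Fn.prems show ?case by (auto simp: is_struct_def)
qed (use assms in auto)

lemma tval_automorphism:
  assumes "is_struct L U" and g: "automorphism L U g" and e: "\<And>i. i < n \<Longrightarrow> e i \<in> univ U"
  shows "tm_in L (univ U) n t \<Longrightarrow> tval U (g \<circ> e) (map_tm id id g t) = g (tval U e t)"
proof (induction t)
  case (Fn f ts)
  have "map (tval U (g \<circ> e) \<circ> map_tm id id g) ts = map g (map (tval U e) ts)"
    using Fn by (auto simp: comp_def id_def)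
  moreover have "map (tval U e) ts \<in> tuples (length ts) (univ U)"
    using Fn.prems tval_in_univ[OF assms(1) e] by auto
  then have "g (fn U f (map (tval U e) ts)) = fn U f (map g (map (tval U e) ts))"
    using g Fn.prems by (auto simp: automorphism_def)
  ultimately show ?case by (simp add: comp_def id_def del: map_eq_conv)
qed auto

lemma sat_automorphism:
  assumes "is_struct L U" and g: "automorphism L U g"
  shows "fm_in L (univ U) n \<phi> \<Longrightarrow> (\<And>i. i < n \<Longrightarrow> e i \<in> univ U) \<Longrightarrow>
    sat U (g \<circ> e) (map_fm id id g \<phi>) \<longleftrightarrow> sat U e \<phi>"
proof (induction \<phi> arbitrary: n e)
  case (Eq s t)
  then have "tval U e s \<in> univ U" "tval U e t \<in> univ U"
    using tval_in_univ[OF assms(1), of n e] by auto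
  then have "g (tval U e s) = g (tval U e t) \<longleftrightarrow> tval U e s = tval U e t"
    using g by (auto simp: automorphism_def bij_betw_def inj_on_def)
  then show ?case using Eq tval_automorphism[OF assms, of n e] by (simp add: comp_def id_def)
next
  case (Rl R ts)
  have "map (tval U (g \<circ> e) \<circ> map_tm id id g) ts = map g (map (tval U e) ts)"
    using Rl tval_automorphism[OF assms, of n e] by (auto simp: comp_def id_def)
  moreover have "map (tval U e) ts \<in> tuples (length ts) (univ U)"
    using Rl tval_in_univ[OF assms(1), of n e] by auto
  then have "rel U R (map g (map (tval U e) ts)) \<longleftrightarrow> rel U R (map (tval U e) ts)"
    using g Rl.prems by (auto simp: automorphism_def)
  ultimately show ?case by (simp add: comp_def id_def del: map_eq_conv)
next
  case (Imp \<phi> \<psi>)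
  then show ?case using Imp.IH(1)[of n e] Imp.IH(2)[of n e] by (simp add: id_def comp_def)
next
  case (All \<phi>)
  have *: "sat U (case_nat (g a) (g \<circ> e)) (map_fm id id g \<phi>) \<longleftrightarrow> sat U (case_nat a e) \<phi>"
    if "a \<in> univ U" for a
  proof -
    have "case_nat (g a) (g \<circ> e) = g \<circ> case_nat a e"
      by (rule ext) (simp split: nat.split)
    moreover have "case_nat a e i \<in> univ U" if "i < Suc n" for i
      using \<open>a \<in> univ U\<close> All.prems(2) that by (cases i) auto
    ultimately show ?thesis using All.IH[of "Suc n" "case_nat a e"] All.prems(1) by (metis fm_in.simps(5))
  qed
  have "g ` univ U = univ U" using g by (simp add: automorphism_def bij_betw_def)
  then have "(\<forall>a\<in>univ U. sat U (case_nat a (g \<circ> e)) (map_fm id id g \<phi>)) \<longleftrightarrow>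
      (\<forall>a\<in>univ U. sat U (case_nat (g a) (g \<circ> e)) (map_fm id id g \<phi>))"
    by (metis (no_types, lifting) imageE imageI)
  then show ?case using * by (simp add: id_def comp_def)
qed simp

lemma sat_map_automorphism:
  assumes "is_struct L U" and "automorphism L U g"
    and "fm_in L (univ U) (length a) \<phi>" and "set a \<subseteq> univ U"
  shows "sat U ((!) (map g a)) (map_fm id id g \<phi>) \<longleftrightarrow> sat U ((!) a) \<phi>"
proof -
  have "map_fm id id g \<phi> \<in> formulas L (g ` univ U) (length a)"
    using fm_in_map[OF assms(3)] by simp
  then have "sat U ((!) (map g a)) (map_fm id id g \<phi>) \<longleftrightarrow> sat U (g \<circ> (!) a) (map_fm id id g \<phi>)"
    by (auto intro!: sat_cong)
  also have "\<dots> \<longleftrightarrow> sat U ((!) a) \<phi>"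
    by (rule sat_automorphism[OF assms(1-3)]) (use assms(4) in auto)
  finally show ?thesis .
qed

section \<open>Saturation and homogeneity of the monster model\<close>

lemma card_finite_ordLeq:
  assumes "finite B" and "infinite A"
  shows "(card_of B, card_of A) \<in> ordLeq"
  using assms by (metis card_of_Well_order card_of_ordLeq_finite ordLeq_total)

lemma card_Un_ordLeq:
  assumes "infinite A" and "(card_of B, card_of A) \<in> ordLeq" and "(card_of C, card_of A) \<in> ordLeq"
  shows "(card_of (B \<union> C), card_of A) \<in> ordLeq"
  by (rule card_of_Un_ordLeq_infinite_Field) (use assms in \<open>auto simp: card_of_card_order_on Field_card_of\<close>)

locale monster =
  fixes L :: "('f, 'r) lang" and U :: "('f, 'r, 'a) struct" and A :: "'a set"
  assumes struct: "is_struct L U" and small: "small L U A"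
begin

lemma A_subset: "A \<subseteq> univ U"
  using small by (simp add: small_def)

lemma realize_partial_type:
  assumes "B \<subseteq> univ U" and "finite B \<or> (card_of B, card_of A) \<in> ordLeq"
    and "\<Phi> \<subseteq> formulas L B n" and "fin_sat_in U n \<Phi> (univ U)"
  obtains b where "length b = n" and "set b \<subseteq> univ U" and "realizes U b \<Phi>"
proof -
  obtain s where s: "s \<in> types L U n B" "\<Phi> \<subseteq> s" using types_extend[OF assms(3,4)] by blast
  then have "\<exists>b\<in>tuples n (univ U). realizes U b s"
    using small assms(1,2) unfolding small_def by blast
  then obtain b where "length b = n" "set b \<subseteq> univ U" "realizes U b s" by auto
  with s(2) show thesis using that unfolding realizes_def by blast
qed

lemma realize_type_over_A:
  assumes "s \<in> types L U n A"
  obtains b where "length b = n" and "set b \<subseteq> univ U" and "tp L U b A = s"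
proof -
  have "s \<subseteq> formulas L A n" "fin_sat_in U n s (univ U)" using assms by (auto simp: types_def)
  from realize_partial_type[OF A_subset _ this] obtain b where
    "length b = n" "set b \<subseteq> univ U" "realizes U b s"
    using card_of_mono1[OF subset_refl] by blast
  then show thesis using that tp_eqI[OF assms] by blast
qed

text \<open>Homogeneity asks for a map on a set, while sequences are families that may repeat
  values. The formula \<open>Eq (Var 0) (Var 1)\<close> shows that indices with equal values under e
  have equal values under e', so h is well defined; the other formulas make it elementary.\<close>

lemma automorphism_extending:
  assumes "e ` J \<subseteq> univ U" and "e' ` J \<subseteq> univ U"
    and "finite (e ` J) \<or> (card_of (e ` J), card_of A) \<in> ordLeq"
    and eq: "\<And>\<phi> js. fm_in L {} (length js) \<phi> \<Longrightarrow> set js \<subseteq> J \<Longrightarrow>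
      sat U ((!) (map e js)) \<phi> \<longleftrightarrow> sat U ((!) (map e' js)) \<phi>"
  obtains g where "automorphism L U g" and "\<And>j. j \<in> J \<Longrightarrow> g (e j) = e' j"
proof -
  define h where "h c = e' (inv_into J e c)" for c
  have h: "h (e j) = e' j" if "j \<in> J" for j
  proof -
    let ?i = "inv_into J e (e j)"
    have "?i \<in> J" "e ?i = e j" using that by (auto intro: inv_into_into f_inv_into_f)
    moreover from this have "sat U ((!) (map e [?i, j])) (Eq (Var 0) (Var 1)) \<longleftrightarrow>
        sat U ((!) (map e' [?i, j])) (Eq (Var 0) (Var 1))"
      by (intro eq) (use that in auto)
    ultimately show ?thesis by (simp add: h_def)
  qed
  have elementary: "sat U ((!) b) \<phi> \<longleftrightarrow> sat U ((!) (map h b)) \<phi>"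
    if "\<phi> \<in> formulas L {} k" "b \<in> tuples k (e ` J)" for k \<phi> b
  proof -
    have "b \<in> lists (e ` J)" using that by auto
    then obtain js where js: "js \<in> lists J" "b = map e js" by (auto simp: lists_image)
    then have "map h b = map e' js" using h by (auto simp: in_lists_conv_set)
    moreover have "sat U ((!) b) \<phi> \<longleftrightarrow> sat U ((!) (map e' js)) \<phi>"
      unfolding js(2) by (rule eq) (use that js in auto)
    ultimately show ?thesis by simp
  qed
  have "h ` e ` J \<subseteq> univ U" using assms(2) h by auto
  then have "\<exists>g. automorphism L U g \<and> (\<forall>c\<in>e ` J. g c = h c)"
    using small[unfolded small_def, THEN conjunct2, rule_format, OF assms(1,3), THEN conjunct2]
      elementary by simp
  then show thesis using that h by auto
qed

text \<open>The automorphism fixes A once A belongs to the domain of the partial map. So the family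
  is enlarged by the identity on A, and equality of types over A becomes elementarity for
  parameter-free formulas.\<close>

lemma automorphism_extending_over_A:
  assumes "e ` J \<subseteq> univ U" and "e' ` J \<subseteq> univ U"
    and card: "finite (e ` J) \<or> (card_of (e ` J), card_of A) \<in> ordLeq"
    and eq: "\<And>js. set js \<subseteq> J \<Longrightarrow> tp L U (map e js) A = tp L U (map e' js) A"
  obtains g where "automorphism L U g" and "\<forall>c\<in>A. g c = c" and "\<And>j. j \<in> J \<Longrightarrow> g (e j) = e' j"
proof -
  let ?E = "case_sum id e" and ?E' = "case_sum id e'" and ?J = "A <+> J"
  have img: "case_sum id d ` ?J = A \<union> d ` J" for d :: "'b \<Rightarrow> 'a"
    by (auto simp: Plus_def image_Un image_image)
  \<comment> \<open>A finite A makes the image of J finite too; for an infinite A, the union with A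
    does not exceed |A|.\<close>
  have "finite (A \<union> e ` J) \<or> (card_of (A \<union> e ` J), card_of A) \<in> ordLeq"
  proof (cases "finite A")
    case True
    then show ?thesis using card card_of_ordLeq_finite by blast
  next
    case False
    then have "(card_of (e ` J), card_of A) \<in> ordLeq" using card card_finite_ordLeq by blast
    then show ?thesis using False
        card_Un_ordLeq[OF False card_of_mono1[OF subset_refl]] by blast
  qed
  moreover have "sat U ((!) (map ?E js)) \<phi> \<longleftrightarrow> sat U ((!) (map ?E' js)) \<phi>"
    if \<phi>: "fm_in L {} (length js) \<phi>" and js: "set js \<subseteq> ?J" for \<phi> js
  proof -
    \<comment> \<open>The members of J occurring in js are listed in ks and become variables, found
      through pos; entries from A become parameters.\<close>
    obtain ks where ks: "set ks = {j. Inr j \<in> set js}"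
      using finite_list[OF finite_vimageI[OF finite_set inj_Inr], of js] by (auto simp: vimage_def)
    then have "\<forall>j\<in>{j. Inr j \<in> set js}. \<exists>i<length ks. ks ! i = j" by (metis in_set_conv_nth)
    then obtain pos where pos: "\<And>j. Inr j \<in> set js \<Longrightarrow> pos j < length ks \<and> ks ! pos j = j"
      by (metis mem_Collect_eq)
    let ?\<psi> = "subst (\<lambda>i. case js ! i of Inl c \<Rightarrow> Par c | Inr j \<Rightarrow> Var (pos j)) \<phi>"
    have "fm_in L A (length ks) ?\<psi>"
    proof (rule fm_in_subst[OF \<phi>])
      fix i assume "i < length js"
      then have i: "js ! i \<in> set js" by simp
      show "tm_in L A (length ks) (case js ! i of Inl c \<Rightarrow> Par c | Inr j \<Rightarrow> Var (pos j))"
        using subsetD[OF js i] pos i by (cases "js ! i") (simp_all add: Plus_def image_iff)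
    qed simp
    moreover have "set ks \<subseteq> J" using js ks by auto
    then have "tp L U (map e ks) A = tp L U (map e' ks) A" by (rule eq)
    ultimately have "sat U ((!) (map e ks)) ?\<psi> \<longleftrightarrow> sat U ((!) (map e' ks)) ?\<psi>"
      by (simp add: tp_eq_iff)
    moreover have "sat U ((!) (map d ks)) ?\<psi> \<longleftrightarrow> sat U ((!) (map (case_sum id d) js)) \<phi>"
      for d :: "'b \<Rightarrow> 'a"
      unfolding sat_subst
    proof (rule sat_cong[OF \<phi>])
      fix i assume i: "i < length js"
      then have "js ! i \<in> set js" by simp
      with i show "tval U ((!) (map d ks)) (case js ! i of Inl c \<Rightarrow> Par c | Inr j \<Rightarrow> Var (pos j)) =
          map (case_sum id d) js ! i"
        using pos by (cases "js ! i") (simp_all add: Plus_def image_iff)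
    qed
    ultimately show ?thesis by simp
  qed
  ultimately obtain g where "automorphism L U g" "\<And>j. j \<in> ?J \<Longrightarrow> g (?E j) = ?E' j"
    using automorphism_extending[of ?E ?J ?E'] assms(1,2) A_subset unfolding img by auto
  then show thesis using that[of g] by (force simp: Plus_def)
qed

lemma automorphism_of_tp_eq:
  assumes "length b = length b'" and "set b \<subseteq> univ U" and "set b' \<subseteq> univ U"
    and "tp L U b A = tp L U b' A"
  obtains g where "automorphism L U g" and "\<forall>c\<in>A. g c = c" and "map g b = b'"
proof -
  have tp: "tp L U (map ((!) b) js) A = tp L U (map ((!) b') js) A" if "set js \<subseteq> {..<length b}" for js
    by (rule tp_eq_reindex[OF assms(1,4)]) (use that assms(1) in auto)
  have "(!) b ` {..<length b} \<subseteq> univ U" "(!) b' ` {..<length b} \<subseteq> univ U"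
    using assms(1-3) by (auto dest: nth_mem)
  from automorphism_extending_over_A[OF this _ tp]
  obtain g where g: "automorphism L U g" "\<forall>c\<in>A. g c = c"
      "\<And>j. j \<in> {..<length b} \<Longrightarrow> g (b ! j) = b' ! j"
    by auto
  have "map g b = b'" using g(3) assms(1) by (auto intro: nth_equalityI)
  with g show thesis using that by blast
qed

text \<open>An automorphism over A taking b to b' sends \<open>inst m b \<psi>\<close> to a formula
  equivalent in U to \<open>inst m b' \<psi>\<close>, the parameters of \<psi> in A staying put;
  closure of p under equivalence does the rest.\<close>

lemma invariant_inst_imp:
  assumes p: "p \<in> types L U m (univ U)" "invariant L U A p"
    and \<psi>: "fm_in L A (m + length b) \<psi>"
    and b: "length b = length b'" "set b \<subseteq> univ U" "set b' \<subseteq> univ U" "tp L U b A = tp L U b' A"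
    and mem: "inst m b \<psi> \<in> p"
  shows "inst m b' \<psi> \<in> p"
proof -
  obtain g where g: "automorphism L U g" "\<forall>c\<in>A. g c = c" "map g b = b'"
    using automorphism_of_tp_eq[OF b] by blast
  have \<psi>': "fm_in L (univ U) (m + length b) \<psi>" using fm_in_mono[OF \<psi>] A_subset by simp
  have inst: "fm_in L (univ U) m (inst m c \<psi>)" if "length c = length b" "set c \<subseteq> univ U" for c
    by (rule fm_in_inst[of L "univ U"]) (use \<psi>' that in auto)
  have "map_fm id id g ` p = p" using p(2) g unfolding invariant_def by blast
  then have "map_fm id id g (inst m b \<psi>) \<in> p" using mem by blast
  moreover have "sat U ((!) a) (inst m b' \<psi>)"
    if a: "length a = m" "set a \<subseteq> univ U" "sat U ((!) a) (map_fm id id g (inst m b \<psi>))" for a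
  proof -
    \<comment> \<open>A solution of the image formula is pulled back along g to a solution of the
      original one.\<close>
    have "g ` univ U = univ U" using g(1) by (simp add: automorphism_def bij_betw_def)
    then have "a \<in> lists (g ` univ U)" using a(2) by auto
    then obtain c where c: "set c \<subseteq> univ U" "a = map g c" by (auto simp: lists_image)
    have "sat U ((!) c) (inst m b \<psi>)"
      using a(1,3) c sat_map_automorphism[OF struct g(1) _ c(1)] inst[of b] b by simp
    then have "sat U ((!) (c @ b)) \<psi>" using a(1) c(2) by (simp add: sat_inst)
    then have "sat U ((!) (map g (c @ b))) (map_fm id id g \<psi>)"
      using sat_map_automorphism[OF struct g(1), of "c @ b" \<psi>] \<psi>' a(1) b c by simp
    then show ?thesis using g(3) c(2) a(1) map_fm_fixed[OF g(2) \<psi>] by (simp add: sat_inst)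
  qed
  ultimately show ?thesis
    by (intro types_closed[OF p(1), of "{map_fm id id g (inst m b \<psi>)}"] inst)
      (use b in \<open>auto simp: realizes_def\<close>)
qed

lemma invariant_inst_iff:
  assumes p: "p \<in> types L U m (univ U)" "invariant L U A p"
    and \<psi>: "fm_in L A (m + length b) \<psi>"
    and b: "length b = length b'" "set b \<subseteq> univ U" "set b' \<subseteq> univ U" "tp L U b A = tp L U b' A"
  shows "inst m b \<psi> \<in> p \<longleftrightarrow> inst m b' \<psi> \<in> p"
  using invariant_inst_imp[OF p \<psi> b] invariant_inst_imp[OF p _ b(1)[symmetric] b(3,2) b(4)[symmetric]]
    \<psi> b(1) by metis

end

section \<open>Finitely satisfiable and definable types\<close>

lemma ex_formula_left:
  fixes \<phi> :: "('f, 'r, 'a) fm"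
  assumes "fm_in L B (n + k) \<phi>"
  obtains \<eta> where "fm_in L B k \<eta>"
    and "\<And>(S :: ('f, 'r, 'a) struct) a. length a = k \<Longrightarrow>
      sat S ((!) a) \<eta> \<longleftrightarrow> (\<exists>b\<in>tuples n (univ S). sat S ((!) (b @ a)) \<phi>)"
proof -
  define \<sigma> where "\<sigma> i = (if i < n then k + i else i - n)" for i
  obtain \<phi>' where \<phi>': "fm_in L B (k + n) \<phi>'"
    "\<And>(S :: ('f, 'r, 'a) struct) e. sat S e \<phi>' \<longleftrightarrow> sat S (e \<circ> \<sigma>) \<phi>"
    by (rule reindex_formula[OF assms, of \<sigma> "k + n"]) (auto simp: \<sigma>_def)
  obtain \<eta> where \<eta>: "fm_in L B k \<eta>"
    "\<And>(S :: ('f, 'r, 'a) struct) a. length a = k \<Longrightarrow>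
      sat S ((!) a) \<eta> \<longleftrightarrow> (\<exists>b\<in>tuples n (univ S). sat S ((!) (a @ b)) \<phi>')"
    by (rule ex_formula[OF \<phi>'(1)]) blast
  have "sat S ((!) (a @ b)) \<phi>' \<longleftrightarrow> sat S ((!) (b @ a)) \<phi>"
    if "length a = k" "length b = n" for S :: "('f, 'r, 'a) struct" and a b
    unfolding \<phi>'(2) by (rule sat_cong[OF assms]) (use that in \<open>auto simp: \<sigma>_def nth_append\<close>)
  then show thesis using that[OF \<eta>(1)] \<eta>(2) by auto
qed

lemma inst_left_formula:
  fixes \<phi> :: "('f, 'r, 'a) fm"
  assumes "fm_in L B (m + n) \<phi>" and "length a = m" and "set a \<subseteq> B"
  obtains \<eta> where "fm_in L B n \<eta>"
    and "\<And>(S :: ('f, 'r, 'a) struct) b. length b = n \<Longrightarrow> sat S ((!) b) \<eta> \<longleftrightarrow> sat S ((!) (a @ b)) \<phi>"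
proof -
  let ?\<eta> = "subst (\<lambda>i. if i < m then Par (a ! i) else Var (i - m)) \<phi>"
  have "fm_in L B n ?\<eta>"
    by (rule fm_in_subst[OF assms(1)]) (use assms(2,3) in \<open>auto simp: subset_iff\<close>)
  moreover have "sat S ((!) b) ?\<eta> \<longleftrightarrow> sat S ((!) (a @ b)) \<phi>"
    for S :: "('f, 'r, 'a) struct" and b
    unfolding sat_subst by (rule sat_cong[OF assms(1)]) (use assms(2) in \<open>auto simp: nth_append\<close>)
  ultimately show thesis using that by blast
qed

text \<open>The Tarski-Vaught property: with the parameters of \<phi> separated as a tuple u of M,
  solvability is a parameter-free statement about u and passes to M; the solution found there passes
  back to U.\<close>

lemma model_realize:
  assumes M: "model L U M" and \<phi>: "fm_in L M n \<phi>"
    and b: "length b = n" "set b \<subseteq> univ U" "sat U ((!) b) \<phi>"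
  obtains c where "length c = n" and "set c \<subseteq> M" and "sat U ((!) c) \<phi>"
proof -
  let ?M = "U\<lparr>univ := M\<rparr>"
  have elem: "sat ?M ((!) a) \<psi> \<longleftrightarrow> sat U ((!) a) \<psi>"
    if "fm_in L {} (length a) \<psi>" "set a \<subseteq> M" for a \<psi>
    using M that unfolding model_def elementary_sub_def by auto
  obtain u \<psi> where u: "set u \<subseteq> M" and \<psi>: "fm_in L {} (n + length u) \<psi>" "inst n u \<psi> = \<phi>"
    by (rule extract_params[OF \<phi>])
  obtain \<eta> where \<eta>: "fm_in L {} (length u) \<eta>"
    "\<And>S a. length a = length u \<Longrightarrow>
      sat S ((!) a) \<eta> \<longleftrightarrow> (\<exists>b\<in>tuples n (univ S). sat S ((!) (b @ a)) \<psi>)"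
    by (rule ex_formula_left[OF \<psi>(1)]) blast
  have "sat U ((!) (b @ u)) \<psi>" using b \<psi>(2) by (simp flip: sat_inst)
  then have "sat U ((!) u) \<eta>" using b by (auto simp: \<eta>(2))
  then have "sat ?M ((!) u) \<eta>" using elem \<eta>(1) u by blast
  then obtain c where c: "length c = n" "set c \<subseteq> M" "sat ?M ((!) (c @ u)) \<psi>"
    by (auto simp: \<eta>(2))
  then have "sat U ((!) c) \<phi>" using elem[of "c @ u" \<psi>] \<psi> u sat_inst[of c n U u \<psi>] by auto
  with c show thesis using that by blast
qed

text \<open>If M were finite, "x differs from every element of M" would be a formula over M,
  solvable in U but not in M. For part (3) this is what makes countable sequences small.\<close>

lemma model_infinite:
  assumes "model L U M" and "infinite (univ U)"
  shows "infinite M"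
proof
  assume fin: "finite M"
  let ?F = "(\<lambda>c. Neg (Eq (Var 0) (Par c))) ` M"
  have F: "finite ?F" "?F \<subseteq> formulas L M 1" using fin by auto
  obtain \<eta> where \<eta>: "fm_in L M 1 \<eta>" "\<And>S e. sat S e \<eta> \<longleftrightarrow> (\<forall>\<phi>\<in>?F. sat S e \<phi>)"
    by (rule conj_formula[OF F]) blast
  obtain u where u: "u \<in> univ U" "u \<notin> M" using fin assms(2) infinite_super[of "univ U" M] by blast
  then have "sat U ((!) [u]) \<eta>" by (auto simp: \<eta>(2))
  then obtain c where c: "length c = 1" "set c \<subseteq> M" "sat U ((!) c) \<eta>"
    using model_realize[OF assms(1) \<eta>(1), of "[u]"] u(1) by auto
  have "c ! 0 \<in> M" using c(1,2) by (cases c) auto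
  with c(3) show False by (auto simp: \<eta>(2))
qed

section \<open>The Stone topology\<close>

lemma types_and:
  assumes s: "s \<in> types L S n B" and \<phi>: "fm_in L B n \<phi>" and \<psi>: "fm_in L B n \<psi>"
  shows "Neg (Imp \<phi> (Neg \<psi>)) \<in> s \<longleftrightarrow> \<phi> \<in> s \<and> \<psi> \<in> s" (is "?\<xi> \<in> s \<longleftrightarrow> _")
proof
  assume "?\<xi> \<in> s"
  then have F: "finite {?\<xi>}" "{?\<xi>} \<subseteq> s" by auto
  show "\<phi> \<in> s \<and> \<psi> \<in> s"
    using types_closed[OF s F \<phi>] types_closed[OF s F \<psi>] by (simp add: realizes_def)
next
  assume "\<phi> \<in> s \<and> \<psi> \<in> s"
  then have F: "finite {\<phi>, \<psi>}" "{\<phi>, \<psi>} \<subseteq> s" by auto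
  show "?\<xi> \<in> s"
    by (rule types_closed[OF s F]) (use \<phi> \<psi> in \<open>auto simp: realizes_def\<close>)
qed

text \<open>Types evaluate conjunctions correctly, so the generating sets are closed under binary
  intersection and form a base.\<close>

lemma stone_openD:
  assumes "openin (stone_topology L U k A) X" and "s \<in> X"
  obtains \<theta> where "fm_in L A k \<theta>" and "\<theta> \<in> s" and "{t \<in> types L U k A. \<theta> \<in> t} \<subseteq> X"
proof -
  have "generate_topology_on ((\<lambda>\<theta>. {s \<in> types L U k A. \<theta> \<in> s}) ` formulas L A k) X"
    using assms(1) by (simp add: stone_topology_def openin_topology_generated_by_iff)
  \<comment> \<open>Membership of s in the type space is carried through the induction because
    conjunctions are evaluated only in complete types.\<close>
  then have "\<forall>s\<in>X. \<exists>\<theta>. fm_in L A k \<theta> \<and> \<theta> \<in> s \<and> {t \<in> types L U k A. \<theta> \<in> t} \<subseteq> X \<and> s \<in> types L U k A"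
  proof induction
    case (Int X Y)
    show ?case
    proof
      fix s assume XY: "s \<in> X \<inter> Y"
      from bspec[OF Int.IH(1) IntD1[OF XY]] obtain \<theta> where \<theta>: "fm_in L A k \<theta>" "\<theta> \<in> s"
        "{t \<in> types L U k A. \<theta> \<in> t} \<subseteq> X" and s: "s \<in> types L U k A"
        by (elim exE conjE)
      from bspec[OF Int.IH(2) IntD2[OF XY]] obtain \<eta> where \<eta>: "fm_in L A k \<eta>" "\<eta> \<in> s"
        "{t \<in> types L U k A. \<eta> \<in> t} \<subseteq> Y"
        by (elim exE conjE)
      let ?\<xi> = "Neg (Imp \<theta> (Neg \<eta>))"
      have conj: "?\<xi> \<in> t \<longleftrightarrow> \<theta> \<in> t \<and> \<eta> \<in> t" if "t \<in> types L U k A" for t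
        by (rule types_and[OF that \<theta>(1) \<eta>(1)])
      then have "?\<xi> \<in> s" "{t \<in> types L U k A. ?\<xi> \<in> t} \<subseteq> X \<inter> Y" using s \<theta> \<eta> by auto
      then show "\<exists>\<theta>. fm_in L A k \<theta> \<and> \<theta> \<in> s \<and> {t \<in> types L U k A. \<theta> \<in> t} \<subseteq> X \<inter> Y \<and> s \<in> types L U k A"
        using s \<theta>(1) \<eta>(1) by (intro exI[of _ ?\<xi>]) simp
    qed
  next
    case (UN K)
    show ?case
    proof
      fix s assume "s \<in> \<Union> K"
      then obtain X where "X \<in> K" "s \<in> X" by blast
      from bspec[OF UN.IH[OF this(1)] this(2)]
      obtain \<theta> where "fm_in L A k \<theta> \<and> \<theta> \<in> s \<and> {t \<in> types L U k A. \<theta> \<in> t} \<subseteq> X \<and> s \<in> types L U k A"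
        by (elim exE)
      with \<open>X \<in> K\<close> show "\<exists>\<theta>. fm_in L A k \<theta> \<and> \<theta> \<in> s \<and> {t \<in> types L U k A. \<theta> \<in> t} \<subseteq> \<Union> K \<and> s \<in> types L U k A"
        by (intro exI[of _ \<theta>]) auto
    qed
  next
    case (Basis X)
    then show ?case by auto
  qed simp
  from bspec[OF this assms(2)] show thesis using that by (elim exE conjE)
qed

lemma stone_openI:
  assumes "\<And>s. s \<in> X \<Longrightarrow> s \<in> types L U k A"
    and "\<And>s. s \<in> X \<Longrightarrow> \<exists>\<theta>. fm_in L A k \<theta> \<and> \<theta> \<in> s \<and> {t \<in> types L U k A. \<theta> \<in> t} \<subseteq> X"
  shows "openin (stone_topology L U k A) X"
proof (subst openin_subopen, intro ballI)
  fix s assume "s \<in> X"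
  then obtain \<theta> where \<theta>: "fm_in L A k \<theta>" "\<theta> \<in> s" "{t \<in> types L U k A. \<theta> \<in> t} \<subseteq> X"
    using assms(2) by metis
  have "openin (stone_topology L U k A) {t \<in> types L U k A. \<theta> \<in> t}"
    unfolding stone_topology_def by (rule topology_generated_by_Basis) (use \<theta>(1) in auto)
  then show "\<exists>T. openin (stone_topology L U k A) T \<and> s \<in> T \<and> T \<subseteq> X"
    using \<theta> assms(1)[OF \<open>s \<in> X\<close>] by (intro exI[of _ "{t \<in> types L U k A. \<theta> \<in> t}"]) simp
qed

lemma topspace_stone: "topspace (stone_topology L U k A) = types L U k A"
proof
  have "Neg Fls \<in> s" if "s \<in> types L U k A" for s
    by (rule types_closed[OF that, of "{}"]) auto
  then show "types L U k A \<subseteq> topspace (stone_topology L U k A)"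
    by (auto simp: stone_topology_def topology_generated_by_topspace intro!: bexI[of _ "Neg Fls"])
qed (auto simp: stone_topology_def topology_generated_by_topspace)

text \<open>By invariance, whether q contains \<psi> at b depends on tp(b/A) alone, so no type lies
  in both sets; by saturation every type over A is realized, so one of them contains it. Clopenness
  thereby reduces to openness.\<close>

lemma (in monster) d_set_Neg:
  assumes q: "q \<in> types L U n (univ U)" "invariant L U A q" and \<psi>: "fm_in L {} (n + k) \<psi>"
  shows "d_set L U n k A q (Neg \<psi>) = types L U k A - d_set L U n k A q \<psi>"
proof -
  have inst: "fm_in L (univ U) n (inst n b \<psi>)" if "length b = k" "set b \<subseteq> univ U" for b
    by (rule fm_in_inst[of L "{}"]) (use \<psi> that in auto)
  show ?thesis
  proof (intro set_eqI iffI)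
    fix s assume "s \<in> d_set L U n k A q (Neg \<psi>)"
    then obtain b where b: "length b = k" "set b \<subseteq> univ U" "s = tp L U b A" "inst n b (Neg \<psi>) \<in> q"
      by (auto simp: d_set_def)
    then have not_mem: "inst n b \<psi> \<notin> q" using types_Neg[OF q(1) inst] by (simp add: inst_Neg)
    have "s \<notin> d_set L U n k A q \<psi>"
    proof
      assume "s \<in> d_set L U n k A q \<psi>"
      then obtain b' where b': "length b' = k" "set b' \<subseteq> univ U" "s = tp L U b' A" "inst n b' \<psi> \<in> q"
        by (auto simp: d_set_def)
      have "fm_in L A (n + length b) \<psi>" using \<psi> b(1) fm_in_mono by blast
      then show False using invariant_inst_iff[OF q, of b \<psi> b'] b b' not_mem by simp
    qed
    then show "s \<in> types L U k A - d_set L U n k A q \<psi>" using tp_in_types b by blast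
  next
    fix s assume s: "s \<in> types L U k A - d_set L U n k A q \<psi>"
    then obtain b where b: "length b = k" "set b \<subseteq> univ U" "tp L U b A = s"
      using realize_type_over_A by blast
    then have "inst n b \<psi> \<notin> q" using s by (auto simp: d_set_def)
    then have "inst n b (Neg \<psi>) \<in> q" using types_Neg[OF q(1) inst] b by (simp add: inst_Neg)
    then show "s \<in> d_set L U n k A q (Neg \<psi>)" using b by (auto simp: d_set_def)
  qed
qed

section \<open>Domination: consistency, finite satisfiability, definability\<close>

locale domination = monster L U A
  for L :: "('f, 'r) lang" and U :: "('f, 'r, 'a) struct" and A :: "'a set" +
  fixes m n :: nat and p q r :: "('f, 'r, 'a) fm set"
  assumes p: "p \<in> types L U m (univ U)" "invariant L U A p"
    and q: "q \<in> types L U n (univ U)" "invariant L U A q"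
    and r: "r \<in> types_extending L U m n A p q"
    and entails: "entails U (m + n) (p \<union> r) (shift m ` q)"
begin

lemma r_type: "r \<in> types L U (m + n) A"
  using r by (simp add: types_extending_def)

lemma p_restrict_subset: "\<phi> \<in> p \<Longrightarrow> fm_in L A m \<phi> \<Longrightarrow> \<phi> \<in> r"
  using r by (auto simp: types_extending_def type_restrict_def)

text \<open>As \<eta> has its parameters in A, a missing \<eta> would put its negation into the
  restriction of p to A, hence into r, where it contradicts \<rho>.\<close>

lemma ex_r_in_p:
  assumes "\<rho> \<in> r" and "fm_in L A m \<eta>"
    and \<eta>: "\<And>a. length a = m \<Longrightarrow> sat U ((!) a) \<eta> \<longleftrightarrow> (\<exists>b\<in>tuples n (univ U). sat U ((!) (a @ b)) \<rho>)"
  shows "\<eta> \<in> p"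
proof (rule ccontr)
  assume "\<eta> \<notin> p"
  have "fm_in L (univ U) m \<eta>" using fm_in_mono[OF assms(2) A_subset] by simp
  then have "Neg \<eta> \<in> p" using types_Neg[OF p(1)] \<open>\<eta> \<notin> p\<close> by blast
  then have "Neg \<eta> \<in> r" using assms(2) by (intro p_restrict_subset) auto
  then obtain c where c: "length c = m + n" "set c \<subseteq> univ U" "realizes U c {\<rho>, Neg \<eta>}"
    using types_realize_finite[OF r_type, of "{\<rho>, Neg \<eta>}"] assms(1) by auto
  define a b where "a = take m c" and "b = drop m c"
  have ab: "c = a @ b" "length a = m" "length b = n" "set b \<subseteq> univ U"
    using c(1,2) set_drop_subset[of m c] by (auto simp: a_def b_def)
  have "\<not> sat U ((!) a) \<eta>"
    using c(3) sat_append_left[OF assms(2) ab(2), of U b] by (simp add: realizes_def ab(1))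
  then show False using \<eta>[OF ab(2)] c(3) ab by (auto simp: realizes_def)
qed

lemma entails_finite:
  assumes "finite F" and "F \<subseteq> q"
  obtains G where "finite G" and "G \<subseteq> p \<union> r"
    and "\<And>c. length c = m + n \<Longrightarrow> set c \<subseteq> univ U \<Longrightarrow> realizes U c G \<Longrightarrow> realizes U c (shift m ` F)"
proof -
  have "\<forall>\<psi>\<in>F. \<exists>G. finite G \<and> G \<subseteq> p \<union> r \<and>
      (\<forall>c\<in>tuples (m + n) (univ U). realizes U c G \<longrightarrow> sat U ((!) c) (shift m \<psi>))"
    using entails assms(2) unfolding entails_def by blast
  then obtain G where G: "\<And>\<psi>. \<psi> \<in> F \<Longrightarrow> finite (G \<psi>) \<and> G \<psi> \<subseteq> p \<union> r \<and>
      (\<forall>c\<in>tuples (m + n) (univ U). realizes U c (G \<psi>) \<longrightarrow> sat U ((!) c) (shift m \<psi>))"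
    by metis
  have "sat U ((!) c) (shift m \<psi>)"
    if "length c = m + n" "set c \<subseteq> univ U" "realizes U c (\<Union>\<psi>\<in>F. G \<psi>)" "\<psi> \<in> F" for c \<psi>
  proof -
    have "realizes U c (G \<psi>)" using that(3,4) by (auto simp: realizes_def)
    then show ?thesis using G[OF that(4)] that(1,2) by auto
  qed
  then show thesis using that[of "\<Union>\<psi>\<in>F. G \<psi>"] G assms(1) by (auto simp: realizes_def)
qed

text \<open>Shared by consistency (X the whole universe) and part (1) (X = A). The tuple a only has
  to satisfy formulas of p, one of which provides some b with \<rho>(a, b); then F follows from the
  hypotheses G' that entail it.\<close>

lemma realize_p_q_r:
  assumes F: "finite F" "F \<subseteq> q" and G: "finite G" "G \<subseteq> p \<union> r"
    and X: "X \<subseteq> univ U" "fin_sat_in U m p X"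
    and ex_in_X: "\<And>a b \<phi>. length a = m \<Longrightarrow> set a \<subseteq> X \<Longrightarrow> length b = n \<Longrightarrow> set b \<subseteq> univ U \<Longrightarrow>
      fm_in L A (m + n) \<phi> \<Longrightarrow> sat U ((!) (a @ b)) \<phi> \<Longrightarrow>
      \<exists>b. length b = n \<and> set b \<subseteq> X \<and> sat U ((!) (a @ b)) \<phi>"
  obtains a b where "length a = m" and "set a \<subseteq> X" and "length b = n" and "set b \<subseteq> X"
    and "realizes U a (G \<inter> p)" and "realizes U (a @ b) (G \<inter> r)" and "realizes U b F"
proof -
  obtain G' where G': "finite G'" "G' \<subseteq> p \<union> r"
    "\<And>c. length c = m + n \<Longrightarrow> set c \<subseteq> univ U \<Longrightarrow> realizes U c G' \<Longrightarrow> realizes U c (shift m ` F)"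
    by (rule entails_finite[OF F]) blast
  let ?H = "G \<union> G'"
  have fin: "finite (?H \<inter> r)" "?H \<inter> r \<subseteq> r" "finite (?H \<inter> p)" using G(1) G'(1) by auto
  obtain \<rho> where \<rho>: "\<rho> \<in> r" "fm_in L A (m + n) \<rho>" "\<And>S e. sat S e \<rho> \<longleftrightarrow> (\<forall>\<phi>\<in>?H \<inter> r. sat S e \<phi>)"
    by (rule types_conj[OF r_type fin(1,2)]) blast
  obtain \<eta> where \<eta>: "fm_in L A m \<eta>"
    "\<And>S a. length a = m \<Longrightarrow> sat S ((!) a) \<eta> \<longleftrightarrow> (\<exists>b\<in>tuples n (univ S). sat S ((!) (a @ b)) \<rho>)"
    by (rule ex_formula[OF \<rho>(2)]) blast
  have "\<eta> \<in> p" by (rule ex_r_in_p[OF \<rho>(1) \<eta>(1)]) (rule \<eta>(2))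
  then have "finite (insert \<eta> (?H \<inter> p)) \<and> insert \<eta> (?H \<inter> p) \<subseteq> p" using fin by blast
  with X(2) have "\<exists>a\<in>tuples m X. realizes U a (insert \<eta> (?H \<inter> p))" unfolding fin_sat_in_def by blast
  then obtain a where a: "length a = m" "set a \<subseteq> X" "realizes U a (insert \<eta> (?H \<inter> p))" by auto
  then have "sat U ((!) a) \<eta>" by (simp add: realizes_def)
  then obtain b' where "length b' = n" "set b' \<subseteq> univ U" "sat U ((!) (a @ b')) \<rho>"
    using \<eta>(2)[OF a(1)] by auto
  then obtain b where b: "length b = n" "set b \<subseteq> X" "sat U ((!) (a @ b)) \<rho>"
    using ex_in_X[OF a(1,2) _ _ \<rho>(2)] by blast
  have r': "realizes U (a @ b) (?H \<inter> r)" using b(3) by (simp add: realizes_def \<rho>(3))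
  have "realizes U (a @ b) (?H \<inter> p)"
    using a(3) realizes_append[of "?H \<inter> p" L "univ U" m a U b] types_fm_in[OF p(1)] a(1)
    by (auto simp: realizes_def subset_iff)
  with r' have "realizes U (a @ b) G'" using G'(2) unfolding realizes_def by blast
  then have "realizes U (a @ b) (shift m ` F)" using G'(3)[of "a @ b"] a b X(1) by auto
  moreover have "sat U ((!) (a @ b)) (shift m \<psi>) \<longleftrightarrow> sat U ((!) b) \<psi>" if "\<psi> \<in> F" for \<psi>
    using sat_shift[of L "univ U" n \<psi> "a @ b" m U] types_fm_in[OF q(1)] F(2) that a(1) b(1) by auto
  ultimately have "realizes U b F" by (auto simp: realizes_def)
  with a b r' show thesis using that[of a b] by (auto simp: realizes_def)
qed

text \<open>Entailment alone could be vacuous. Consistency of p with r comes from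
  \<open>ex_r_in_p\<close>, and formulas of q are then consequences.\<close>

lemma p_q_r_consistent: "fin_sat_in U (m + n) (p \<union> r \<union> shift m ` q) (univ U)"
  unfolding fin_sat_in_def
proof (intro allI impI)
  fix F assume F: "finite F \<and> F \<subseteq> p \<union> r \<union> shift m ` q"
  obtain F' where F': "finite F'" "F' \<subseteq> q" "F \<inter> shift m ` q = shift m ` F'"
    using finite_subset_image[of "F \<inter> shift m ` q" "shift m" q] F by auto
  have G: "finite (F \<inter> (p \<union> r))" "F \<inter> (p \<union> r) \<subseteq> p \<union> r" using F by auto
  have p_sat: "fin_sat_in U m p (univ U)" using p(1) by (simp add: types_def)
  have ex: "\<exists>b. length b = n \<and> set b \<subseteq> univ U \<and> sat U ((!) (a @ b)) \<phi>"
    if "length a = m" "set a \<subseteq> univ U" "length b = n" "set b \<subseteq> univ U"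
      "fm_in L A (m + n) \<phi>" "sat U ((!) (a @ b)) \<phi>" for a b \<phi>
    using that by blast
  obtain a b where ab: "length a = m" "set a \<subseteq> univ U" "length b = n" "set b \<subseteq> univ U"
    "realizes U a (F \<inter> (p \<union> r) \<inter> p)" "realizes U (a @ b) (F \<inter> (p \<union> r) \<inter> r)" "realizes U b F'"
    by (rule realize_p_q_r[OF F'(1,2) G subset_refl p_sat ex]) (assumption | rule that)+
  have "sat U ((!) (a @ b)) \<phi>" if "\<phi> \<in> F" for \<phi>
  proof -
    have "\<phi> \<in> p \<union> r \<union> shift m ` q" using F that by (elim conjE subsetD)
    moreover have "\<phi> \<in> shift m ` F'" if "\<phi> \<in> shift m ` q"
      using \<open>\<phi> \<in> F\<close> that unfolding F'(3)[symmetric] by (rule IntI)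
    ultimately consider "\<phi> \<in> p" | "\<phi> \<in> r" | "\<phi> \<in> shift m ` F'" by (elim UnE) simp_all
    then show ?thesis
    proof cases
      case 1
      then show ?thesis using ab(5) that sat_append_left[OF types_fm_in[OF p(1)] ab(1), of \<phi> U b]
        by (auto simp: realizes_def)
    next
      case 2
      then show ?thesis using ab(6) that by (auto simp: realizes_def)
    next
      case 3
      then obtain \<psi> where "\<psi> \<in> F'" "\<phi> = shift m \<psi>" by blast
      then show ?thesis
        using ab sat_shift[of L "univ U" n \<psi> "a @ b" m U] types_fm_in[OF q(1)] F'(2)
        by (auto simp: realizes_def)
    qed
  qed
  then show "\<exists>c\<in>tuples (m + n) (univ U). realizes U c F"
    using ab by (intro bexI[of _ "a @ b"]) (auto simp: realizes_def)
qed

lemma fin_sat_in_dominated: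
  assumes M: "model L U A" and "fin_sat_in U m p A"
  shows "fin_sat_in U n q A"
  unfolding fin_sat_in_def
proof (intro allI impI)
  fix F assume "finite F \<and> F \<subseteq> q"
  then have F: "finite F" "F \<subseteq> q" by auto
  \<comment> \<open>With a from A filled in, the formula left in y has parameters in A, so the model
    A contains a solution.\<close>
  have ex: "\<exists>b. length b = n \<and> set b \<subseteq> A \<and> sat U ((!) (a @ b)) \<phi>"
    if a: "length a = m" "set a \<subseteq> A" and b: "length b = n" "set b \<subseteq> univ U"
      and \<phi>: "fm_in L A (m + n) \<phi>" "sat U ((!) (a @ b)) \<phi>" for a b \<phi>
  proof -
    obtain \<eta> where \<eta>: "fm_in L A n \<eta>"
      "\<And>S b. length b = n \<Longrightarrow> sat S ((!) b) \<eta> \<longleftrightarrow> sat S ((!) (a @ b)) \<phi>"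
      by (rule inst_left_formula[OF \<phi>(1) a]) blast
    then show ?thesis using model_realize[OF M \<eta>(1) b] \<phi>(2) b(1) by metis
  qed
  obtain b where "length b = n" "set b \<subseteq> A" "realizes U b F"
    by (rule realize_p_q_r[OF F finite.emptyI empty_subsetI A_subset assms(2) ex]) (assumption | rule that)+
  then show "\<exists>b\<in>tuples n A. realizes U b F" by auto
qed

text \<open>The formula \<xi>(x, d) of p used to derive \<psi>(y, b) has parameters d outside A,
  while a neighbourhood of tp(b/A) needs a formula over A. So d is quantified away: \<theta>(z) says
  that some w satisfies \<delta>, which puts \<xi>(x, w) into p, and that \<xi>(x, w) and \<rho>(x,
  y) imply \<psi>(y, z).\<close>

lemma d_set_open:
  assumes def: "definable_over L U m A p" and \<psi>: "fm_in L {} (n + k) \<psi>"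
  shows "openin (stone_topology L U k A) (d_set L U n k A q \<psi>)"
proof (rule stone_openI)
  show "s \<in> types L U k A" if "s \<in> d_set L U n k A q \<psi>" for s
    using that by (auto simp: d_set_def intro!: tp_in_types)
next
  fix s assume "s \<in> d_set L U n k A q \<psi>"
  then obtain b where b: "length b = k" "set b \<subseteq> univ U" "s = tp L U b A" "inst n b \<psi> \<in> q"
    by (auto simp: d_set_def)
  obtain G where G: "finite G" "G \<subseteq> p \<union> r" "\<And>c. length c = m + n \<Longrightarrow> set c \<subseteq> univ U \<Longrightarrow>
      realizes U c G \<Longrightarrow> realizes U c (shift m ` {inst n b \<psi>})"
    using entails_finite[of "{inst n b \<psi>}"] b(4) by auto
  have fin: "finite (G \<inter> p)" "G \<inter> p \<subseteq> p" "finite (G \<inter> r)" "G \<inter> r \<subseteq> r" using G(1) by auto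
  obtain \<phi> where \<phi>: "\<phi> \<in> p" "fm_in L (univ U) m \<phi>" "\<And>S e. sat S e \<phi> \<longleftrightarrow> (\<forall>\<phi>\<in>G \<inter> p. sat S e \<phi>)"
    by (rule types_conj[OF p(1) fin(1,2)]) blast
  obtain \<rho> where \<rho>: "\<rho> \<in> r" "fm_in L A (m + n) \<rho>" "\<And>S e. sat S e \<rho> \<longleftrightarrow> (\<forall>\<phi>\<in>G \<inter> r. sat S e \<phi>)"
    by (rule types_conj[OF r_type fin(3,4)]) blast
  obtain d \<xi> where d: "set d \<subseteq> univ U" and \<xi>: "fm_in L {} (m + length d) \<xi>" "inst m d \<xi> = \<phi>"
    by (rule extract_params[OF \<phi>(2)])
  define l where "l = length d"
  \<comment> \<open>Definability of p enters here: \<delta> holds at d and forces \<xi>(x, w) into p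
    for every w satisfying it.\<close>
  have "openin (stone_topology L U l A) (d_set L U m l A p \<xi>)"
    using def \<xi>(1) by (auto simp: definable_over_def l_def)
  moreover have "tp L U d A \<in> d_set L U m l A p \<xi>"
    using d \<phi>(1) \<xi>(2) by (auto simp: d_set_def l_def)
  ultimately obtain \<delta> where \<delta>: "fm_in L A l \<delta>" "\<delta> \<in> tp L U d A"
    "{t \<in> types L U l A. \<delta> \<in> t} \<subseteq> d_set L U m l A p \<xi>"
    by (rule stone_openD)
  obtain \<delta>' where \<delta>': "fm_in L A (k + l) \<delta>'" "\<And>S e. sat S e \<delta>' \<longleftrightarrow> sat S (e \<circ> (+) k) \<delta>"
    by (rule reindex_formula[OF \<delta>(1), of "(+) k" "k + l"]) auto
  \<comment> \<open>The combined formula has its variables in the order z, w, x, y, of lengths k, l,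
    m, n; \<sigma> places \<xi>(x, w) and \<tau> places \<psi>(y, z) in it.\<close>
  define \<sigma> \<tau> where "\<sigma> i = (if i < m then k + l + i else k + (i - m))"
    and "\<tau> i = (if i < n then k + l + m + i else i - n)" for i
  obtain \<xi>' where \<xi>': "fm_in L {} (k + l + (m + n)) \<xi>'" "\<And>S e. sat S e \<xi>' \<longleftrightarrow> sat S (e \<circ> \<sigma>) \<xi>"
    by (rule reindex_formula[OF \<xi>(1), of \<sigma> "k + l + (m + n)"]) (auto simp: \<sigma>_def l_def)
  obtain \<rho>' where \<rho>': "fm_in L A (k + l + (m + n)) \<rho>'" "\<And>S e. sat S e \<rho>' \<longleftrightarrow> sat S (e \<circ> (+) (k + l)) \<rho>"
    by (rule reindex_formula[OF \<rho>(2), of "(+) (k + l)" "k + l + (m + n)"]) auto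
  obtain \<psi>' where \<psi>': "fm_in L {} (k + l + (m + n)) \<psi>'" "\<And>S e. sat S e \<psi>' \<longleftrightarrow> sat S (e \<circ> \<tau>) \<psi>"
    by (rule reindex_formula[OF \<psi>, of \<tau> "k + l + (m + n)"]) (auto simp: \<tau>_def)
  \<comment> \<open>\<beta> expresses that a counterexample (x, y) to the implication exists;
    \<theta> asks for a w satisfying \<delta> without one.\<close>
  have "fm_in L A (k + l + (m + n)) (Neg (Imp \<xi>' (Imp \<rho>' \<psi>')))"
    using fm_in_mono[OF \<xi>'(1)] fm_in_mono[OF \<psi>'(1)] \<rho>'(1) by simp
  then obtain \<beta> where \<beta>: "fm_in L A (k + l) \<beta>" "\<And>S a. length a = k + l \<Longrightarrow> sat S ((!) a) \<beta> \<longleftrightarrow>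
      (\<exists>c\<in>tuples (m + n) (univ S). sat S ((!) (a @ c)) (Neg (Imp \<xi>' (Imp \<rho>' \<psi>'))))"
    by (rule ex_formula) blast
  have "fm_in L A (k + l) (Neg (Imp \<delta>' \<beta>))" using \<delta>'(1) \<beta>(1) by simp
  then obtain \<theta> where \<theta>: "fm_in L A k \<theta>" "\<And>S a. length a = k \<Longrightarrow> sat S ((!) a) \<theta> \<longleftrightarrow>
      (\<exists>w\<in>tuples l (univ S). sat S ((!) (a @ w)) (Neg (Imp \<delta>' \<beta>)))"
    by (rule ex_formula) blast
  have sat_\<theta>: "sat U ((!) z) \<theta> \<longleftrightarrow> (\<exists>w\<in>tuples l (univ U). sat U ((!) w) \<delta> \<and>
      (\<forall>c\<in>tuples (m + n) (univ U). sat U ((!) (take m c @ w)) \<xi> \<longrightarrow> sat U ((!) c) \<rho> \<longrightarrow>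
        sat U ((!) (drop m c @ z)) \<psi>))" if z: "length z = k" for z
  proof -
    have "sat U ((!) (z @ w)) \<delta>' \<longleftrightarrow> sat U ((!) w) \<delta>" if "length w = l" for w
      unfolding \<delta>'(2) by (rule sat_cong[OF \<delta>(1)]) (use z that in \<open>auto simp: nth_append\<close>)
    moreover have "sat U ((!) ((z @ w) @ c)) \<xi>' \<longleftrightarrow> sat U ((!) (take m c @ w)) \<xi>"
        "sat U ((!) ((z @ w) @ c)) \<rho>' \<longleftrightarrow> sat U ((!) c) \<rho>"
        "sat U ((!) ((z @ w) @ c)) \<psi>' \<longleftrightarrow> sat U ((!) (drop m c @ z)) \<psi>"
      if "length w = l" "length c = m + n" for w c
    proof -
      show "sat U ((!) ((z @ w) @ c)) \<xi>' \<longleftrightarrow> sat U ((!) (take m c @ w)) \<xi>"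
        unfolding \<xi>'(2) by (rule sat_cong[OF \<xi>(1)]) (use z that in \<open>auto simp: \<sigma>_def nth_append l_def\<close>)
      show "sat U ((!) ((z @ w) @ c)) \<rho>' \<longleftrightarrow> sat U ((!) c) \<rho>"
        unfolding \<rho>'(2) by (rule sat_cong[OF \<rho>(2)]) (use z that in \<open>auto simp: nth_append\<close>)
      show "sat U ((!) ((z @ w) @ c)) \<psi>' \<longleftrightarrow> sat U ((!) (drop m c @ z)) \<psi>"
        unfolding \<psi>'(2) by (rule sat_cong[OF \<psi>]) (use z that in \<open>auto simp: \<tau>_def nth_append\<close>)
    qed
    ultimately show ?thesis using z by (simp add: \<theta>(2) \<beta>(2) Bex_def Ball_def cong: conj_cong) blast
  qed
  \<comment> \<open>The original d serves as w.\<close>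
  have "\<theta> \<in> s"
  proof -
    have "sat U ((!) (drop m c @ b)) \<psi>"
      if c: "length c = m + n" "set c \<subseteq> univ U" and "sat U ((!) (take m c @ d)) \<xi>" "sat U ((!) c) \<rho>" for c
    proof -
      have "sat U ((!) (take m c)) \<phi>" using that(3) c(1) by (simp add: sat_inst flip: \<xi>(2))
      then have "realizes U (take m c) (G \<inter> p)" by (simp add: \<phi>(3) realizes_def)
      then have "realizes U (take m c @ drop m c) (G \<inter> p)"
        using realizes_append[of "G \<inter> p" L "univ U" m "take m c" U "drop m c"] c(1) types_fm_in[OF p(1)]
        by (auto simp: subset_iff)
      moreover have "realizes U c (G \<inter> r)" using that(4) by (simp add: \<rho>(3) realizes_def)
      ultimately have "realizes U c G" using G(2) by (auto simp: realizes_def)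
      then have "sat U ((!) c) (shift m (inst n b \<psi>))" using G(3) c by (simp add: realizes_def)
      then have "sat U ((!) (drop m c)) (inst n b \<psi>)"
        using sat_shift[OF types_fm_in[OF q(1) b(4)] c(1)] by simp
      then show ?thesis using c(1) by (simp add: sat_inst)
    qed
    moreover have "sat U ((!) d) \<delta>" using \<delta>(2) by (simp add: tp_def)
    ultimately have "sat U ((!) b) \<theta>"
      unfolding sat_\<theta>[OF b(1)] using d by (intro bexI[of _ d]) (auto simp: l_def)
    then show ?thesis using b \<theta>(1) by (simp add: tp_def)
  qed
  moreover have "t \<in> d_set L U n k A q \<psi>" if t: "t \<in> types L U k A" "\<theta> \<in> t" for t
  proof -
    obtain z where z: "length z = k" "set z \<subseteq> univ U" "tp L U z A = t"
      using realize_type_over_A[OF t(1)] by blast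
    then have "sat U ((!) z) \<theta>" using t(2) by (auto simp: tp_def)
    then obtain w where w: "length w = l" "set w \<subseteq> univ U" "sat U ((!) w) \<delta>"
      "\<And>c. length c = m + n \<Longrightarrow> set c \<subseteq> univ U \<Longrightarrow> sat U ((!) (take m c @ w)) \<xi> \<Longrightarrow>
        sat U ((!) c) \<rho> \<Longrightarrow> sat U ((!) (drop m c @ z)) \<psi>"
      using sat_\<theta>[OF z(1)] by auto
    have "\<delta> \<in> tp L U w A" using w \<delta>(1) by (simp add: tp_def)
    then have "tp L U w A \<in> d_set L U m l A p \<xi>" using \<delta>(3) tp_in_types[OF w(2)] w(1) by blast
    \<comment> \<open>Membership in \<open>d_set\<close> only provides some w' with the type of w;
      invariance carries the formula back to w.\<close>
    then obtain w' where w': "length w' = l" "set w' \<subseteq> univ U" "tp L U w' A = tp L U w A" "inst m w' \<xi> \<in> p"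
      by (auto simp: d_set_def)
    have "fm_in L A (m + length w') \<xi>" using fm_in_mono[OF \<xi>(1)] w'(1) by (simp add: l_def)
    then have "inst m w \<xi> \<in> p" using invariant_inst_imp[OF p, of w' \<xi> w] w w' by simp
    have inst_z: "fm_in L (univ U) n (inst n z \<psi>)"
      by (rule fm_in_inst[of L "{}"]) (use \<psi> z in auto)
    \<comment> \<open>Otherwise consistency gives a common solution of \<xi>(x, w), \<rho>(x, y) and
      the negation of \<psi>(y, z), against \<theta>.\<close>
    have "inst n z \<psi> \<in> q"
    proof (rule ccontr)
      assume "inst n z \<psi> \<notin> q"
      then have "Neg (inst n z \<psi>) \<in> q" using types_Neg[OF q(1) inst_z] by simp
      then obtain c where c: "length c = m + n" "set c \<subseteq> univ U"
        "realizes U c {inst m w \<xi>, \<rho>, shift m (Neg (inst n z \<psi>))}"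
        using p_q_r_consistent \<open>inst m w \<xi> \<in> p\<close> \<rho>(1) unfolding fin_sat_in_def
        by (elim allE[of _ "{inst m w \<xi>, \<rho>, shift m (Neg (inst n z \<psi>))}"]) auto
      have split: "take m c @ drop m c = c" "length (take m c) = m" using c(1) by auto
      have "sat U ((!) (take m c)) (inst m w \<xi>)"
        using sat_append_left[OF types_fm_in[OF p(1) \<open>inst m w \<xi> \<in> p\<close>] split(2), of U "drop m c"] c(3) split(1)
        by (simp add: realizes_def)
      then have "sat U ((!) (take m c @ w)) \<xi>" using split(2) by (simp add: sat_inst)
      moreover have "sat U ((!) c) \<rho>" using c(3) by (simp add: realizes_def)
      ultimately have "sat U ((!) (drop m c @ z)) \<psi>" using w(4) c by blast
      moreover have "\<not> sat U ((!) (drop m c)) (inst n z \<psi>)"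
        using sat_shift[of L "univ U" n "Neg (inst n z \<psi>)" c m U] inst_z c by (simp add: realizes_def)
      ultimately show False using c(1) by (simp add: sat_inst)
    qed
    then show ?thesis using z by (auto simp: d_set_def)
  qed
  ultimately show "\<exists>\<theta>. fm_in L A k \<theta> \<and> \<theta> \<in> s \<and> {t \<in> types L U k A. \<theta> \<in> t} \<subseteq> d_set L U n k A q \<psi>"
    using \<theta>(1) by blast
qed

lemma definable_over_dominated:
  assumes "definable_over L U m A p"
  shows "definable_over L U n A q"
  unfolding definable_over_def
proof (intro conjI allI ballI q(2))
  fix k and \<psi> :: "('f, 'r, 'a) fm"
  assume "\<psi> \<in> formulas L {} (n + k)"
  then have \<psi>: "fm_in L {} (n + k) \<psi>" by simp
  show "openin (stone_topology L U k A) (d_set L U n k A q \<psi>)" by (rule d_set_open[OF assms \<psi>])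
  from openin_subset[OF this] have "d_set L U n k A q \<psi> \<subseteq> types L U k A"
    by (simp only: topspace_stone)
  moreover have "openin (stone_topology L U k A) (types L U k A - d_set L U n k A q \<psi>)"
    unfolding d_set_Neg[OF q \<psi>, symmetric] by (rule d_set_open[OF assms]) (use \<psi> in simp)
  ultimately show "closedin (stone_topology L U k A) (d_set L U n k A q \<psi>)"
    by (simp only: closedin_def topspace_stone)
qed

end

section \<open>Products of invariant types\<close>

lemma tp_restrict:
  assumes "B \<subseteq> C"
  shows "type_restrict L (length a) (tp L S a C) B = tp L S a B"
  using fm_in_mono[of L B "length a" _ C "length a"] assms by (auto simp: type_restrict_def tp_def)

locale monster_extension = monster L U A
  for L :: "('f, 'r) lang" and U :: "('f, 'r, 'a) struct" and A :: "'a set" +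
  fixes N :: "('f, 'r, 'a) struct"
  assumes extension: "realizes_global_types L U N"
begin

lemma univ_subset: "univ U \<subseteq> univ N"
  using extension by (simp add: realizes_global_types_def elementary_sub_def)

lemma elementary:
  assumes "fm_in L {} (length a) \<phi>" and "set a \<subseteq> univ U"
  shows "sat N ((!) a) \<phi> \<longleftrightarrow> sat U ((!) a) \<phi>"
  using extension assms by (simp add: realizes_global_types_def elementary_sub_def)

lemma elementary_params:
  assumes "fm_in L (univ U) (length a) \<phi>" and "set a \<subseteq> univ U"
  shows "sat N ((!) a) \<phi> \<longleftrightarrow> sat U ((!) a) \<phi>"
proof -
  obtain u \<psi> where u: "set u \<subseteq> univ U" "fm_in L {} (length a + length u) \<psi>" "inst (length a) u \<psi> = \<phi>"
    by (rule extract_params[OF assms(1)])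
  then show ?thesis
    using elementary[of "a @ u" \<psi>] assms(2) sat_inst[of a "length a" _ u \<psi>] by simp
qed

text \<open>Tarski-Vaught from N down to U: the parameters u lie in U, so the existential statement
  about u is reflected.\<close>

lemma realize_in_univ:
  assumes "fm_in L (univ U) (length b) \<phi>" and "set b \<subseteq> univ N" and "sat N ((!) b) \<phi>"
  obtains c where "length c = length b" and "set c \<subseteq> univ U" and "sat U ((!) c) \<phi>"
proof -
  obtain u \<psi> where u: "set u \<subseteq> univ U" "fm_in L {} (length b + length u) \<psi>" "inst (length b) u \<psi> = \<phi>"
    by (rule extract_params[OF assms(1)])
  obtain \<eta> where \<eta>: "fm_in L {} (length u) \<eta>"
    "\<And>S a. length a = length u \<Longrightarrow>
      sat S ((!) a) \<eta> \<longleftrightarrow> (\<exists>c\<in>tuples (length b) (univ S). sat S ((!) (c @ a)) \<psi>)"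
    by (rule ex_formula_left[OF u(2)]) blast
  have "sat N ((!) (b @ u)) \<psi>" using assms(3) unfolding u(3)[symmetric] by (simp add: sat_inst)
  then have "sat N ((!) u) \<eta>" using assms(2) by (auto simp: \<eta>(2))
  then have "sat U ((!) u) \<eta>" using elementary[OF \<eta>(1) u(1)] by simp
  then obtain c where "length c = length b" "set c \<subseteq> univ U" "sat U ((!) (c @ u)) \<psi>"
    by (auto simp: \<eta>(2))
  then show thesis using that[of c] sat_inst[of c "length b" U u \<psi>] u(3) by simp
qed

lemma tp_extension:
  assumes "set a \<subseteq> univ U" and "B \<subseteq> univ U"
  shows "tp L N a B = tp L U a B"
  using assms fm_in_mono[of L B "length a" _ "univ U" "length a"] elementary_params[of a]
  by (auto simp: tp_def)

lemma tp_extension_in_types: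
  assumes "set b \<subseteq> univ N" and "B \<subseteq> univ U"
  shows "tp L N b B \<in> types L U (length b) B"
proof -
  have "\<exists>a\<in>tuples (length b) (univ U). realizes U a F" if F: "finite F" "F \<subseteq> tp L N b B" for F
  proof -
    have "F \<subseteq> formulas L B (length b)" using F(2) by (auto simp: tp_def)
    from conj_formula[OF F(1) this] obtain \<phi> where \<phi>: "fm_in L B (length b) \<phi>"
      "\<And>S e. sat S e \<phi> \<longleftrightarrow> (\<forall>\<phi>\<in>F. sat S e \<phi>)" by blast
    have "fm_in L (univ U) (length b) \<phi>" using fm_in_mono[OF \<phi>(1) assms(2)] by simp
    moreover have "sat N ((!) b) \<phi>" using F(2) by (auto simp: \<phi>(2) tp_def)
    ultimately obtain c where "length c = length b" "set c \<subseteq> univ U" "sat U ((!) c) \<phi>"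
      using realize_in_univ assms(1) by metis
    then show ?thesis by (intro bexI[of _ c]) (auto simp: realizes_def \<phi>(2))
  qed
  moreover have "tp L N b B \<subseteq> formulas L B (length b)" by (auto simp: tp_def)
  moreover have "\<forall>\<phi>\<in>formulas L B (length b). \<phi> \<in> tp L N b B \<or> Neg \<phi> \<in> tp L N b B"
    by (auto simp: tp_def)
  ultimately show ?thesis unfolding types_def fin_sat_in_def by simp
qed

text \<open>This lets p be evaluated at parameters outside U: by invariance only their type over A
  counts, and a counterpart in U has the same one.\<close>

lemma realize_tp_over_A:
  assumes "set b \<subseteq> univ N"
  obtains c where "length c = length b" and "set c \<subseteq> univ U" and "tp L U c A = tp L N b A"
  using realize_type_over_A[OF tp_extension_in_types[OF assms A_subset]] by blast

section \<open>The invariant extension p | B and products\<close>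

context
  fixes m p
  assumes p: "p \<in> types L U m (univ U)" "invariant L U A p"
begin

text \<open>The counterparts b' and c' are chosen independently, and the implication may fail
  between them. Realizing the type of the concatenation gives b'' and c'' for which it holds;
  invariance leads from c' to c'' before using it, and from b'' to b' afterwards.\<close>

lemma transfer_implication:
  assumes \<psi>: "fm_in L {} (m + length b) \<psi>" and \<phi>: "fm_in L {} (m + length c) \<phi>"
    and b: "set b \<subseteq> univ N" "length b' = length b" "set b' \<subseteq> univ U" "tp L U b' A = tp L N b A"
    and c: "set c \<subseteq> univ N" "length c' = length c" "set c' \<subseteq> univ U" "tp L U c' A = tp L N c A"
    and imp: "\<And>a. length a = m \<Longrightarrow> set a \<subseteq> univ N \<Longrightarrow> sat N ((!) (a @ c)) \<phi> \<Longrightarrow> sat N ((!) (a @ b)) \<psi>"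
    and mem: "inst m c' \<phi> \<in> p"
  shows "inst m b' \<psi> \<in> p"
proof -
  have "set (b @ c) \<subseteq> univ N" using b c by simp
  then obtain d where d: "length d = length (b @ c)" "set d \<subseteq> univ U" "tp L U d A = tp L N (b @ c) A"
    by (rule realize_tp_over_A)
  define b'' c'' where "b'' = take (length b) d" and "c'' = drop (length b) d"
  have bc: "length b'' = length b" "length c'' = length c" "set b'' \<subseteq> univ U" "set c'' \<subseteq> univ U" "d = b'' @ c''"
    using d set_take_subset[of "length b" d] set_drop_subset[of "length b" d]
    by (auto simp: b''_def c''_def)
  have tps: "tp L U b'' A = tp L U b' A" "tp L U c'' A = tp L U c' A"
    using tp_eq_take_drop[of b'' b L U c'' A N c] d(3) b(4) c(4) bc by auto
  \<comment> \<open>\<psi> uses the blocks x, y and \<phi> the blocks x, z; in the joint order x, y,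
    z only \<phi> is renamed.\<close>
  define \<sigma> where "\<sigma> i = (if i < m then i else length b + i)" for i
  obtain \<phi>' where \<phi>': "fm_in L {} (m + (length b + length c)) \<phi>'" "\<And>S e. sat S e \<phi>' \<longleftrightarrow> sat S (e \<circ> \<sigma>) \<phi>"
    by (rule reindex_formula[OF \<phi>, of \<sigma> "m + (length b + length c)"]) (auto simp: \<sigma>_def)
  have "fm_in L {} (m + (length b + length c)) (Neg (Imp \<phi>' \<psi>))"
    using \<phi>'(1) fm_in_mono[OF \<psi>] by simp
  then obtain \<eta> where \<eta>: "fm_in L {} (length b + length c) \<eta>"
    "\<And>S y. length y = length b + length c \<Longrightarrow>
      sat S ((!) y) \<eta> \<longleftrightarrow> (\<exists>a\<in>tuples m (univ S). sat S ((!) (a @ y)) (Neg (Imp \<phi>' \<psi>)))"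
    by (rule ex_formula_left) blast
  have sat_\<eta>: "sat S ((!) (y @ z)) \<eta> \<longleftrightarrow>
      (\<exists>a\<in>tuples m (univ S). sat S ((!) (a @ z)) \<phi> \<and> \<not> sat S ((!) (a @ y)) \<psi>)"
    if yz: "length y = length b" "length z = length c" for S y z
  proof -
    have "sat S ((!) (a @ y @ z)) \<phi>' \<longleftrightarrow> sat S ((!) (a @ z)) \<phi>" if "length a = m" for a
      unfolding \<phi>'(2) by (rule sat_cong[OF \<phi>]) (use that yz in \<open>auto simp: \<sigma>_def nth_append\<close>)
    moreover have "sat S ((!) (a @ y @ z)) \<psi> \<longleftrightarrow> sat S ((!) (a @ y)) \<psi>" if "length a = m" for a
      using sat_append_left[OF \<psi>, of "a @ y" S z] that yz by simp
    ultimately show ?thesis using yz by (auto simp: \<eta>(2))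
  qed
  have "\<not> sat N ((!) (b @ c)) \<eta>" using imp by (auto simp: sat_\<eta>)
  then have "\<not> sat U ((!) (b'' @ c'')) \<eta>"
    using d(1,3) fm_in_mono[OF \<eta>(1), of A "length b + length c"] bc(5) tp_eq_iff[of d "b @ c" L U A N]
    by simp
  then have imp': "sat U ((!) (a @ b'')) \<psi>" if "length a = m" "set a \<subseteq> univ U" "sat U ((!) (a @ c'')) \<phi>" for a
    using that bc by (auto simp: sat_\<eta>)
  have "fm_in L A (m + length c') \<phi>" using fm_in_mono[OF \<phi>] c by simp
  then have mem'': "inst m c'' \<phi> \<in> p" using invariant_inst_imp[OF p, of c' \<phi> c''] mem tps bc c by simp
  have "inst m b'' \<psi> \<in> p"
  proof (rule types_closed[OF p(1), of "{inst m c'' \<phi>}"])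
    show "fm_in L (univ U) m (inst m b'' \<psi>)"
      by (rule fm_in_inst[of L "{}"]) (use \<psi> bc in auto)
    show "sat U ((!) a) (inst m b'' \<psi>)"
      if "length a = m" "set a \<subseteq> univ U" "realizes U a {inst m c'' \<phi>}" for a
      using imp'[OF that(1,2)] that(1,3) by (simp add: realizes_def sat_inst)
  qed (use mem'' in auto)
  moreover have "fm_in L A (m + length b'') \<psi>" using fm_in_mono[OF \<psi>] bc by simp
  ultimately show ?thesis using invariant_inst_imp[OF p, of b'' \<psi> b'] tps bc b by simp
qed

text \<open>The explicit candidate for p | B: a formula belongs to it if p contains its copy at some
  counterpart b' in U of its parameters.\<close>

definition extend :: "'a set \<Rightarrow> ('f, 'r, 'a) fm set" where
  "extend B = {inst m b \<psi> | b \<psi> b'. set b \<subseteq> B \<and> fm_in L {} (m + length b) \<psi> \<and>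
     length b' = length b \<and> set b' \<subseteq> univ U \<and> tp L U b' A = tp L N b A \<and> inst m b' \<psi> \<in> p}"

text \<open>A formula is \<open>inst m b \<psi>\<close> in several ways, and b has many
  counterparts. Two ways of writing one formula imply each other, so
  \<open>transfer_implication\<close> shows that neither choice matters.\<close>

lemma inst_in_extend_iff:
  assumes "B \<subseteq> univ N" and \<psi>: "fm_in L {} (m + length b) \<psi>"
    and b: "set b \<subseteq> B" "length b' = length b" "set b' \<subseteq> univ U" "tp L U b' A = tp L N b A"
  shows "inst m b \<psi> \<in> extend B \<longleftrightarrow> inst m b' \<psi> \<in> p"
proof
  assume "inst m b \<psi> \<in> extend B"
  then obtain c \<phi> c' where c: "inst m b \<psi> = inst m c \<phi>" "set c \<subseteq> B" "fm_in L {} (m + length c) \<phi>"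
    "length c' = length c" "set c' \<subseteq> univ U" "tp L U c' A = tp L N c A" "inst m c' \<phi> \<in> p"
    unfolding extend_def by blast
  show "inst m b' \<psi> \<in> p"
  proof (rule transfer_implication[OF \<psi> c(3) _ b(2-4) _ c(4-6) _ c(7)])
    show "set b \<subseteq> univ N" "set c \<subseteq> univ N" using assms(1) b(1) c(2) by auto
    show "sat N ((!) (a @ b)) \<psi>" if "length a = m" "sat N ((!) (a @ c)) \<phi>" for a
      using that c(1) sat_inst[of a m N b \<psi>] sat_inst[of a m N c \<phi>] by simp
  qed
qed (use assms in \<open>auto simp: extend_def\<close>)

lemma p_subset_extend:
  assumes "univ U \<subseteq> B"
  shows "p \<subseteq> extend B"
proof
  fix \<phi> assume "\<phi> \<in> p"
  obtain u \<psi> where u: "set u \<subseteq> univ U" "fm_in L {} (m + length u) \<psi>" "inst m u \<psi> = \<phi>"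
    by (rule extract_params[OF types_fm_in[OF p(1) \<open>\<phi> \<in> p\<close>]])
  then show "\<phi> \<in> extend B"
    using \<open>\<phi> \<in> p\<close> assms tp_extension[OF u(1) A_subset] unfolding extend_def by blast
qed

lemma extend_in_types:
  assumes B: "univ U \<subseteq> B" "B \<subseteq> univ N"
  shows "extend B \<in> types L N m B"
proof -
  have fm: "fm_in L B m (inst m b \<psi>)" if "set b \<subseteq> B" "fm_in L {} (m + length b) \<psi>" for b \<psi>
    by (rule fm_in_inst[of L "{}"]) (use that in auto)
  then have sub: "extend B \<subseteq> formulas L B m" by (auto simp: extend_def)
  have "\<phi> \<in> extend B \<or> Neg \<phi> \<in> extend B" if \<phi>: "fm_in L B m \<phi>" for \<phi>
  proof -
    obtain b \<psi> where b: "set b \<subseteq> B" "fm_in L {} (m + length b) \<psi>" "inst m b \<psi> = \<phi>"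
      by (rule extract_params[OF \<phi>])
    obtain b' where b': "length b' = length b" "set b' \<subseteq> univ U" "tp L U b' A = tp L N b A"
      using realize_tp_over_A[of b] b(1) B(2) by blast
    have "fm_in L (univ U) m (inst m b' \<psi>)" by (rule fm_in_inst[of L "{}"]) (use b b' in auto)
    then have "inst m b' \<psi> \<in> p \<or> inst m b' (Neg \<psi>) \<in> p"
      using types_Neg[OF p(1)] by (auto simp: inst_Neg)
    then have "inst m b \<psi> \<in> extend B \<or> inst m b (Neg \<psi>) \<in> extend B"
      using inst_in_extend_iff[OF B(2) _ b(1) b'] b(2) by simp
    then show ?thesis by (simp add: inst_Neg b(3))
  qed
  \<comment> \<open>Joint solvability at b depends only on the type of b over A, and it holds at b'
    because the copies lie in p.\<close>
  moreover have "\<exists>a\<in>tuples m (univ N). realizes N a F" if F: "finite F" "F \<subseteq> extend B" for F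
  proof -
    have "F \<subseteq> formulas L B m" using F(2) sub by blast
    then obtain b \<psi> where b: "set b \<subseteq> B" "\<And>\<phi>. \<phi> \<in> F \<Longrightarrow> fm_in L {} (m + length b) (\<psi> \<phi>)"
      "\<And>\<phi>. \<phi> \<in> F \<Longrightarrow> inst m b (\<psi> \<phi>) = \<phi>"
      by (rule common_params[OF F(1)]) blast
    obtain b' where b': "length b' = length b" "set b' \<subseteq> univ U" "tp L U b' A = tp L N b A"
      using realize_tp_over_A[of b] b(1) B(2) by blast
    have in_p: "inst m b' (\<psi> \<phi>) \<in> p" if "\<phi> \<in> F" for \<phi>
      using inst_in_extend_iff[OF B(2) b(2)[OF that] b(1) b'] b(3)[OF that] F(2) that by auto
    have G: "finite (\<psi> ` F)" "\<psi> ` F \<subseteq> formulas L {} (m + length b)" using F(1) b(2) by auto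
    obtain \<phi> where \<phi>: "fm_in L {} (m + length b) \<phi>" "\<And>S e. sat S e \<phi> \<longleftrightarrow> (\<forall>\<phi>\<in>\<psi> ` F. sat S e \<phi>)"
      by (rule conj_formula[OF G]) blast
    obtain \<eta> where \<eta>: "fm_in L {} (length b) \<eta>"
      "\<And>S y. length y = length b \<Longrightarrow> sat S ((!) y) \<eta> \<longleftrightarrow> (\<exists>a\<in>tuples m (univ S). sat S ((!) (a @ y)) \<phi>)"
      by (rule ex_formula_left[OF \<phi>(1)]) blast
    have "(\<lambda>\<phi>. inst m b' (\<psi> \<phi>)) ` F \<subseteq> p" using in_p by blast
    then obtain a where a: "length a = m" "set a \<subseteq> univ U" "realizes U a ((\<lambda>\<phi>. inst m b' (\<psi> \<phi>)) ` F)"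
      using types_realize_finite[OF p(1) finite_imageI[OF F(1)]] by metis
    then have "sat U ((!) (a @ b')) \<phi>" by (auto simp: \<phi>(2) realizes_def sat_inst)
    then have "sat U ((!) b') \<eta>" using a b'(1) by (auto simp: \<eta>(2))
    then have "sat N ((!) b) \<eta>"
      using b'(1,3) fm_in_mono[OF \<eta>(1)] tp_eq_iff[of b' b L U A N] by simp
    then obtain a' where a': "length a' = m" "set a' \<subseteq> univ N" "sat N ((!) (a' @ b)) \<phi>"
      by (auto simp: \<eta>(2))
    have "sat N ((!) a') \<phi>'" if "\<phi>' \<in> F" for \<phi>'
      using a'(1,3) that sat_inst[of a' m N b "\<psi> \<phi>'"] b(3)[OF that] by (simp add: \<phi>(2))
    then show ?thesis using a' by (intro bexI[of _ a']) (auto simp: realizes_def)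
  qed
  ultimately show ?thesis using sub by (auto simp: types_def fin_sat_in_def)
qed

text \<open>Uniqueness: b and its counterpart b' both lie in B, so an invariant s treats them alike,
  and at b' it agrees with p.\<close>

lemma invariant_ext_eq:
  assumes B: "univ U \<subseteq> B" "B \<subseteq> univ N"
  shows "invariant_ext L N m A p B = extend B"
  unfolding invariant_ext_def
proof (rule the_equality, intro conjI)
  show "extend B \<in> types L N m B" by (rule extend_in_types[OF B])
  show "p \<subseteq> extend B" by (rule p_subset_extend[OF B(1)])
  show "invariant_over L N m A B (extend B)"
    unfolding invariant_over_def
  proof (intro allI ballI impI)
    fix k b b' and \<psi> :: "('f, 'r, 'a) fm"
    assume \<psi>: "\<psi> \<in> formulas L {} (m + k)" and b: "b \<in> tuples k B" and b': "b' \<in> tuples k B"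
      and eq: "tp L N b A = tp L N b' A"
    obtain c where "length c = length b" "set c \<subseteq> univ U" "tp L U c A = tp L N b A"
      using realize_tp_over_A[of b] b B(2) by auto
    then show "inst m b \<psi> \<in> extend B \<longleftrightarrow> inst m b' \<psi> \<in> extend B"
      using inst_in_extend_iff[OF B(2), of b \<psi> c] inst_in_extend_iff[OF B(2), of b' \<psi> c] \<psi> b b' eq
      by simp
  qed
next
  fix s assume s: "s \<in> types L N m B \<and> p \<subseteq> s \<and> invariant_over L N m A B s"
  have "\<phi> \<in> s \<longleftrightarrow> \<phi> \<in> extend B" if \<phi>: "fm_in L B m \<phi>" for \<phi>
  proof -
    obtain b \<psi> where b: "set b \<subseteq> B" "fm_in L {} (m + length b) \<psi>" "inst m b \<psi> = \<phi>"
      by (rule extract_params[OF \<phi>])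
    obtain b' where b': "length b' = length b" "set b' \<subseteq> univ U" "tp L U b' A = tp L N b A"
      using realize_tp_over_A[of b] b(1) B(2) by blast
    have fm: "fm_in L (univ U) m (inst m b' \<psi>)" by (rule fm_in_inst[of L "{}"]) (use b b' in auto)
    have "tp L N b A = tp L N b' A" using b' tp_extension[OF b'(2) A_subset] by simp
    then have "inst m b \<psi> \<in> s \<longleftrightarrow> inst m b' \<psi> \<in> s"
      using s b b' B(1) unfolding invariant_over_def by auto
    also have "\<dots> \<longleftrightarrow> inst m b' \<psi> \<in> p"
      using types_subset_mem[OF p(1) _ _ fm] s by blast
    also have "\<dots> \<longleftrightarrow> inst m b \<psi> \<in> extend B" using inst_in_extend_iff[OF B(2) b(2,1) b'] by simp
    finally show ?thesis by (simp add: b(3))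
  qed
  then show "s = extend B"
    using types_fm_in[of s L N m B] types_fm_in[OF extend_in_types[OF B]] s by blast
qed

text \<open>With C the universe of U, this makes products independent of the chosen realization of
  q; with C = A, it replaces a realization in N by a tuple of U. Parameters from C are appended to b
  and b'.\<close>

lemma inst_in_invariant_ext_cong:
  assumes C: "A \<subseteq> C" "C \<subseteq> univ U" and \<phi>: "fm_in L C (m + length b) \<phi>"
    and b: "length b = length b'" "tp L N b C = tp L N b' C"
    and B: "univ U \<subseteq> B" "B \<subseteq> univ N" "set b \<subseteq> B"
    and B': "univ U \<subseteq> B'" "B' \<subseteq> univ N" "set b' \<subseteq> B'"
  shows "inst m b \<phi> \<in> invariant_ext L N m A p B \<longleftrightarrow> inst m b' \<phi> \<in> invariant_ext L N m A p B'"
proof -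
  obtain u \<psi> where u: "set u \<subseteq> C" "fm_in L {} (m + length b + length u) \<psi>" "inst (m + length b) u \<psi> = \<phi>"
    by (rule extract_params[OF \<phi>])
  have "set u \<subseteq> univ N" using u(1) C(2) univ_subset by (meson subset_trans)
  with B have "set (b @ u) \<subseteq> univ N" by auto
  then obtain c where c: "length c = length (b @ u)" "set c \<subseteq> univ U" "tp L U c A = tp L N (b @ u) A"
    by (rule realize_tp_over_A)
  have eq: "tp L N (b @ u) A = tp L N (b' @ u) A"
    by (rule tp_eq_mono[OF _ tp_eq_append[OF b u(1)] C(1)]) (use b in simp)
  have *: "inst m d \<phi> \<in> extend D \<longleftrightarrow> inst m c \<psi> \<in> p"
    if d: "length d = length b" "set d \<subseteq> D" "tp L N (d @ u) A = tp L N (b @ u) A"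
      and D: "univ U \<subseteq> D" "D \<subseteq> univ N" for d D
  proof -
    have "inst m d \<phi> \<in> extend D \<longleftrightarrow> inst m (d @ u) \<psi> \<in> extend D"
    proof (rule types_equiv[OF extend_in_types[OF D]])
      show "fm_in L D m (inst m d \<phi>)"
        by (rule fm_in_inst[of L C]) (use \<phi> d C D in auto)
      show "fm_in L D m (inst m (d @ u) \<psi>)"
        by (rule fm_in_inst[of L "{}"]) (use u d C D in \<open>auto simp: add.assoc\<close>)
      show "sat N ((!) a) (inst m d \<phi>) \<longleftrightarrow> sat N ((!) a) (inst m (d @ u) \<psi>)" if "length a = m" for a
        using that d(1) sat_inst[of "a @ d" "m + length b" N u \<psi>] by (simp add: sat_inst u(3))
    qed
    also have "\<dots> \<longleftrightarrow> inst m c \<psi> \<in> p"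
      by (rule inst_in_extend_iff[OF D(2)]) (use u c d C D in \<open>auto simp: add.assoc\<close>)
    finally show ?thesis .
  qed
  show ?thesis
    unfolding invariant_ext_eq[OF B(1,2)] invariant_ext_eq[OF B'(1,2)]
    using *[OF refl B(3) refl B(1,2)] *[OF b(1)[symmetric] B'(3) eq[symmetric] B'(1,2)] by simp
qed

text \<open>The definition asks for some realization of q; any two have the same type over U and
  therefore decide alike.\<close>

lemma tensor_mem_iff:
  assumes q: "q \<in> types L U k (univ U)" and b: "length b = k" "set b \<subseteq> univ N" "realizes N b q"
    and \<phi>: "fm_in L (univ U) (m + k) \<phi>"
  shows "\<phi> \<in> tensor L U N A m k p q \<longleftrightarrow> inst m b \<phi> \<in> invariant_ext L N m A p (univ U \<union> set b)"
proof -
  have indep: "inst m b' \<phi> \<in> invariant_ext L N m A p (univ U \<union> set b') \<longleftrightarrow>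
      inst m b \<phi> \<in> invariant_ext L N m A p (univ U \<union> set b)"
    if b': "length b' = k" "set b' \<subseteq> univ N" "realizes N b' q" for b'
  proof (rule inst_in_invariant_ext_cong[OF A_subset subset_refl])
    show "tp L N b' (univ U) = tp L N b (univ U)" using tp_eqI[OF q] b b' by simp
  qed (use b b' \<phi> univ_subset in auto)
  show ?thesis
  proof
    assume "\<phi> \<in> tensor L U N A m k p q"
    then have "\<exists>b'\<in>tuples k (univ N). realizes N b' q \<and>
        inst m b' \<phi> \<in> invariant_ext L N m A p (univ U \<union> set b')"
      unfolding tensor_def by (elim CollectE conjE)
    then show "inst m b \<phi> \<in> invariant_ext L N m A p (univ U \<union> set b)"
      by (elim bexE conjE) (simp add: indep)
  next
    assume "inst m b \<phi> \<in> invariant_ext L N m A p (univ U \<union> set b)"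
    moreover have "b \<in> tuples k (univ N)" using b by simp
    ultimately show "\<phi> \<in> tensor L U N A m k p q"
      unfolding tensor_def using b(3) \<phi> by (intro CollectI conjI bexI[of _ b]) simp_all
  qed
qed

text \<open>Completeness and finite satisfiability are inherited from p | Ub; solutions found in N
  are reflected into U.\<close>

lemma tensor_in_types:
  assumes q: "q \<in> types L U k (univ U)"
  shows "tensor L U N A m k p q \<in> types L U (m + k) (univ U)"
proof -
  have "\<exists>b\<in>tuples k (univ N). realizes N b q"
    using extension q unfolding realizes_global_types_def by blast
  then obtain b where b: "length b = k" "set b \<subseteq> univ N" "realizes N b q" by auto
  let ?E = "invariant_ext L N m A p (univ U \<union> set b)"
  have E: "?E \<in> types L N m (univ U \<union> set b)"
    using invariant_ext_eq[of "univ U \<union> set b"] extend_in_types[of "univ U \<union> set b"] b univ_subset by simp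
  have mem: "\<phi> \<in> tensor L U N A m k p q \<longleftrightarrow> inst m b \<phi> \<in> ?E" if "fm_in L (univ U) (m + k) \<phi>" for \<phi>
    by (rule tensor_mem_iff[OF q b that])
  have sub: "tensor L U N A m k p q \<subseteq> formulas L (univ U) (m + k)" by (auto simp: tensor_def)
  have "\<phi> \<in> tensor L U N A m k p q \<or> Neg \<phi> \<in> tensor L U N A m k p q"
    if \<phi>: "fm_in L (univ U) (m + k) \<phi>" for \<phi>
  proof -
    have "fm_in L (univ U \<union> set b) m (inst m b \<phi>)"
      by (rule fm_in_inst[of L "univ U"]) (use \<phi> b in auto)
    then show ?thesis using types_Neg[OF E] mem[of \<phi>] mem[of "Neg \<phi>"] \<phi> by (simp add: inst_Neg)
  qed
  moreover have "\<exists>c\<in>tuples (m + k) (univ U). realizes U c F"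
    if F: "finite F" "F \<subseteq> tensor L U N A m k p q" for F
  proof -
    have F': "F \<subseteq> formulas L (univ U) (m + k)" using F(2) sub by blast
    have "inst m b \<phi> \<in> ?E" if "\<phi> \<in> F" for \<phi>
      using mem[of \<phi>] subsetD[OF F' that] subsetD[OF F(2) that] by simp
    then have "inst m b ` F \<subseteq> ?E" by blast
    then obtain a where a: "length a = m" "set a \<subseteq> univ N" "realizes N a (inst m b ` F)"
      using types_realize_finite[OF E finite_imageI[OF F(1)]] by metis
    obtain \<phi> where \<phi>: "fm_in L (univ U) (m + k) \<phi>" "\<And>S e. sat S e \<phi> \<longleftrightarrow> (\<forall>\<phi>\<in>F. sat S e \<phi>)"
      by (rule conj_formula[OF F(1) F']) blast
    have "sat N ((!) (a @ b)) \<phi>" using a by (auto simp: \<phi>(2) realizes_def sat_inst)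
    then obtain c where "length c = m + k" "set c \<subseteq> univ U" "sat U ((!) c) \<phi>"
      using realize_in_univ[of "a @ b" \<phi>] \<phi>(1) a b by auto
    then show ?thesis by (intro bexI[of _ c]) (auto simp: realizes_def \<phi>(2))
  qed
  ultimately show ?thesis using sub by (auto simp: types_def fin_sat_in_def)
qed

text \<open>A realization b of q in N and the tuple c have the same type over A, and at c the
  extension p | U agrees with p. Products over A thus become visible inside U.\<close>

lemma tensor_over_A:
  assumes q: "q \<in> types L U k (univ U)"
    and c: "set c \<subseteq> univ U" "length c = k" "tp L U c A = type_restrict L k q A"
    and \<phi>: "fm_in L A (m + k) \<phi>"
  shows "\<phi> \<in> tensor L U N A m k p q \<longleftrightarrow> inst m c \<phi> \<in> p"
proof -
  have "\<exists>b\<in>tuples k (univ N). realizes N b q"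
    using extension q unfolding realizes_global_types_def by blast
  then obtain b where b: "length b = k" "set b \<subseteq> univ N" "realizes N b q" by auto
  have \<phi>': "fm_in L (univ U) (m + k) \<phi>" using fm_in_mono[OF \<phi> A_subset] by simp
  have tps: "tp L N b A = tp L N c A"
    using tp_restrict[OF A_subset, of L b N] tp_eqI[OF q b(1,3)] b(1) c tp_extension[OF c(1) A_subset] by simp
  have fm: "fm_in L (univ U) m (inst m c \<phi>)"
    by (rule fm_in_inst[of L "univ U"]) (use \<phi>' c in auto)
  have "\<phi> \<in> tensor L U N A m k p q \<longleftrightarrow> inst m b \<phi> \<in> invariant_ext L N m A p (univ U \<union> set b)"
    by (rule tensor_mem_iff[OF q b \<phi>'])
  also have "\<dots> \<longleftrightarrow> inst m c \<phi> \<in> invariant_ext L N m A p (univ U)"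
    by (rule inst_in_invariant_ext_cong[OF subset_refl A_subset]) (use \<phi> b c tps univ_subset in auto)
  also have "\<dots> \<longleftrightarrow> inst m c \<phi> \<in> p"
    unfolding invariant_ext_eq[OF subset_refl univ_subset]
    by (rule types_subset_mem[OF p(1) extend_in_types[OF subset_refl univ_subset]
          p_subset_extend[OF subset_refl] fm])
  finally show ?thesis .
qed

lemma morley_power_in_types:
  "morley_power L U N A m p (Suc k) \<in> types L U (Suc k * m) (univ U)"
proof (induction k)
  case (Suc k)
  then show ?case using tensor_in_types[OF Suc.IH] by simp
qed (use p in simp)

end

end

section \<open>Morley sequences\<close>

lemma length_concat_uniform: "\<forall>x\<in>set xs. length x = m \<Longrightarrow> length (concat xs) = length xs * m"
  by (induction xs) auto

lemma nth_concat_uniform: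
  "\<forall>x\<in>set xs. length x = m \<Longrightarrow> i < length xs \<Longrightarrow> t < m \<Longrightarrow> concat xs ! (i * m + t) = xs ! i ! t"
proof (induction xs arbitrary: i)
  case (Cons x xs)
  then show ?case by (cases i) (auto simp: nth_append add.assoc)
qed simp

text \<open>Morley powers list tuples from last to first, indiscernibility from first to last. The
  permutation depends only on the number and length of the blocks, so equality of types survives
  reversal.\<close>

lemma concat_rev_reindex:
  "\<exists>js. (\<forall>j\<in>set js. j < l * m) \<and>
    (\<forall>xs :: 'a list list. length xs = l \<and> (\<forall>x\<in>set xs. length x = m) \<longrightarrow> concat (rev xs) = map ((!) (concat xs)) js)"
proof (induction l)
  case (Suc l)
  then obtain js where js: "\<forall>j\<in>set js. j < l * m"
    "\<forall>xs :: 'a list list. length xs = l \<and> (\<forall>x\<in>set xs. length x = m) \<longrightarrow>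
      concat (rev xs) = map ((!) (concat xs)) js"
    by (elim exE conjE)
  have "concat (rev xs) = map ((!) (concat xs)) (map ((+) m) js @ [0..<m])"
    if xs: "length xs = Suc l" "\<forall>x\<in>set xs. length x = m" for xs :: "'a list list"
  proof -
    obtain y ys where y: "xs = y # ys" "length ys = l" using xs(1) by (cases xs) auto
    have "map ((!) (y @ concat ys)) [0..<m] = y"
      using xs(2) y(1) by (auto intro!: nth_equalityI simp: nth_append)
    moreover have "map ((!) (y @ concat ys)) (map ((+) m) js) = map ((!) (concat ys)) js"
      using xs(2) y(1) by (auto simp: nth_append)
    moreover have "concat (rev ys) = map ((!) (concat ys)) js"
      using js(2) xs(2) y by simp
    ultimately show ?thesis using y(1) by simp
  qed
  moreover have "\<forall>j\<in>set (map ((+) m) js @ [0..<m]). j < Suc l * m" using js(1) by auto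
  ultimately show ?case by (intro exI[of _ "map ((+) m) js @ [0..<m]"]) simp
qed auto

lemma tp_eq_concat_rev:
  assumes "length xs = length ys" and "\<forall>x\<in>set xs. length x = m" and "\<forall>y\<in>set ys. length y = m"
    and "tp L S (concat (rev xs)) A = tp L S' (concat (rev ys)) A"
  shows "tp L S (concat xs) A = tp L S' (concat ys) A"
proof -
  obtain js where js: "\<forall>j\<in>set js. j < length ys * m"
    "\<forall>zs :: 'a list list. length zs = length ys \<and> (\<forall>x\<in>set zs. length x = m) \<longrightarrow>
      concat (rev zs) = map ((!) (concat zs)) js"
    using concat_rev_reindex[of "length ys" m] by (elim exE conjE)
  have len: "length (concat (rev xs)) = length ys * m" "length (concat (rev ys)) = length ys * m"
    using length_concat_uniform[of "rev xs" m] length_concat_uniform[of "rev ys" m] assms(1-3) by auto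
  have "tp L S (map ((!) (concat (rev xs))) js) A = tp L S' (map ((!) (concat (rev ys))) js) A"
    by (rule tp_eq_reindex[OF _ assms(4)]) (use js(1) len in auto)
  then show ?thesis using spec[OF js(2), of "rev xs"] spec[OF js(2), of "rev ys"] assms(1-3) by simp
qed

text \<open>Homogeneity concerns single elements: the pairs (i, t) of block and position index them
  as a family.\<close>

lemma tp_eq_concat_select:
  assumes "length xs = length ys" and "\<forall>x\<in>set xs. length x = m" and "\<forall>y\<in>set ys. length y = m"
    and "tp L S (concat xs) A = tp L S' (concat ys) A"
    and js: "\<forall>(i, t)\<in>set js. i < length ys \<and> t < m"
  shows "tp L S (map (\<lambda>(i, t). xs ! i ! t) js) A = tp L S' (map (\<lambda>(i, t). ys ! i ! t) js) A"
proof -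
  let ?ks = "map (\<lambda>(i, t). i * m + t) js"
  have len: "length (concat xs) = length ys * m" "length (concat ys) = length ys * m"
    using length_concat_uniform[of xs m] length_concat_uniform[of ys m] assms(1-3) by auto
  have "i * m + t < length ys * m" if "i < length ys" "t < m" for i t
  proof -
    have "i * m + t < Suc i * m" using that by simp
    also have "\<dots> \<le> length ys * m" using that by (intro mult_le_mono1) simp
    finally show ?thesis .
  qed
  then have tps: "tp L S (map ((!) (concat xs)) ?ks) A = tp L S' (map ((!) (concat ys)) ?ks) A"
    using js len by (intro tp_eq_reindex[OF _ assms(4)]) auto
  have select: "map ((!) (concat zs)) ?ks = map (\<lambda>(i, t). zs ! i ! t) js"
    if "length zs = length ys" "\<forall>z\<in>set zs. length z = m" for zs :: "'a list list"
    using js that nth_concat_uniform[of zs m] by auto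
  show ?thesis using tps unfolding select[OF assms(1,2)] select[OF refl assms(3)] .
qed

section \<open>Generic sequences\<close>

lemma card_countable_ordLeq:
  assumes "countable X" and "infinite A"
  shows "(card_of X, card_of A) \<in> ordLeq"
proof -
  obtain f :: "'a \<Rightarrow> nat" where "inj_on f X" using assms(1) by (auto simp: countable_def)
  then have "(card_of X, card_of (UNIV :: nat set)) \<in> ordLeq" using card_of_ordLeq by blast
  moreover have "(card_of (UNIV :: nat set), card_of A) \<in> ordLeq"
    using assms(2) infinite_iff_card_of_nat by blast
  ultimately show ?thesis by (rule ordLeq_transitive)
qed

lemma increasing_snoc:
  "increasing I (is @ [i]) \<longleftrightarrow> increasing I is \<and> i \<in> Field I \<and> (\<forall>j\<in>set is. (j, i) \<in> I \<and> j \<noteq> i)"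
  by (auto simp: increasing_def sorted_wrt_append)

text \<open>Each stage involves only parameters from C and finitely many earlier tuples, a set of
  size at most |A| since A is infinite, so saturation applies.\<close>

lemma (in monster) generic_sequence:
  assumes "infinite A" and \<Phi>: "\<Phi> \<subseteq> formulas L (univ U) n" "fin_sat_in U n \<Phi> (univ U)"
    and C: "C \<subseteq> univ U" "(card_of C, card_of A) \<in> ordLeq"
  obtains f :: "nat \<Rightarrow> 'a list" where "\<And>i. length (f i) = n" and "\<And>i. set (f i) \<subseteq> univ U"
    and "\<And>i. realizes U (f i) (\<Phi> \<inter> formulas L (C \<union> (\<Union>j<i. set (f j))) n)"
proof -
  define P where "P f i b \<longleftrightarrow> length b = n \<and> set b \<subseteq> univ U \<and>
    realizes U b (\<Phi> \<inter> formulas L (C \<union> (\<Union>j<i. set (f j))) n)" for f and i :: nat and b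
  have "\<exists>f. \<forall>i. P f i (f i)"
  proof (rule dependent_wellorder_choice)
    fix b and f g :: "nat \<Rightarrow> 'a list" and i :: nat
    assume "\<And>j. j < i \<Longrightarrow> f j = g j"
    then show "P f i b = P g i b" by (simp add: P_def)
  next
    fix i :: nat and f :: "nat \<Rightarrow> 'a list" assume f: "\<And>j. j < i \<Longrightarrow> P f j (f j)"
    let ?D = "C \<union> (\<Union>j<i. set (f j))"
    have D: "?D \<subseteq> univ U" using f C(1) by (auto simp: P_def)
    have "(card_of (\<Union>j<i. set (f j)), card_of A) \<in> ordLeq"
      by (rule card_finite_ordLeq[OF _ assms(1)]) simp
    from card_Un_ordLeq[OF assms(1) C(2) this] have card: "(card_of ?D, card_of A) \<in> ordLeq" .
    have "fin_sat_in U n (\<Phi> \<inter> formulas L ?D n) (univ U)" using \<Phi>(2) unfolding fin_sat_in_def by simp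
    then obtain b where "length b = n" "set b \<subseteq> univ U" "realizes U b (\<Phi> \<inter> formulas L ?D n)"
      using realize_partial_type[OF D disjI2[OF card] Int_lower2] by blast
    then show "\<exists>b. P f i b" by (auto simp: P_def)
  qed
  then show thesis using that by (auto simp: P_def)
qed

context monster_extension
begin

text \<open>Induction on adding a largest index i: the earlier tuples realize the Morley power over
  A, and a i realizes p over A and those tuples, so \<open>tensor_over_A\<close> identifies the
  joint type. Leaving the order I general covers omega and omega + omega.\<close>

lemma generic_sequence_tp:
  assumes p: "p \<in> types L U m (univ U)" "invariant L U A p"
    and a: "\<And>i. i \<in> Field I \<Longrightarrow> length (a i) = m" "\<And>i. i \<in> Field I \<Longrightarrow> set (a i) \<subseteq> univ U"
    and generic: "\<And>i \<phi>. i \<in> Field I \<Longrightarrow> \<phi> \<in> p \<Longrightarrow>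
      fm_in L (A \<union> (\<Union>j\<in>{j. (j, i) \<in> I \<and> j \<noteq> i}. set (a j))) m \<phi> \<Longrightarrow> sat U ((!) (a i)) \<phi>"
    and "is \<noteq> []" and "increasing I is"
  shows "tp L U (concat (map a (rev is))) A =
    type_restrict L (length is * m) (morley_power L U N A m p (length is)) A"
  using assms(6,7)
proof (induction "is" rule: rev_nonempty_induct)
  case (single i)
  then have i: "i \<in> Field I" by (simp add: increasing_def)
  have "realizes U (a i) (type_restrict L m p A)"
    using generic[OF i] fm_in_mono[of L A m _ "A \<union> (\<Union>j\<in>{j. (j, i) \<in> I \<and> j \<noteq> i}. set (a j))" m]
    by (auto simp: realizes_def type_restrict_def)
  then have "tp L U (a i) A = type_restrict L m p A"
    using tp_eqI[OF types_restrict[OF p(1) A_subset] a(1)[OF i]] by blast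
  then show ?case by simp
next
  case (snoc i "is")
  let ?c = "concat (map a (rev is))" and ?l = "length is" and ?q = "morley_power L U N A m p (length is)"
  have incr: "increasing I is" and i: "i \<in> Field I" and less: "\<forall>j\<in>set is. (j, i) \<in> I \<and> j \<noteq> i"
    using snoc.prems by (simp_all add: increasing_snoc)
  have Field: "set is \<subseteq> Field I" using incr by (simp add: increasing_def)
  have c: "length ?c = ?l * m" "set ?c \<subseteq> univ U"
    using length_concat_uniform[of "map a (rev is)" m] a Field by (auto simp: subset_iff)
  obtain k where k: "?l = Suc k" using snoc.hyps by (cases "is") auto
  have q: "?q \<in> types L U (?l * m) (univ U)"
    using morley_power_in_types[OF p, of k] unfolding k .
  have power: "morley_power L U N A m p (length (is @ [i])) = tensor L U N A m (?l * m) p ?q"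
    by (simp add: k)
  have IH: "tp L U ?c A = type_restrict L (?l * m) ?q A" by (rule snoc.IH[OF incr])
  have "sat U ((!) (a i @ ?c)) \<phi> \<longleftrightarrow> \<phi> \<in> tensor L U N A m (?l * m) p ?q"
    if \<phi>: "fm_in L A (m + ?l * m) \<phi>" for \<phi>
  proof -
    let ?B = "A \<union> (\<Union>j\<in>{j. (j, i) \<in> I \<and> j \<noteq> i}. set (a j))"
    have "set ?c \<subseteq> ?B" using less by auto
    then have fm: "fm_in L ?B m (inst m ?c \<phi>)"
      by (intro fm_in_inst[of L A]) (use \<phi> c in auto)
    have fmU: "fm_in L (univ U) m (inst m ?c \<phi>)"
      by (rule fm_in_inst[of L A]) (use \<phi> c A_subset in auto)
    have "\<phi> \<in> tensor L U N A m (?l * m) p ?q \<longleftrightarrow> inst m ?c \<phi> \<in> p"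
      by (rule tensor_over_A[OF p q c(2,1) IH \<phi>])
    also have "\<dots> \<longleftrightarrow> sat U ((!) (a i)) (inst m ?c \<phi>)"
      using generic[OF i _ fm] generic[OF i, of "Neg (inst m ?c \<phi>)"] fm types_Neg[OF p(1) fmU] by auto
    also have "\<dots> \<longleftrightarrow> sat U ((!) (a i @ ?c)) \<phi>" using a(1)[OF i] by (rule sat_inst)
    finally show ?thesis by simp
  qed
  then show ?case unfolding power using a(1)[OF i] c(1)
    by (auto simp: tp_def type_restrict_def)
qed

text \<open>Read backwards, the type of an increasing tuple depends only on its length; undoing the
  reversal gives indiscernibility.\<close>

lemma generic_sequence_morley:
  assumes p: "p \<in> types L U m (univ U)" "invariant L U A p"
    and a: "\<And>i. i \<in> Field I \<Longrightarrow> length (a i) = m" "\<And>i. i \<in> Field I \<Longrightarrow> set (a i) \<subseteq> univ U"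
    and generic: "\<And>i \<phi>. i \<in> Field I \<Longrightarrow> \<phi> \<in> p \<Longrightarrow>
      fm_in L (A \<union> (\<Union>j\<in>{j. (j, i) \<in> I \<and> j \<noteq> i}. set (a j))) m \<phi> \<Longrightarrow> sat U ((!) (a i)) \<phi>"
  shows "morley_sequence L U N m A p I a"
proof -
  have tps: "tp L U (concat (map a (rev is))) A =
      type_restrict L (length is * m) (morley_power L U N A m p (length is)) A"
    if "increasing I is" "is \<noteq> []" for "is"
    by (rule generic_sequence_tp[OF p a generic that(2,1)])
  have "tp L U (concat (map a is)) A = tp L U (concat (map a js)) A"
    if incr: "increasing I is" "increasing I js" and len: "length is = length js" for "is" js
  proof (cases "is = []")
    case False
    then have "js \<noteq> []" using len by auto
    have rev_eq: "tp L U (concat (rev (map a is))) A = tp L U (concat (rev (map a js))) A"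
      using tps[OF incr(1) False] tps[OF incr(2) \<open>js \<noteq> []\<close>] len by (simp add: rev_map)
    have "set is \<subseteq> Field I" "set js \<subseteq> Field I" using incr by (auto simp: increasing_def)
    then have "\<forall>x\<in>set (map a is). length x = m" "\<forall>x\<in>set (map a js). length x = m"
      using a(1) by auto
    from tp_eq_concat_rev[OF _ this rev_eq] show ?thesis using len by simp
  qed (use len in simp)
  then show ?thesis
    using tps a unfolding morley_sequence_def indiscernible_def by simp
qed

text \<open>The generic sequence is prolonged by a second \<open>\<omega>\<close>-sequence which is generic also over the
  parameters of \<open>\<phi>\<close>; on the resulting Morley sequence of order type \<open>\<omega> + \<omega>\<close>, both \<open>\<phi>\<close> and its
  negation would hold infinitely often.\<close>

lemma generically_stable_cofinite:
  fixes a :: "nat \<Rightarrow> 'a list"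
  assumes p: "p \<in> types L U m (univ U)" "invariant L U A p"
    and stable: "generically_stable TYPE('i) L U N m A p" and inf: "infinite (UNIV :: 'i set)"
    and "infinite A"
    and a: "\<And>i. length (a i) = m" "\<And>i. set (a i) \<subseteq> univ U"
    and generic: "\<And>i \<phi>. \<phi> \<in> p \<Longrightarrow> fm_in L (A \<union> (\<Union>j<i. set (a j))) m \<phi> \<Longrightarrow> sat U ((!) (a i)) \<phi>"
    and "\<phi> \<in> p"
  shows "finite {i. \<not> sat U ((!) (a i)) \<phi>}"
proof (rule ccontr)
  let ?J = "{i. \<not> sat U ((!) (a i)) \<phi>}"
  assume J: "infinite ?J"
  \<comment> \<open>Only the failures are kept, so that \<phi> fails on the entire first
    half.\<close>
  let ?h = "enumerate ?J"
  have h: "\<not> sat U ((!) (a (?h i))) \<phi>" for i using enumerate_in_set[OF J, of i] by simp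
  \<comment> \<open>The parameters of \<phi> force the second half to satisfy \<phi>; the terms of
    the first half keep the concatenation generic.\<close>
  let ?C = "A \<union> (fm_params \<phi> \<union> (\<Union>i. set (a (?h i))))"
  have \<phi>: "fm_in L (univ U) m \<phi>" using types_fm_in[OF p(1) \<open>\<phi> \<in> p\<close>] .
  have C: "?C \<subseteq> univ U" using A_subset a(2) fm_params_subset[OF \<phi>] by blast
  have "countable (fm_params \<phi> \<union> (\<Union>i. set (a (?h i))))"
    using finite_fm_params[of \<phi>] by (auto intro: countable_finite)
  then have card: "(card_of ?C, card_of A) \<in> ordLeq"
    using card_Un_ordLeq[OF \<open>infinite A\<close> card_of_mono1[OF subset_refl]
        card_countable_ordLeq[OF _ \<open>infinite A\<close>]] by blast
  have p': "p \<subseteq> formulas L (univ U) m" "fin_sat_in U m p (univ U)" using p(1) by (simp_all add: types_def)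
  obtain f :: "nat \<Rightarrow> 'a list" where f: "\<And>i. length (f i) = m" "\<And>i. set (f i) \<subseteq> univ U"
    "\<And>i. realizes U (f i) (p \<inter> formulas L (?C \<union> (\<Union>j<i. set (f j))) m)"
    by (rule generic_sequence[OF \<open>infinite A\<close> p' C card]) blast
  have f\<phi>: "sat U ((!) (f i)) \<phi>" for i
  proof -
    have "fm_in L (?C \<union> (\<Union>j<i. set (f j))) m \<phi>" by (rule fm_in_params[OF \<phi>]) blast
    then show ?thesis using f(3)[of i] \<open>\<phi> \<in> p\<close> by (simp add: realizes_def)
  qed
  \<comment> \<open>The order type omega + omega must live on \<open>'i\<close>: pairs of a Boolean
    and a number, ordered lexicographically with \<open>False\<close> first, are coded into
    \<open>'i\<close> by G.\<close>
  obtain g :: "nat \<Rightarrow> 'i" where "inj g" using infinite_countable_subset[OF inf] by blast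
  define G where "G x = g (prod_encode (of_bool (fst x), snd x))" for x :: "bool \<times> nat"
  have "inj G" by (rule injI) (auto simp: G_def inj_eq[OF \<open>inj g\<close>] prod_eq_iff of_bool_def split: if_splits)
  let ?less = "\<lambda>x y :: bool \<times> nat. fst x < fst y \<or> fst x = fst y \<and> snd x < snd y"
  define R where "R = {(x, y). x = y \<or> ?less x y}"
  define \<alpha> where "\<alpha> = dir_image R G"
  have "(G x, G y) \<in> \<alpha> \<longleftrightarrow> (x, y) \<in> R" for x y
    using inj_eq[OF \<open>inj G\<close>] by (cases x; cases y) (simp add: \<alpha>_def dir_image_def)
  then have \<alpha>: "(G x, G y) \<in> \<alpha> \<longleftrightarrow> x = y \<or> ?less x y" for x y by (simp add: R_def)
  have Field_R: "Field R = UNIV" by (auto simp: Field_def R_def)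
  then have Field: "Field \<alpha> = range G" by (simp add: \<alpha>_def dir_image_Field)
  have "wf (inv_image (less_than <*lex*> less_than) (\<lambda>x :: bool \<times> nat. (of_bool (fst x) :: nat, snd x)))"
    by (intro wf_inv_image wf_lex_prod wf_less_than)
  then have "wf (R - Id)" by (rule wf_subset) (auto simp: R_def)
  moreover have "Linear_order R"
    unfolding linear_order_on_def partial_order_on_def preorder_on_def Field_R
    by (auto simp: R_def refl_on_def trans_def antisym_def total_on_def)
  ultimately have "Well_order R" by (simp add: well_order_on_def)
  then have wo: "Well_order \<alpha>"
    unfolding \<alpha>_def using \<open>inj G\<close> by (intro Well_order_dir_image) (auto simp: inj_on_def)
  define b where "b i = (case inv G i of (False, k) \<Rightarrow> a (?h k) | (True, k) \<Rightarrow> f k)" for i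
  have b: "b (G (False, k)) = a (?h k)" "b (G (True, k)) = f k" for k
    using inv_f_f[OF \<open>inj G\<close>] by (simp_all add: b_def)
  have "morley_sequence L U N m A p \<alpha> b"
  proof (rule generic_sequence_morley[OF p])
    fix i assume "i \<in> Field \<alpha>"
    then obtain x k where i: "i = G (x, k)" by (auto simp: Field)
    show "length (b i) = m" "set (b i) \<subseteq> univ U" using a f b by (cases x; simp add: i)+
    fix \<psi> assume \<psi>: "\<psi> \<in> p" "fm_in L (A \<union> (\<Union>j\<in>{j. (j, i) \<in> \<alpha> \<and> j \<noteq> i}. set (b j))) m \<psi>"
    have prev: "{j. (j, i) \<in> \<alpha> \<and> j \<noteq> i} = G ` {y. ?less y (x, k)}"
    proof (intro set_eqI iffI)
      fix j assume "j \<in> {j. (j, i) \<in> \<alpha> \<and> j \<noteq> i}"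
      moreover from this obtain y where "j = G y" using FieldI1[of j i \<alpha>] Field by blast
      ultimately show "j \<in> G ` {y. ?less y (x, k)}" using \<alpha>[of y "(x, k)"] i by blast
    qed (use \<alpha>[of _ "(x, k)"] inj_eq[OF \<open>inj G\<close>] i in auto)
    show "sat U ((!) (b i)) \<psi>"
    proof (cases x)
      case True
      have "(\<Union>j\<in>{j. (j, i) \<in> \<alpha> \<and> j \<noteq> i}. set (b j)) \<subseteq> (\<Union>i. set (a (?h i))) \<union> (\<Union>j<k. set (f j))"
      proof
        fix c assume "c \<in> (\<Union>j\<in>{j. (j, i) \<in> \<alpha> \<and> j \<noteq> i}. set (b j))"
        then obtain y l where y: "?less (y, l) (x, k)" "c \<in> set (b (G (y, l)))" unfolding prev by auto
        then show "c \<in> (\<Union>i. set (a (?h i))) \<union> (\<Union>j<k. set (f j))" using b by (cases y) auto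
      qed
      then have "fm_in L (?C \<union> (\<Union>j<k. set (f j))) m \<psi>" by (intro fm_in_mono[OF \<psi>(2)]) auto
      then show ?thesis using f(3)[of k] \<psi>(1) b(2) True by (auto simp: realizes_def i)
    next
      case False
      \<comment> \<open>Thinning preserves genericity: the terms kept before \<open>?h k\<close> are
        among the a j with j < \<open>?h k\<close>.\<close>
      have "(\<Union>j\<in>{j. (j, i) \<in> \<alpha> \<and> j \<noteq> i}. set (b j)) \<subseteq> (\<Union>j<?h k. set (a j))"
      proof
        fix c assume "c \<in> (\<Union>j\<in>{j. (j, i) \<in> \<alpha> \<and> j \<noteq> i}. set (b j))"
        then obtain y l where y: "?less (y, l) (x, k)" "c \<in> set (b (G (y, l)))" unfolding prev by auto
        then show "c \<in> (\<Union>j<?h k. set (a j))"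
          using b(1) False enumerate_mono[OF _ J, of l k] by (cases y) auto
      qed
      then have "fm_in L (A \<union> (\<Union>j<?h k. set (a j))) m \<psi>" by (intro fm_in_mono[OF \<psi>(2)]) auto
      then show ?thesis using generic[OF \<psi>(1)] b(1) False by (simp add: i)
    qed
  qed
  moreover have "infinite (Field \<alpha>)"
    using finite_imageD[of G UNIV] \<open>inj G\<close> finite_prod[where 'a = bool and 'b = nat] unfolding Field by auto
  ultimately have S: "{\<phi> \<in> formulas L (univ U) m. finite {i \<in> Field \<alpha>. \<not> sat U ((!) (b i)) \<phi>}}
      \<in> types L U m (univ U)"
    using stable wo unfolding generically_stable_def by blast
  have inf_range: "infinite (range (\<lambda>k. G (y, k)))" for y
    by (rule range_inj_infinite) (use \<open>inj G\<close> in \<open>auto simp: inj_def\<close>)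
  have "range (\<lambda>k. G (False, k)) \<subseteq> {i \<in> Field \<alpha>. \<not> sat U ((!) (b i)) \<phi>}"
    using b(1) h by (auto simp: Field)
  then have "infinite {i \<in> Field \<alpha>. \<not> sat U ((!) (b i)) \<phi>}"
    using inf_range infinite_super by blast
  moreover have "range (\<lambda>k. G (True, k)) \<subseteq> {i \<in> Field \<alpha>. \<not> sat U ((!) (b i)) (Neg \<phi>)}"
    using b(2) f\<phi> by (auto simp: Field)
  then have "infinite {i \<in> Field \<alpha>. \<not> sat U ((!) (b i)) (Neg \<phi>)}"
    using inf_range infinite_super by blast
  ultimately show False using types_Neg[OF S \<phi>] \<phi> by auto
qed

end

text \<open>Each term is the least element of J not taken before. Infinitely many failures along any
  well-order are thus visible along omega.\<close>

lemma Well_order_increasing_sequence: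
  assumes "Well_order \<alpha>" and "J \<subseteq> Field \<alpha>" and "infinite J"
  obtains h :: "nat \<Rightarrow> 'i" where "range h \<subseteq> J" and "\<And>i j. i < j \<Longrightarrow> (h i, h j) \<in> \<alpha> \<and> h i \<noteq> h j"
proof -
  have "\<exists>h :: nat \<Rightarrow> 'i. \<forall>i. h i \<in> J - h ` {..<i} \<and> (\<forall>z\<in>J - h ` {..<i}. (h i, z) \<in> \<alpha>)"
  proof (rule dependent_wellorder_choice)
    fix r and f g :: "nat \<Rightarrow> 'i" and i assume "\<And>j. j < i \<Longrightarrow> f j = g j"
    then have "f ` {..<i} = g ` {..<i}" by (intro image_cong) auto
    then show "(r \<in> J - f ` {..<i} \<and> (\<forall>z\<in>J - f ` {..<i}. (r, z) \<in> \<alpha>)) =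
        (r \<in> J - g ` {..<i} \<and> (\<forall>z\<in>J - g ` {..<i}. (r, z) \<in> \<alpha>))" by simp
  next
    fix i and f :: "nat \<Rightarrow> 'i"
    have wo: "wo_rel \<alpha>" using assms(1) by (simp add: wo_rel_def)
    have "infinite (J - f ` {..<i})" using assms(3) by (simp add: Diff_infinite_finite)
    then have ne: "J - f ` {..<i} \<noteq> {}" by (rule infinite_imp_nonempty)
    have sub: "J - f ` {..<i} \<subseteq> Field \<alpha>" using assms(2) by auto
    obtain r where "wo_rel.isMinim \<alpha> (J - f ` {..<i}) r"
      using wo_rel.Well_order_isMinim_exists[OF wo sub ne] by (elim exE)
    then show "\<exists>r. r \<in> J - f ` {..<i} \<and> (\<forall>z\<in>J - f ` {..<i}. (r, z) \<in> \<alpha>)"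
      unfolding wo_rel.isMinim_def[OF wo] by (rule exI)
  qed
  then obtain h :: "nat \<Rightarrow> 'i" where h: "\<And>i. h i \<in> J - h ` {..<i}" "\<And>i z. z \<in> J - h ` {..<i} \<Longrightarrow> (h i, z) \<in> \<alpha>"
    by blast
  have "(h i, h j) \<in> \<alpha> \<and> h i \<noteq> h j" if "i < j" for i j
  proof
    have "h j \<notin> h ` {..<j}" using h(1)[of j] by blast
    moreover have "h ` {..<i} \<subseteq> h ` {..<j}" using that by auto
    ultimately have "h j \<in> J - h ` {..<i}" using h(1)[of j] by blast
    then show "(h i, h j) \<in> \<alpha>" by (rule h(2))
    show "h i \<noteq> h j" using \<open>h j \<notin> h ` {..<j}\<close> that by (metis imageI lessThan_iff)
  qed
  moreover have "range h \<subseteq> J" using h(1) by blast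
  ultimately show thesis using that by blast
qed

section \<open>Domination of generically stable types\<close>

locale domination_extension = domination L U A m n p q r + monster_extension L U A N
  for L :: "('f, 'r) lang" and U :: "('f, 'r, 'a) struct" and A :: "'a set"
    and m n :: nat and p q r :: "('f, 'r, 'a) fm set" and N :: "('f, 'r, 'a) struct"
begin

text \<open>Pairs are generic for p, r and q jointly over A and all earlier pairs. Each half is then
  generic over its own earlier terms, and r, being a type over A, is realized in full by every
  pair.\<close>

lemma joint_generic_sequence:
  assumes "infinite A"
  obtains a b :: "nat \<Rightarrow> 'a list" where "\<And>i. length (a i) = m" and "\<And>i. set (a i) \<subseteq> univ U"
    and "\<And>i. length (b i) = n" and "\<And>i. set (b i) \<subseteq> univ U"
    and "\<And>i. realizes U (a i @ b i) r"
    and "\<And>i \<phi>. \<phi> \<in> p \<Longrightarrow> fm_in L (A \<union> (\<Union>j<i. set (a j))) m \<phi> \<Longrightarrow> sat U ((!) (a i)) \<phi>"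
    and "\<And>i \<phi>. \<phi> \<in> q \<Longrightarrow> fm_in L (A \<union> (\<Union>j<i. set (b j))) n \<phi> \<Longrightarrow> sat U ((!) (b i)) \<phi>"
proof -
  let ?\<Phi> = "p \<union> r \<union> shift m ` q"
  have \<Phi>: "?\<Phi> \<subseteq> formulas L (univ U) (m + n)"
  proof
    fix \<phi> assume "\<phi> \<in> ?\<Phi>"
    then consider "\<phi> \<in> p" | "\<phi> \<in> r" | \<psi> where "\<psi> \<in> q" "\<phi> = shift m \<psi>" by blast
    then show "\<phi> \<in> formulas L (univ U) (m + n)"
    proof cases
      case 1
      then show ?thesis using fm_in_mono[OF types_fm_in[OF p(1)] subset_refl, of \<phi> "m + n"] by simp
    next
      case 2
      then show ?thesis using fm_in_mono[OF types_fm_in[OF r_type] A_subset, of \<phi> "m + n"] by simp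
    next
      case 3
      then show ?thesis using fm_in_shift[OF types_fm_in[OF q(1)]] by simp
    qed
  qed
  obtain c :: "nat \<Rightarrow> 'a list" where c: "\<And>i. length (c i) = m + n" "\<And>i. set (c i) \<subseteq> univ U"
    "\<And>i. realizes U (c i) (?\<Phi> \<inter> formulas L (A \<union> (\<Union>j<i. set (c j))) (m + n))"
    by (rule generic_sequence[OF assms \<Phi> p_q_r_consistent A_subset card_of_mono1[OF subset_refl]]) blast
  define a b where "a i = take m (c i)" and "b i = drop m (c i)" for i
  have ab: "c i = a i @ b i" "length (a i) = m" "length (b i) = n"
    "set (a i) \<subseteq> set (c i)" "set (b i) \<subseteq> set (c i)" for i
    using c(1)[of i] set_take_subset[of m "c i"] set_drop_subset[of m "c i"] by (auto simp: a_def b_def)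
  have sat_c: "sat U ((!) (c i)) \<phi>"
    if "\<phi> \<in> ?\<Phi>" "fm_in L (A \<union> (\<Union>j<i. set (c j))) (m + n) \<phi>" for i \<phi>
    using c(3)[of i] that by (simp add: realizes_def)
  show thesis
  proof (rule that[of a b])
    fix i
    show "length (a i) = m" "length (b i) = n" using ab by auto
    show "set (a i) \<subseteq> univ U" "set (b i) \<subseteq> univ U" using ab(4,5)[of i] c(2)[of i] by auto
    show "realizes U (a i @ b i) r"
      unfolding realizes_def
    proof
      fix \<phi> assume "\<phi> \<in> r"
      then have "fm_in L (A \<union> (\<Union>j<i. set (c j))) (m + n) \<phi>"
        using fm_in_mono[OF types_fm_in[OF r_type]] by simp
      then show "sat U ((!) (a i @ b i)) \<phi>" using sat_c[of \<phi> i] \<open>\<phi> \<in> r\<close> by (simp add: ab(1))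
    qed
  next
    fix i \<phi> assume \<phi>: "\<phi> \<in> p" "fm_in L (A \<union> (\<Union>j<i. set (a j))) m \<phi>"
    have "A \<union> (\<Union>j<i. set (a j)) \<subseteq> A \<union> (\<Union>j<i. set (c j))" using ab(4) by blast
    then have "fm_in L (A \<union> (\<Union>j<i. set (c j))) (m + n) \<phi>" by (rule fm_in_mono[OF \<phi>(2)]) simp
    then have "sat U ((!) (a i @ b i)) \<phi>" using sat_c[of \<phi> i] \<phi>(1) by (simp add: ab(1))
    then show "sat U ((!) (a i)) \<phi>" by (simp add: sat_append_left[OF \<phi>(2) ab(2)])
  next
    fix i \<phi> assume \<phi>: "\<phi> \<in> q" "fm_in L (A \<union> (\<Union>j<i. set (b j))) n \<phi>"
    have "A \<union> (\<Union>j<i. set (b j)) \<subseteq> A \<union> (\<Union>j<i. set (c j))" using ab(5) by blast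
    then have "fm_in L (A \<union> (\<Union>j<i. set (c j))) (m + n) (shift m \<phi>)"
      by (intro fm_in_shift fm_in_mono[OF \<phi>(2)]) simp_all
    then have "sat U ((!) (c i)) (shift m \<phi>)" using sat_c[of "shift m \<phi>" i] \<phi>(1) by simp
    then show "sat U ((!) (b i)) \<phi>" by (simp add: sat_shift[OF \<phi>(2) c(1)] b_def)
  qed
qed

text \<open>An automorphism \<open>g\<close> carries a Morley sequence \<open>b\<close> of \<open>q\<close> to the second half \<open>b'\<close> of a joint generic
  sequence, so that failure of \<open>\<psi> \<in> q\<close> along \<open>b\<close> becomes failure of \<open>g \<psi> \<in> q\<close> along \<open>b'\<close>, hence of
  some formula of \<open>p\<close> along the first half.\<close>

lemma generically_stable_dominated:
  assumes M: "model L U A" and inf: "infinite (univ U)" and stable: "generically_stable TYPE('i) L U N m A p"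
  shows "generically_stable TYPE('i) L U N n A q"
  unfolding generically_stable_def
proof (intro conjI allI impI q(2))
  fix \<alpha> :: "'i rel" and b
  assume "Well_order \<alpha> \<and> infinite (Field \<alpha>) \<and> morley_sequence L U N n A q \<alpha> b"
  then have \<alpha>: "Well_order \<alpha>" "infinite (Field \<alpha>)" and b: "morley_sequence L U N n A q \<alpha> b" by auto
  have b_len: "length (b i) = n" "set (b i) \<subseteq> univ U" if "i \<in> Field \<alpha>" for i
    using b that by (auto simp: morley_sequence_def)
  have "infinite A" by (rule model_infinite[OF M inf])
  have inf_i: "infinite (UNIV :: 'i set)" by (rule infinite_super[OF subset_UNIV \<alpha>(2)])
  \<comment> \<open>Once every formula of q holds at almost all indices, the eventual set inherits
    completeness from q.\<close>
  have cofinite: "finite {i \<in> Field \<alpha>. \<not> sat U ((!) (b i)) \<psi>}" if "\<psi> \<in> q" for \<psi>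
  proof (rule ccontr)
    assume "infinite {i \<in> Field \<alpha>. \<not> sat U ((!) (b i)) \<psi>}"
    then obtain h :: "nat \<Rightarrow> 'i" where h: "range h \<subseteq> {i \<in> Field \<alpha>. \<not> sat U ((!) (b i)) \<psi>}"
      "\<And>i j. i < j \<Longrightarrow> (h i, h j) \<in> \<alpha> \<and> h i \<noteq> h j"
      by (rule Well_order_increasing_sequence[OF \<alpha>(1), rotated]) auto
    have h': "h i \<in> Field \<alpha>" "\<not> sat U ((!) (b (h i))) \<psi>" for i using h(1) by auto
    obtain a b' :: "nat \<Rightarrow> 'a list" where a: "\<And>i. length (a i) = m" "\<And>i. set (a i) \<subseteq> univ U"
      and b': "\<And>i. length (b' i) = n" "\<And>i. set (b' i) \<subseteq> univ U"
      and r: "\<And>i. realizes U (a i @ b' i) r"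
      and a_gen: "\<And>i \<phi>. \<phi> \<in> p \<Longrightarrow> fm_in L (A \<union> (\<Union>j<i. set (a j))) m \<phi> \<Longrightarrow> sat U ((!) (a i)) \<phi>"
      and b'_gen: "\<And>i \<phi>. \<phi> \<in> q \<Longrightarrow> fm_in L (A \<union> (\<Union>j<i. set (b' j))) n \<phi> \<Longrightarrow> sat U ((!) (b' i)) \<phi>"
      by (rule joint_generic_sequence[OF \<open>infinite A\<close>]) blast
    \<comment> \<open>Read backwards, the first k terms of either sequence realize the k-th Morley
      power of q over A.\<close>
    have tps: "tp L U (concat (map (b \<circ> h) [0..<k])) A = tp L U (concat (map b' [0..<k])) A" for k
    proof (cases k)
      case (Suc l)
      let ?le = "{(i, j). i \<le> j} :: nat rel"
      have "{j. (j, i) \<in> ?le \<and> j \<noteq> i} = {..<i}" for i by auto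
      moreover have "increasing ?le [0..<k]"
        by (auto simp: increasing_def Field_def sorted_wrt_upt intro!: sorted_wrt_mono_rel[OF _ sorted_wrt_upt])
      ultimately have "tp L U (concat (map b' (rev [0..<k]))) A =
          type_restrict L (k * n) (morley_power L U N A n q k) A"
        using generic_sequence_tp[OF q, of ?le b' "[0..<k]"] b' b'_gen Suc by simp
      moreover have "increasing \<alpha> (map h [0..<k])"
        using h' h(2) by (auto simp: increasing_def sorted_wrt_map intro!: sorted_wrt_mono_rel[OF _ sorted_wrt_upt])
      then have "tp L U (concat (map b (rev (map h [0..<k])))) A =
          type_restrict L (k * n) (morley_power L U N A n q k) A"
        using b Suc unfolding morley_sequence_def
        by (elim conjE allE[of _ "map h [0..<k]"]) simp
      ultimately have "tp L U (concat (rev (map (b \<circ> h) [0..<k]))) A = tp L U (concat (rev (map b' [0..<k]))) A"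
        by (simp add: rev_map)
      then show ?thesis
        by (rule tp_eq_concat_rev[of _ _ n, rotated 3]) (use b_len[OF h'(1)] b' in auto)
    qed simp
    \<comment> \<open>All coordinates of the sequence, indexed by term and position; they are
      countably many, hence small.\<close>
    let ?J = "(UNIV :: nat set) \<times> {..<n}"
    let ?e = "\<lambda>(i, t). (b \<circ> h) i ! t" and ?e' = "\<lambda>(i, t). b' i ! t"
    have nth: "x ! t \<in> univ U" if "length x = n" "set x \<subseteq> univ U" "t < n" for x t
      using that nth_mem[of t x] by blast
    have e: "?e ` ?J \<subseteq> univ U" using nth[OF b_len[OF h'(1)]] by auto
    have e': "?e' ` ?J \<subseteq> univ U" using nth[OF b'] by auto
    have "countable (?e ` ?J)" by (rule countable_image) simp
    then have card: "finite (?e ` ?J) \<or> (card_of (?e ` ?J), card_of A) \<in> ordLeq"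
      using card_countable_ordLeq[OF _ \<open>infinite A\<close>] by blast
    have "tp L U (map ?e js) A = tp L U (map ?e' js) A" if js: "set js \<subseteq> ?J" for js
    proof -
      obtain k where k: "\<forall>i\<in>fst ` set js. i < k" using finite_nat_set_iff_bounded by blast
      then have js': "\<forall>(i, t)\<in>set js. i < length (map b' [0..<k]) \<and> t < n" using js by force
      have "tp L U (map (\<lambda>(i, t). map (b \<circ> h) [0..<k] ! i ! t) js) A =
          tp L U (map (\<lambda>(i, t). map b' [0..<k] ! i ! t) js) A"
        by (rule tp_eq_concat_select[OF _ _ _ tps js']) (use b_len[OF h'(1)] b' in auto)
      moreover have "map (\<lambda>(i, t). map f [0..<k] ! i ! t) js = map (\<lambda>(i, t). f i ! t) js" for f :: "nat \<Rightarrow> 'a list"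
        using k by auto
      ultimately show ?thesis by simp
    qed
    from automorphism_extending_over_A[OF e e' card this]
    obtain g where g: "automorphism L U g" "\<forall>c\<in>A. g c = c" "\<And>j. j \<in> ?J \<Longrightarrow> g (?e j) = ?e' j" by blast
    have gb: "map g (b (h i)) = b' i" for i
      using g(3)[of "(i, t)" for t] b_len[OF h'(1)] b' by (intro nth_equalityI) auto
    have "map_fm id id g ` q = q" using q(2) g unfolding invariant_def by blast
    then have "map_fm id id g \<psi> \<in> q" using \<open>\<psi> \<in> q\<close> by blast
    have b'_fails: "\<not> sat U ((!) (b' i)) (map_fm id id g \<psi>)" for i
      using sat_map_automorphism[OF struct g(1), of "b (h i)" \<psi>] types_fm_in[OF q(1) \<open>\<psi> \<in> q\<close>]
        b_len[OF h'(1)] h'(2) gb by simp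
    obtain G where G: "finite G" "G \<subseteq> p \<union> r" "\<And>c. length c = m + n \<Longrightarrow> set c \<subseteq> univ U \<Longrightarrow>
        realizes U c G \<Longrightarrow> realizes U c (shift m ` {map_fm id id g \<psi>})"
      using entails_finite[of "{map_fm id id g \<psi>}"] \<open>map_fm id id g \<psi> \<in> q\<close> by auto
    have fin: "finite (G \<inter> p)" "G \<inter> p \<subseteq> p" using G(1) by auto
    obtain \<phi> where \<phi>: "\<phi> \<in> p" "fm_in L (univ U) m \<phi>" "\<And>S e. sat S e \<phi> \<longleftrightarrow> (\<forall>\<phi>\<in>G \<inter> p. sat S e \<phi>)"
      by (rule types_conj[OF p(1) fin]) blast
    \<comment> \<open>Every pair realizes r, so the entailment of the failing formula can break down
      only on its hypotheses from p, whose conjunction is \<phi>.\<close>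
    have "\<not> sat U ((!) (a i)) \<phi>" for i
    proof
      assume "sat U ((!) (a i)) \<phi>"
      then have "sat U ((!) (a i @ b' i)) \<phi>" by (simp add: sat_append_left[OF \<phi>(2) a(1)])
      then have "realizes U (a i @ b' i) (G \<inter> p)" by (simp add: \<phi>(3) realizes_def)
      then have "realizes U (a i @ b' i) G" using r[of i] G(2) by (auto simp: realizes_def)
      then have "sat U ((!) (a i @ b' i)) (shift m (map_fm id id g \<psi>))"
        using G(3)[of "a i @ b' i"] a b' by (simp add: realizes_def)
      then show False
        using sat_shift[OF types_fm_in[OF q(1) \<open>map_fm id id g \<psi> \<in> q\<close>], of "a i @ b' i" m U] a b' b'_fails[of i]
        by simp
    qed
    moreover have "finite {i. \<not> sat U ((!) (a i)) \<phi>}"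
      by (rule generically_stable_cofinite[OF p stable inf_i \<open>infinite A\<close> a a_gen \<phi>(1)])
    ultimately show False by simp
  qed
  let ?S = "{\<phi> \<in> formulas L (univ U) n. finite {i \<in> Field \<alpha>. \<not> sat U ((!) (b i)) \<phi>}}"
  have "\<phi> \<in> ?S \<or> Neg \<phi> \<in> ?S" if "fm_in L (univ U) n \<phi>" for \<phi>
    using types_Neg[OF q(1) that] cofinite[of \<phi>] cofinite[of "Neg \<phi>"] that by auto
  \<comment> \<open>Finitely many eventual formulas fail at finitely many indices altogether, so a
    term of the infinite sequence satisfies them all.\<close>
  moreover have "\<exists>c\<in>tuples n (univ U). realizes U c F" if F: "finite F" "F \<subseteq> ?S" for F
  proof -
    have fin: "finite (\<Union>\<phi>\<in>F. {i \<in> Field \<alpha>. \<not> sat U ((!) (b i)) \<phi>})" using F by auto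
    have "\<not> Field \<alpha> \<subseteq> (\<Union>\<phi>\<in>F. {i \<in> Field \<alpha>. \<not> sat U ((!) (b i)) \<phi>})"
      by (rule contrapos_nn[OF \<alpha>(2) finite_subset[OF _ fin]])
    then obtain i where i: "i \<in> Field \<alpha>" "i \<notin> (\<Union>\<phi>\<in>F. {i \<in> Field \<alpha>. \<not> sat U ((!) (b i)) \<phi>})"
      unfolding subset_iff not_all not_imp by (elim exE conjE)
    then show ?thesis using b_len[OF i(1)] by (intro bexI[of _ "b i"]) (auto simp: realizes_def)
  qed
  moreover have "?S \<subseteq> formulas L (univ U) n" by blast
  ultimately show "?S \<in> types L U n (univ U)" unfolding types_def fin_sat_in_def by simp
qed

end

theorem theorem3p5:
  fixes L :: "('f, 'r) lang"
    and U :: "('f, 'r, 'a) struct"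
    and A :: "'a set"
    and m n :: nat
    and p q r :: "('f, 'r, 'a) fm set"
  assumes "is_struct L U" and "infinite (univ U)"
    and "small L U A"
    and "p \<in> types L U m (univ U)" and "invariant L U A p"
    and "q \<in> types L U n (univ U)" and "invariant L U A q"
    and "r \<in> types_extending L U m n A p q"
    and "entails U (m + n) (p \<union> r) (shift m ` q)"
  shows "(model L U A \<and> fin_sat_in U m p A \<longrightarrow> fin_sat_in U n q A) \<and>
    (definable_over L U m A p \<longrightarrow> definable_over L U n A q) \<and>
    (\<forall>N. realizes_global_types L U N \<and> model L U A \<and>
       generically_stable TYPE('i) L U N m A p \<longrightarrow> generically_stable TYPE('i) L U N n A q)"
proof -
  interpret domination L U A m n p q r
    by unfold_locales (use assms in auto)
  have "generically_stable TYPE('i) L U N n A q"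
    if "realizes_global_types L U N" "model L U A" "generically_stable TYPE('i) L U N m A p" for N
  proof -
    interpret domination_extension L U A m n p q r N
      by unfold_locales (rule that(1))
    show ?thesis by (rule generically_stable_dominated[OF that(2) assms(2) that(3)])
  qed
  then show ?thesis
    using fin_sat_in_dominated definable_over_dominated by blast
qed

end
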